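(* The six elements $\dot B^{(1)}_{tz},\ \dot B^{(2)}_{tz},\ \dot R^{(1)}_{x\ell},\ \dot A_\ell,\ \dot G_\ell,\ \dot S^{(1)}_\ell$ of $sl(3,\mathbb O)$ are linearly independent, commute pairwise, and span a Cartan subalgebra of the complexified Lie algebra $sl(3,\mathbb O)\otimes\mathbb C\cong E_6$.
   Context: Octonions: $\mathbb O$ has real basis $1,i,j,k,k\ell,j\ell,i\ell,\ell$; the seven imaginary units square to $-1$ and anticommute, and each ordered triple $(i,j,k),(i,\ell,i\ell),(j,\ell,j\ell),(k,\ell,k\ell),(k\ell,j,i\ell),(i\ell,k,j\ell),(j\ell,i,k\ell)$ is a quaternionic triple $(p,q,r)$: $pq=r,\ qr=p,\ rp=q$. $M_3(\mathbb O)$ is the 27-dimensional real space of $3\times3$ octonionic hermitian matrices $\chi$ (first row $(p,\bar a,c)$, second row $(a,m,\bar b)$, third row $(\bar c,b,n)$), with $\det\chi=pmn-(p|b|^2+m|c|^2+n|a|^2)+2\,\mathrm{Re}(\bar a\bar b\bar c)$. $SL(3,\mathbb O)$ is the group of real-linear maps of $M_3(\mathbb O)$ preserving $\det$, and $sl(3,\mathbb O)$ is its Lie algebra, a real form of $E_6$. For a $2\times2$ matrix $M$, let $M^{(1)}=\mathrm{diag}(M,1)$ and $M^{(2)}=\mathrm{diag}(1,M)$ (block diagonal $3\times 3$ matrices). $B^{(a)}_{tz}(\alpha)$ is $\chi\mapsto M^{(a)}\chi M^{(a)\dagger}$ with $M=\mathrm{diag}(e^{\alpha/2},e^{-\alpha/2})$;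 $R^{(1)}_{x\ell}(\alpha)$ is $\chi\mapsto M^{(1)}\chi M^{(1)\dagger}$ with $M=\mathrm{diag}(e^{\ell\alpha/2},e^{-\ell\alpha/2})$. For imaginary basis units $p\neq q$, $R^{(1)}_{p,q}(\alpha)$ is $\chi\mapsto M_2^{(1)}(M_1^{(1)}\chi M_1^{(1)\dagger})M_2^{(1)\dagger}$ with $M_1=-p\,I_2$, $M_2=(\cos\frac\alpha2\,p+\sin\frac\alpha2\,q)I_2$, where $I_2$ is the $2\times2$ identity. Then $A_\ell(\alpha)=R^{(1)}_{i\ell,i}(\alpha)\circ R^{(1)}_{j\ell,j}(-\alpha)$, $G_\ell(\alpha)=R^{(1)}_{i\ell,i}(\alpha)\circ R^{(1)}_{j\ell,j}(\alpha)\circ R^{(1)}_{k\ell,k}(-2\alpha)$, $S^{(1)}_\ell(\alpha)=R^{(1)}_{i\ell,i}(\alpha)\circ R^{(1)}_{j\ell,j}(\alpha)\circ R^{(1)}_{k\ell,k}(\alpha)$. A dot denotes $\frac{d}{d\alpha}|_{\alpha=0}$, giving an element of $sl(3,\mathbb O)$. *)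

theory Defs
  imports "HOL-Analysis.Analysis"
begin

section \<open>Octonions\<close>

datatype octunit = One | I | J | K | KL | JL | IL | L

instantiation octunit :: finite
begin

instance
proof
  have "(UNIV :: octunit set) = {One, I, J, K, KL, JL, IL, L}"
    using octunit.exhaust by auto
  then show "finite (UNIV :: octunit set)"
    by (metis finite.emptyI finite.insertI)
qed

end

lemma UNIV_octunit: "(UNIV :: octunit set) = {One, I, J, K, KL, JL, IL, L}"
  using octunit.exhaust by auto

type_synonym oct = "real ^ octunit"

definition quat_triples :: "(octunit \<times> octunit \<times> octunit) set" where
  "quat_triples =
     {(I, J, K), (I, L, IL), (J, L, JL), (K, L, KL), (KL, J, IL), (IL, K, JL), (JL, I, KL)}"

definition cyclic_triple :: "octunit \<Rightarrow> octunit \<Rightarrow> octunit \<Rightarrow> bool" where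
  "cyclic_triple p q r \<longleftrightarrow>
     (p, q, r) \<in> quat_triples \<or> (q, r, p) \<in> quat_triples \<or> (r, p, q) \<in> quat_triples"

text \<open>The coefficient of the unit \<open>u\<close> in the product of the units \<open>s\<close> and \<open>t\<close>.\<close>

definition unit_coeff :: "octunit \<Rightarrow> octunit \<Rightarrow> octunit \<Rightarrow> real" where
  "unit_coeff s t u =
     (if s = One then (if u = t then 1 else 0)
      else if t = One then (if u = s then 1 else 0)
      else if s = t then (if u = One then -1 else 0)
      else if cyclic_triple s t u then 1
      else if cyclic_triple t s u then -1
      else 0)"

text \<open>A separate symbol is needed because \<open>*\<close> on \<open>real ^ _\<close> is the componentwise product.\<close>

definition octmult :: "oct \<Rightarrow> oct \<Rightarrow> oct" (infixl "\<odot>" 70) where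
  "x \<odot> y = (\<chi> u. \<Sum>s\<in>UNIV. \<Sum>t\<in>UNIV. unit_coeff s t u * (x $ s) * (y $ t))"

definition octunit_vec :: "octunit \<Rightarrow> oct" where
  "octunit_vec u = axis u 1"

definition oct_of_real :: "real \<Rightarrow> oct" where
  "oct_of_real r = r *\<^sub>R octunit_vec One"

definition oct_Re :: "oct \<Rightarrow> real" where
  "oct_Re x = x $ One"

definition oct_cnj :: "oct \<Rightarrow> oct" where
  "oct_cnj x = (\<chi> u. if u = One then x $ u else - (x $ u))"

primrec oct_power :: "oct \<Rightarrow> nat \<Rightarrow> oct" where
  "oct_power x 0 = oct_of_real 1"
| "oct_power x (Suc n) = x \<odot> oct_power x n"

definition oct_exp :: "oct \<Rightarrow> oct" where
  "oct_exp x = (\<Sum>n. oct_power x n /\<^sub>R fact n)"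

lemma octmult_nth:
  "(x \<odot> y) $ One = x$One*y$One - x$I*y$I - x$J*y$J - x$K*y$K - x$KL*y$KL - x$JL*y$JL - x$IL*y$IL - x$L*y$L"
  "(x \<odot> y) $ I = x$One*y$I + x$I*y$One + x$J*y$K - x$K*y$J + x$L*y$IL - x$IL*y$L + x$KL*y$JL - x$JL*y$KL"
  "(x \<odot> y) $ J = x$One*y$J + x$J*y$One + x$K*y$I - x$I*y$K + x$L*y$JL - x$JL*y$L + x$IL*y$KL - x$KL*y$IL"
  "(x \<odot> y) $ K = x$One*y$K + x$K*y$One + x$I*y$J - x$J*y$I + x$L*y$KL - x$KL*y$L + x$JL*y$IL - x$IL*y$JL"
  "(x \<odot> y) $ KL = x$One*y$KL + x$KL*y$One + x$K*y$L - x$L*y$K + x$J*y$IL - x$IL*y$J + x$JL*y$I - x$I*y$JL"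
  "(x \<odot> y) $ JL = x$One*y$JL + x$JL*y$One + x$J*y$L - x$L*y$J + x$IL*y$K - x$K*y$IL + x$I*y$KL - x$KL*y$I"
  "(x \<odot> y) $ IL = x$One*y$IL + x$IL*y$One + x$I*y$L - x$L*y$I + x$KL*y$J - x$J*y$KL + x$K*y$JL - x$JL*y$K"
  "(x \<odot> y) $ L = x$One*y$L + x$L*y$One + x$IL*y$I - x$I*y$IL + x$JL*y$J - x$J*y$JL + x$KL*y$K - x$K*y$KL"
  by (simp_all add: octmult_def UNIV_octunit unit_coeff_def cyclic_triple_def quat_triples_def)

lemma oct_eq_iff: "x = y \<longleftrightarrow> x$One = y$One \<and> x$I = y$I \<and> x$J = y$J \<and> x$K = y$K \<and>
    x$KL = y$KL \<and> x$JL = y$JL \<and> x$IL = y$IL \<and> x$L = y$L" for x y :: oct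
proof -
  have "(\<forall>u. P u) \<longleftrightarrow> P One \<and> P I \<and> P J \<and> P K \<and> P KL \<and> P JL \<and> P IL \<and> P L" for P
    using octunit.exhaust by (auto intro: octunit.induct)
  then show ?thesis
    by (simp add: vec_eq_iff)
qed

lemma oct_cnj_simps [simp]:
  "oct_cnj (oct_cnj x) = x"
  "oct_cnj (x + y) = oct_cnj x + oct_cnj y"
  "oct_cnj (r *\<^sub>R x) = r *\<^sub>R oct_cnj x"
  "oct_cnj 0 = 0"
  by (simp_all add: oct_cnj_def vec_eq_iff)

lemma oct_cnj_mult: "oct_cnj (x \<odot> y) = oct_cnj y \<odot> oct_cnj x"
  by (simp add: oct_eq_iff octmult_nth oct_cnj_def)

lemma linear_octmult_left: "linear (\<lambda>x. x \<odot> y)"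
  by (rule linearI) (simp_all add: oct_eq_iff octmult_nth algebra_simps)

lemma linear_octmult_right: "linear (\<lambda>y. x \<odot> y)"
  by (rule linearI) (simp_all add: oct_eq_iff octmult_nth algebra_simps)


section \<open>Hermitian matrices and the determinant\<close>

definition omat_mult :: "oct^3^3 \<Rightarrow> oct^3^3 \<Rightarrow> oct^3^3" (infixl "\<odot>\<odot>" 70) where
  "A \<odot>\<odot> B = (\<chi> i j. \<Sum>k\<in>UNIV. A $ i $ k \<odot> B $ k $ j)"

definition omat_dagger :: "oct^3^3 \<Rightarrow> oct^3^3" where
  "omat_dagger A = (\<chi> i j. oct_cnj (A $ j $ i))"

text \<open>A Hermitian matrix is represented by its independent entries \<open>(p, m, n, a, b, c)\<close>; the
  lemmas \<open>herm_coords_mat\<close>, \<open>herm_mat_coords\<close> and \<open>range_herm_mat\<close> below identify these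
  tuples with the Hermitian matrices.\<close>

type_synonym herm3 = "real \<times> real \<times> real \<times> oct \<times> oct \<times> oct"

fun herm_mat :: "herm3 \<Rightarrow> oct^3^3" where
  "herm_mat (p, m, n, a, b, c) = vector
     [vector [oct_of_real p, oct_cnj a, c],
      vector [a, oct_of_real m, oct_cnj b],
      vector [oct_cnj c, b, oct_of_real n]]"

definition herm_coords :: "oct^3^3 \<Rightarrow> herm3" where
  "herm_coords A = (oct_Re (A$1$1), oct_Re (A$2$2), oct_Re (A$3$3), A$2$1, A$3$2, A$1$3)"

fun herm_det :: "herm3 \<Rightarrow> real" where
  "herm_det (p, m, n, a, b, c) =
     p * m * n - (p * (norm b)\<^sup>2 + m * (norm c)\<^sup>2 + n * (norm a)\<^sup>2)
     + 2 * oct_Re ((oct_cnj a \<odot> oct_cnj b) \<odot> oct_cnj c)"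

lemma oct_of_real_Re: "oct_cnj x = x \<longleftrightarrow> oct_of_real (oct_Re x) = x"
  by (auto simp: oct_eq_iff oct_cnj_def oct_of_real_def oct_Re_def octunit_vec_def axis_def)

lemma oct_Re_of_real [simp]: "oct_Re (oct_of_real r) = r"
  by (simp add: oct_Re_def oct_of_real_def octunit_vec_def axis_def)

lemma herm_coords_mat: "herm_coords (herm_mat x) = x"
  by (cases x) (simp add: herm_coords_def)

lemma herm_mat_hermitian: "omat_dagger (herm_mat x) = herm_mat x"
  by (cases x) (simp add: omat_dagger_def vec_eq_iff[where 'b=3] forall_3 oct_of_real_Re)

lemma herm_mat_coords: "omat_dagger A = A \<Longrightarrow> herm_mat (herm_coords A) = A"
  by (simp add: herm_coords_def omat_dagger_def vec_eq_iff[where 'b=3] forall_3 oct_of_real_Re)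

lemma range_herm_mat: "range herm_mat = {A. omat_dagger A = A}"
proof
  show "range herm_mat \<subseteq> {A. omat_dagger A = A}"
    using herm_mat_hermitian by blast
  show "{A. omat_dagger A = A} \<subseteq> range herm_mat"
  proof
    fix A assume "A \<in> {A. omat_dagger A = A}"
    then have "A = herm_mat (herm_coords A)"
      by (simp add: herm_mat_coords)
    then show "A \<in> range herm_mat"
      by (rule range_eqI)
  qed
qed


section \<open>The group and its Lie algebra\<close>

text \<open>In finite dimension every linear map is bounded, and a linear map preserving the
  nondegenerate cubic form \<open>herm_det\<close> is invertible.\<close>

definition SL3O :: "(herm3 \<Rightarrow>\<^sub>L herm3) set" where
  "SL3O = {g. \<forall>x. herm_det (blinfun_apply g x) = herm_det x}"

text \<open>The Lie algebra is the tangent space at the identity.\<close>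

definition sl3O :: "(herm3 \<Rightarrow>\<^sub>L herm3) set" where
  "sl3O = {X. \<exists>\<gamma>. (\<forall>t. \<gamma> t \<in> SL3O) \<and> \<gamma> 0 = id_blinfun \<and> (\<gamma> has_vector_derivative X) (at 0)}"

definition commutator :: "('a::real_normed_vector \<Rightarrow>\<^sub>L 'a) \<Rightarrow> ('a \<Rightarrow>\<^sub>L 'a) \<Rightarrow> ('a \<Rightarrow>\<^sub>L 'a)" where
  "commutator X Y = (X o\<^sub>L Y) - (Y o\<^sub>L X)"

text \<open>The map taking \<open>x\<close> to \<open>M x M\<^sup>\<dagger>\<close>.  Lemma \<open>herm_mat_conj\<close> shows that the product
  is Hermitian, and independent of the bracketing, when the entries of \<open>M\<close> lie in a common
  complex subalgebra; the matrices used below are of this kind.\<close>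

lift_definition conj_action :: "oct^3^3 \<Rightarrow> (herm3 \<Rightarrow>\<^sub>L herm3)" is
  "\<lambda>M x. herm_coords ((M \<odot>\<odot> herm_mat x) \<odot>\<odot> omat_dagger M)"
proof -
  fix M :: "oct^3^3"
  have 1: "linear herm_mat"
    by (rule linearI) (auto simp: vec_eq_iff[where 'b=3] forall_3 oct_of_real_def algebra_simps)
  have 2: "linear (\<lambda>A. M \<odot>\<odot> A)"
    by (rule linearI) (simp_all add: omat_mult_def vec_eq_iff[where 'b=3]
      linear_add[OF linear_octmult_right] linear_scale[OF linear_octmult_right]
      sum.distrib scaleR_sum_right)
  have 3: "linear (\<lambda>A. A \<odot>\<odot> omat_dagger M)"
    by (rule linearI) (simp_all add: omat_mult_def vec_eq_iff[where 'b=3]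
      linear_add[OF linear_octmult_left] linear_scale[OF linear_octmult_left]
      sum.distrib scaleR_sum_right)
  have 4: "linear herm_coords"
    by (rule linearI) (simp_all add: herm_coords_def oct_Re_def)
  have "linear (herm_coords \<circ> (\<lambda>A. A \<odot>\<odot> omat_dagger M) \<circ> (\<lambda>A. M \<odot>\<odot> A) \<circ> herm_mat)"
    by (intro linear_compose 1 2 3 4)
  then show "bounded_linear (\<lambda>x. herm_coords ((M \<odot>\<odot> herm_mat x) \<odot>\<odot> omat_dagger M))"
    by (simp add: o_def linear_conv_bounded_linear)
qed

lemma oct_flexible: "(u \<odot> x) \<odot> u = u \<odot> (x \<odot> u)"
  by (simp add: oct_eq_iff octmult_nth algebra_simps)

lemma oct_one_mult [simp]: "oct_of_real r \<odot> x = r *\<^sub>R x" "x \<odot> oct_of_real r = r *\<^sub>R x"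
  by (simp_all add: oct_eq_iff octmult_nth oct_of_real_def octunit_vec_def axis_def)

lemmas octmult_linear =
  linear_add[OF linear_octmult_left] linear_add[OF linear_octmult_right]
  linear_scale[OF linear_octmult_left] linear_scale[OF linear_octmult_right]

lemma oct_complex_cnj:
  assumes "b \<in> span {oct_of_real 1, u}"
  shows "oct_cnj b \<in> span {oct_of_real 1, u}"
proof -
  have "oct_cnj b = (2 * oct_Re b) *\<^sub>R oct_of_real 1 - b"
    by (simp add: oct_eq_iff oct_cnj_def oct_of_real_def oct_Re_def octunit_vec_def axis_def)
  then show ?thesis
    using assms by (metis span_base insertI1 span_diff span_scale)
qed

lemma oct_complex_assoc:
  assumes "a \<in> span {oct_of_real 1, u}" "b \<in> span {oct_of_real 1, u}"
  shows "(a \<odot> x) \<odot> b = a \<odot> (x \<odot> b)"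
proof -
  have *: "\<exists>r t. z = oct_of_real r + t *\<^sub>R u" if z: "z \<in> span {oct_of_real 1, u}" for z
  proof -
    obtain r t where "z - r *\<^sub>R oct_of_real 1 = t *\<^sub>R u"
      using z by (auto simp: span_breakdown_eq)
    then have "z = oct_of_real r + t *\<^sub>R u"
      by (simp add: oct_of_real_def algebra_simps)
    then show ?thesis by blast
  qed
  obtain r t r' t' where "a = oct_of_real r + t *\<^sub>R u" "b = oct_of_real r' + t' *\<^sub>R u"
    using *[OF assms(1)] *[OF assms(2)] by blast
  then show ?thesis
    by (simp add: octmult_linear oct_flexible algebra_simps)
qed

lemma omat_conj_assoc:
  assumes "\<And>i j. M $ i $ j \<in> span {oct_of_real 1, u}"
  shows "(M \<odot>\<odot> A) \<odot>\<odot> omat_dagger M = M \<odot>\<odot> (A \<odot>\<odot> omat_dagger M)"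
  by (simp add: vec_eq_iff[where 'b=3] omat_mult_def omat_dagger_def sum_3 octmult_linear
      oct_complex_assoc[OF assms oct_complex_cnj[OF assms]])

lemma omat_dagger_mult: "omat_dagger (A \<odot>\<odot> B) = omat_dagger B \<odot>\<odot> omat_dagger A"
  by (simp add: vec_eq_iff[where 'b=3] omat_mult_def omat_dagger_def sum_3 oct_cnj_mult)

lemma herm_mat_conj:
  assumes "\<And>i j. M $ i $ j \<in> span {oct_of_real 1, u}"
  shows "herm_mat (blinfun_apply (conj_action M) x) = (M \<odot>\<odot> herm_mat x) \<odot>\<odot> omat_dagger M"
proof -
  have "omat_dagger (omat_dagger M) = M"
    by (simp add: omat_dagger_def vec_eq_iff[where 'b=3])
  then have "omat_dagger ((M \<odot>\<odot> herm_mat x) \<odot>\<odot> omat_dagger M)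
      = (M \<odot>\<odot> herm_mat x) \<odot>\<odot> omat_dagger M"
    by (simp add: omat_dagger_mult herm_mat_hermitian omat_conj_assoc[OF assms])
  then show ?thesis
    by (simp add: conj_action.rep_eq herm_mat_coords)
qed


section \<open>The one-parameter families\<close>

definition diag2 :: "oct \<Rightarrow> oct \<Rightarrow> oct^2^2" where
  "diag2 x y = vector [vector [x, 0], vector [0, y]]"

definition block1 :: "oct^2^2 \<Rightarrow> oct^3^3" where
  "block1 M = vector
     [vector [M$1$1, M$1$2, 0],
      vector [M$2$1, M$2$2, 0],
      vector [0, 0, oct_of_real 1]]"

definition block2 :: "oct^2^2 \<Rightarrow> oct^3^3" where
  "block2 M = vector
     [vector [oct_of_real 1, 0, 0],
      vector [0, M$1$1, M$1$2],
      vector [0, M$2$1, M$2$2]]"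

definition Btz_mat :: "real \<Rightarrow> oct^2^2" where
  "Btz_mat \<alpha> = diag2 (oct_of_real (exp (\<alpha> / 2))) (oct_of_real (exp (- \<alpha> / 2)))"

definition B1tz :: "real \<Rightarrow> (herm3 \<Rightarrow>\<^sub>L herm3)" where
  "B1tz \<alpha> = conj_action (block1 (Btz_mat \<alpha>))"

definition B2tz :: "real \<Rightarrow> (herm3 \<Rightarrow>\<^sub>L herm3)" where
  "B2tz \<alpha> = conj_action (block2 (Btz_mat \<alpha>))"

definition R1xl :: "real \<Rightarrow> (herm3 \<Rightarrow>\<^sub>L herm3)" where
  "R1xl \<alpha> = conj_action (block1 (diag2 (oct_exp ((\<alpha> / 2) *\<^sub>R octunit_vec L))
                                       (oct_exp ((- \<alpha> / 2) *\<^sub>R octunit_vec L))))"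

definition R1 :: "octunit \<Rightarrow> octunit \<Rightarrow> real \<Rightarrow> (herm3 \<Rightarrow>\<^sub>L herm3)" where
  "R1 p q \<alpha> =
     (let u = - octunit_vec p;
          v = cos (\<alpha> / 2) *\<^sub>R octunit_vec p + sin (\<alpha> / 2) *\<^sub>R octunit_vec q
      in conj_action (block1 (diag2 v v)) o\<^sub>L conj_action (block1 (diag2 u u)))"

definition A_l :: "real \<Rightarrow> (herm3 \<Rightarrow>\<^sub>L herm3)" where
  "A_l \<alpha> = R1 IL I \<alpha> o\<^sub>L R1 JL J (- \<alpha>)"

definition G_l :: "real \<Rightarrow> (herm3 \<Rightarrow>\<^sub>L herm3)" where
  "G_l \<alpha> = R1 IL I \<alpha> o\<^sub>L R1 JL J \<alpha> o\<^sub>L R1 KL K (- 2 * \<alpha>)"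

definition S1_l :: "real \<Rightarrow> (herm3 \<Rightarrow>\<^sub>L herm3)" where
  "S1_l \<alpha> = R1 IL I \<alpha> o\<^sub>L R1 JL J \<alpha> o\<^sub>L R1 KL K \<alpha>"

definition dot :: "(real \<Rightarrow> 'a::real_normed_vector) \<Rightarrow> 'a" where
  "dot \<gamma> = vector_derivative \<gamma> (at 0)"


section \<open>Lie algebras\<close>

locale lie_algebra = vector_space scale
  for scale :: "'f::field \<Rightarrow> 'v::ab_group_add \<Rightarrow> 'v" +
  fixes bracket :: "'v \<Rightarrow> 'v \<Rightarrow> 'v"
    and carrier :: "'v set"
  assumes subspace_carrier: "subspace carrier"
    and bracket_closed: "\<lbrakk>x \<in> carrier; y \<in> carrier\<rbrakk> \<Longrightarrow> bracket x y \<in> carrier"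
    and bracket_add_left: "\<lbrakk>x \<in> carrier; y \<in> carrier; z \<in> carrier\<rbrakk> \<Longrightarrow>
          bracket (x + y) z = bracket x z + bracket y z"
    and bracket_add_right: "\<lbrakk>x \<in> carrier; y \<in> carrier; z \<in> carrier\<rbrakk> \<Longrightarrow>
          bracket x (y + z) = bracket x y + bracket x z"
    and bracket_scale_left: "\<lbrakk>x \<in> carrier; y \<in> carrier\<rbrakk> \<Longrightarrow>
          bracket (scale c x) y = scale c (bracket x y)"
    and bracket_scale_right: "\<lbrakk>x \<in> carrier; y \<in> carrier\<rbrakk> \<Longrightarrow>
          bracket x (scale c y) = scale c (bracket x y)"
    and bracket_self: "x \<in> carrier \<Longrightarrow> bracket x x = 0"
    and jacobi: "\<lbrakk>x \<in> carrier; y \<in> carrier; z \<in> carrier\<rbrakk> \<Longrightarrow>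
          bracket x (bracket y z) + bracket y (bracket z x) + bracket z (bracket x y) = 0"
begin

definition finite_dim :: bool where
  "finite_dim \<longleftrightarrow> (\<exists>B. finite B \<and> carrier = span B)"

definition bracket_span :: "'v set \<Rightarrow> 'v set \<Rightarrow> 'v set" where
  "bracket_span A B = span {bracket x y | x y. x \<in> A \<and> y \<in> B}"

definition subalgebra :: "'v set \<Rightarrow> bool" where
  "subalgebra H \<longleftrightarrow> subspace H \<and> H \<subseteq> carrier \<and> (\<forall>x\<in>H. \<forall>y\<in>H. bracket x y \<in> H)"

definition ideal :: "'v set \<Rightarrow> bool" where
  "ideal N \<longleftrightarrow> subspace N \<and> N \<subseteq> carrier \<and> (\<forall>x\<in>carrier. \<forall>y\<in>N. bracket x y \<in> N)"

definition abelian :: "'v set \<Rightarrow> bool" where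
  "abelian H \<longleftrightarrow> (\<forall>x\<in>H. \<forall>y\<in>H. bracket x y = 0)"

definition semisimple :: bool where
  "semisimple \<longleftrightarrow> (\<forall>N. ideal N \<and> abelian N \<longrightarrow> N = {0})"

definition nilpotent :: "'v set \<Rightarrow> bool" where
  "nilpotent H \<longleftrightarrow> (\<exists>n. (bracket_span H ^^ n) H = {0})"

definition normalizer :: "'v set \<Rightarrow> 'v set" where
  "normalizer H = {x \<in> carrier. \<forall>h\<in>H. bracket x h \<in> H}"

definition cartan_subalgebra :: "'v set \<Rightarrow> bool" where
  "cartan_subalgebra H \<longleftrightarrow> subalgebra H \<and> nilpotent H \<and> normalizer H = H"

definition root_space :: "'v set \<Rightarrow> ('v \<Rightarrow> 'f) \<Rightarrow> 'v set" where
  "root_space H f = {x \<in> carrier. \<forall>h\<in>H. bracket h x = scale (f h) x}"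

text \<open>Functionals on \<open>H\<close> are represented by functions whose values off \<open>H\<close> are irrelevant.\<close>

definition is_root :: "'v set \<Rightarrow> ('v \<Rightarrow> 'f) \<Rightarrow> bool" where
  "is_root H f \<longleftrightarrow>
     (\<forall>x\<in>H. \<forall>y\<in>H. f (x + y) = f x + f y) \<and> (\<forall>c. \<forall>x\<in>H. f (scale c x) = c * f x) \<and>
     (\<exists>h\<in>H. f h \<noteq> 0) \<and> root_space H f \<noteq> {0}"

definition base_of_roots :: "'v set \<Rightarrow> nat \<Rightarrow> (nat \<Rightarrow> 'v \<Rightarrow> 'f) \<Rightarrow> bool" where
  "base_of_roots H r \<alpha> \<longleftrightarrow>
     (\<forall>i\<in>{1..r}. is_root H (\<alpha> i)) \<and>
     (\<forall>c. (\<forall>h\<in>H. (\<Sum>i=1..r. c i * \<alpha> i h) = 0) \<longrightarrow> (\<forall>i\<in>{1..r}. c i = 0)) \<and>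
     (\<forall>f. is_root H f \<longrightarrow> (\<exists>n :: nat \<Rightarrow> nat.
        (\<forall>h\<in>H. f h = (\<Sum>i=1..r. of_nat (n i) * \<alpha> i h)) \<or>
        (\<forall>h\<in>H. f h = - (\<Sum>i=1..r. of_nat (n i) * \<alpha> i h))))"

definition coroot :: "'v set \<Rightarrow> ('v \<Rightarrow> 'f) \<Rightarrow> 'v \<Rightarrow> bool" where
  "coroot H f h \<longleftrightarrow>
     h \<in> H \<and> h \<in> bracket_span (root_space H f) (root_space H (\<lambda>x. - f x)) \<and> f h = 2"

text \<open>A semisimple Lie algebra (over an algebraically closed field of characteristic 0) whose root
  system has the \<open>r \<times> r\<close> Cartan matrix \<open>A\<close>; by the isomorphism theorem this determines it
  up to isomorphism.\<close>

definition has_type :: "nat \<Rightarrow> (nat \<Rightarrow> nat \<Rightarrow> int) \<Rightarrow> bool" where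
  "has_type r A \<longleftrightarrow>
     finite_dim \<and> semisimple \<and>
     (\<exists>H \<alpha> h. cartan_subalgebra H \<and> base_of_roots H r \<alpha> \<and>
        (\<forall>i\<in>{1..r}. coroot H (\<alpha> i) (h i)) \<and>
        (\<forall>i\<in>{1..r}. \<forall>j\<in>{1..r}. \<alpha> j (h i) = of_int (A i j)))"

end

text \<open>Bourbaki's numbering of the Dynkin diagram: the chain 1-3-4-5-6 with 2 joined to 4.\<close>

definition E6_cartan_matrix :: "nat \<Rightarrow> nat \<Rightarrow> int" where
  "E6_cartan_matrix i j =
     (if i = j then 2
      else if {i, j} \<in> {{1, 3}, {3, 4}, {4, 5}, {5, 6}, {2, 4}} then -1
      else 0)"


section \<open>Complexification\<close>

text \<open>The pair \<open>(x, y)\<close> stands for \<open>x \<otimes> 1 + y \<otimes> \<i>\<close>.\<close>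

definition cscale :: "complex \<Rightarrow> 'a::real_vector \<times> 'a \<Rightarrow> 'a \<times> 'a" where
  "cscale z v = (Re z *\<^sub>R fst v - Im z *\<^sub>R snd v, Re z *\<^sub>R snd v + Im z *\<^sub>R fst v)"

definition cbracket :: "('a \<Rightarrow> 'a \<Rightarrow> 'a::real_vector) \<Rightarrow> 'a \<times> 'a \<Rightarrow> 'a \<times> 'a \<Rightarrow> 'a \<times> 'a" where
  "cbracket br v w = (br (fst v) (fst w) - br (snd v) (snd w), br (fst v) (snd w) + br (snd v) (fst w))"

definition complexification :: "'a set \<Rightarrow> ('a \<times> 'a) set" where
  "complexification S = S \<times> S"

interpretation cplx: vector_space cscale
  by unfold_locales (simp_all add: cscale_def algebra_simps)

end

theory Submission
  imports Defs
begin

text \<open>After complexification the 27-dimensional space of Hermitian octonionic matrices becomes the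
space of triples \<open>(M\<^sub>1, M\<^sub>2, M\<^sub>3)\<close> of complex \<open>3\<times>3\<close> matrices, with determinant
\<open>det M\<^sub>1 + det M\<^sub>2 + det M\<^sub>3 - tr (M\<^sub>1 M\<^sub>2 M\<^sub>3)\<close> (the first Tits construction).  The unit \<open>L\<close> is
what splits the octonions: the components in \<open>span {1, L}\<close> of the matrix entries form \<open>M\<^sub>1\<close>,
with \<open>L\<close> read as the complex unit, and the planes \<open>(I, IL)\<close>, \<open>(J, JL)\<close>, \<open>(K, KL)\<close> of the three
off-diagonal entries, taken with this unit and with its conjugate, form \<open>M\<^sub>2\<close> and \<open>M\<^sub>3\<close>
(\<open>herm_det_cubic_polar\<close>).

In these coordinates all six generators are diagonal: there are numbers \<open>x t i\<close> with
\<open>\<Sum>\<^sub>i x t i = 0\<close> such that the entry \<open>(i, j)\<close> of \<open>M\<^sub>t\<close> is multiplied by \<open>x t i - x (t+1) j\<close>, the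
index \<open>t\<close> being cyclic.  The six parameter vectors are linearly independent and hence span the
6-dimensional space of all traceless parameters (\<open>cartan_H_span\<close>).

A linear map belongs to the Lie algebra iff it annihilates the cubic form
infinitesimally: one direction is differentiation, the other is the exponential
series (\<open>sl3O_iff\<close>).  Thus the complexified Lie algebra consists of the derivations of the
cubic form on triples (\<open>complexified_sl3O_iff\<close>).  Two distinct matrix units either lie in a common monomial
of the cubic form, in which case a derivation has no entry between them, or they differ by a root,
and then evaluating the polarised derivation identity on basis vectors equates, up to sign, the six
entries belonging to that root.  Hence a derivation is given by three traceless
matrices and two tensors (\<open>derivation_imp_e6_op\<close>), which is the decomposition
\<open>3 sl(3) \<oplus> (3,3,3) \<oplus> (3*,3*,3*)\<close>, and its diagonal part is an element of the span of the six
generators.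

What remains is general: an abelian subalgebra with a multiplicity-free root space decomposition,
root vectors \<open>e\<close> and opposite ones whose brackets are coroots, is a Cartan subalgebra of a
semisimple algebra without further roots (locale \<open>root_decomposition\<close>).  The 72 roots are
\<open>x t i - x t j\<close> for \<open>i \<noteq> j\<close> and \<open>\<plusminus>(x 1 i + x 2 j + x 3 k)\<close>.  The extended Dynkin diagram of
\<open>E\<^sub>6\<close>, with its three arms of length two, shows how to choose simple roots: two from each of the
first two copies of \<open>sl(3)\<close>, one from the third, and \<open>x 1 3 + x 2 3 + x 3 3\<close> as the central node.\<close>

section \<open>Root space decompositions of abstract Lie algebras\<close>

context lie_algebra
begin

lemma scale_carrier: "x \<in> carrier \<Longrightarrow> scale c x \<in> carrier"
  by (rule subspace_scale[OF subspace_carrier])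

lemma bracket_zero_right: "x \<in> carrier \<Longrightarrow> bracket x 0 = 0"
  using bracket_scale_right[of x x 0] by simp

lemma bracket_minus_swap:
  assumes "x \<in> carrier" "y \<in> carrier"
  shows "bracket y x = - bracket x y"
proof -
  have "x + y \<in> carrier" using assms subspace_carrier by (simp add: subspace_add)
  then have "0 = bracket (x + y) (x + y)" by (simp add: bracket_self)
  also have "\<dots> = bracket x y + bracket y x"
    using assms \<open>x + y \<in> carrier\<close> bracket_add_left[of x y "x + y"] bracket_add_right[of x x y]
      bracket_add_right[of y x y] bracket_self[of x] bracket_self[of y] by simp
  finally show ?thesis by (simp add: eq_neg_iff_add_eq_0 add.commute)
qed

lemma bracket_sum_right:
  assumes "finite S" "x \<in> carrier" "\<And>s. s \<in> S \<Longrightarrow> v s \<in> carrier"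
  shows "bracket x (\<Sum>s\<in>S. v s) = (\<Sum>s\<in>S. bracket x (v s))"
  using assms
proof (induction S)
  case (insert s S)
  then have "(\<Sum>s\<in>S. v s) \<in> carrier"
    by (intro subspace_sum subspace_carrier) auto
  then show ?case using insert by (simp add: bracket_add_right)
qed (simp add: bracket_zero_right)

text \<open>An invariant subspace contains the weight components of its elements: with \<open>h\<close> separating the
weights of \<open>s\<close> and \<open>t\<close>, the operator \<open>ad h - w s h\<close> kills the \<open>s\<close>-component and multiplies the
\<open>t\<close>-component by a nonzero scalar, which drives the induction on the number of components.  With
\<open>N = {0}\<close> this is the independence of weight vectors.\<close>

lemma weight_components:
  assumes "finite S" "subspace N" "H \<subseteq> carrier"
    and "\<And>h y. h \<in> H \<Longrightarrow> y \<in> N \<Longrightarrow> bracket h y \<in> N"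
    and "\<And>s. s \<in> S \<Longrightarrow> v s \<in> carrier"
    and "\<And>s h. s \<in> S \<Longrightarrow> h \<in> H \<Longrightarrow> bracket h (v s) = scale (w s h) (v s)"
    and "\<And>s t. s \<in> S \<Longrightarrow> t \<in> S \<Longrightarrow> s \<noteq> t \<Longrightarrow> \<exists>h\<in>H. w s h \<noteq> w t h"
    and "(\<Sum>s\<in>S. v s) \<in> N"
  shows "\<forall>s\<in>S. v s \<in> N"
  using assms
proof (induction S arbitrary: v)
  case (insert s S)
  have *: "v t \<in> N" if "t \<in> S" for t
  proof -
    obtain h where h: "h \<in> H" "w s h \<noteq> w t h"
      using insert.prems(6)[of s t] insert.hyps \<open>t \<in> S\<close> by auto
    let ?y = "\<Sum>u\<in>insert s S. v u"
    have hc: "h \<in> carrier" using h insert.prems(2) by blast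
    have "bracket h ?y = (\<Sum>u\<in>insert s S. scale (w u h) (v u))"
      using insert.hyps insert.prems(4,5) h hc by (subst bracket_sum_right) (auto intro!: sum.cong)
    then have "bracket h ?y - scale (w s h) ?y = (\<Sum>u\<in>S. scale (w u h - w s h) (v u))"
      using insert.hyps by (simp add: scale_sum_right scale_left_diff_distrib sum_subtractf scale_right_distrib)
    moreover have "bracket h ?y - scale (w s h) ?y \<in> N"
      using insert.prems(1,3,7) h by (intro subspace_diff subspace_scale) auto
    ultimately have sumN: "(\<Sum>u\<in>S. scale (w u h - w s h) (v u)) \<in> N" by simp
    have "\<forall>u\<in>S. scale (w u h - w s h) (v u) \<in> N"
    proof (rule insert.IH)
      show "bracket k (scale (w u h - w s h) (v u)) = scale (w u k) (scale (w u h - w s h) (v u))"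
        if "u \<in> S" "k \<in> H" for u k
        using insert.prems(2,4,5) that by (subst bracket_scale_right) (auto simp: mult.commute)
      show "scale (w u h - w s h) (v u) \<in> carrier" if "u \<in> S" for u
        using insert.prems(4) that by (intro subspace_scale subspace_carrier) auto
    qed (use insert.prems sumN in auto)
    then have "scale (inverse (w t h - w s h)) (scale (w t h - w s h) (v t)) \<in> N"
      using that by (intro subspace_scale[OF insert.prems(1), of "scale (w t h - w s h) (v t)"]) auto
    then show ?thesis using h by simp
  qed
  have "v s = (\<Sum>u\<in>insert s S. v u) - (\<Sum>u\<in>S. v u)"
    using insert.hyps by simp
  also have "\<dots> \<in> N"
    using * by (intro subspace_diff[OF insert.prems(1,7)] subspace_sum[OF insert.prems(1)]) auto
  finally show ?case using * by blast
qed simp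

end

text \<open>The data from which everything about the root system is read off.  The index \<open>r\<close> of a root is
kept apart from the functional \<open>rt r\<close> since the latter is only determined on \<open>H\<close>.  The last two
assumptions say that the bracket of \<open>e r\<close> with the opposite root vector is the coroot of \<open>rt r\<close>.\<close>

locale root_decomposition = lie_algebra scale bracket carrier
  for scale :: "'f::field_char_0 \<Rightarrow> 'v::ab_group_add \<Rightarrow> 'v" and bracket carrier +
  fixes H :: "'v set" and R :: "'r set" and rt :: "'r \<Rightarrow> 'v \<Rightarrow> 'f" and e :: "'r \<Rightarrow> 'v" and opp :: "'r \<Rightarrow> 'r"
  assumes H_subspace: "subspace H" and H_carrier: "H \<subseteq> carrier"
    and H_finite_dim: "\<exists>B. finite B \<and> H = span B"
    and H_abelian: "\<lbrakk>x \<in> H; y \<in> H\<rbrakk> \<Longrightarrow> bracket x y = 0"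
    and finite_R: "finite R"
    and e_carrier: "r \<in> R \<Longrightarrow> e r \<in> carrier"
    and e_nonzero: "r \<in> R \<Longrightarrow> e r \<noteq> 0"
    and e_weight: "\<lbrakk>r \<in> R; h \<in> H\<rbrakk> \<Longrightarrow> bracket h (e r) = scale (rt r h) (e r)"
    and rt_add: "\<lbrakk>r \<in> R; x \<in> H; y \<in> H\<rbrakk> \<Longrightarrow> rt r (x + y) = rt r x + rt r y"
    and rt_scale: "\<lbrakk>r \<in> R; x \<in> H\<rbrakk> \<Longrightarrow> rt r (scale c x) = c * rt r x"
    and rt_nonzero: "r \<in> R \<Longrightarrow> \<exists>h\<in>H. rt r h \<noteq> 0"
    and rt_distinct: "\<lbrakk>r \<in> R; s \<in> R; r \<noteq> s\<rbrakk> \<Longrightarrow> \<exists>h\<in>H. rt r h \<noteq> rt s h"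
    and rt_separate: "\<lbrakk>h \<in> H; \<And>r. r \<in> R \<Longrightarrow> rt r h = 0\<rbrakk> \<Longrightarrow> h = 0"
    and decomposition: "x \<in> carrier \<Longrightarrow> \<exists>h\<in>H. \<exists>c. x = h + (\<Sum>r\<in>R. scale (c r) (e r))"
    and opp_R: "r \<in> R \<Longrightarrow> opp r \<in> R"
    and rt_opp: "\<lbrakk>r \<in> R; h \<in> H\<rbrakk> \<Longrightarrow> rt (opp r) h = - rt r h"
    and bracket_opp: "r \<in> R \<Longrightarrow> bracket (e r) (e (opp r)) \<in> H"
    and rt_bracket_opp: "r \<in> R \<Longrightarrow> rt r (bracket (e r) (e (opp r))) = 2"
begin

lemma rt_eqD: "\<lbrakk>\<forall>h\<in>H. rt r h = rt s h; r \<in> R; s \<in> R\<rbrakk> \<Longrightarrow> r = s"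
  using rt_distinct by blast

text \<open>In the application of \<open>weight_components\<close>, the index \<open>None\<close> carries the weight zero.\<close>

lemma components:
  assumes N: "subspace N" "\<And>h y. h \<in> H \<Longrightarrow> y \<in> N \<Longrightarrow> bracket h y \<in> N"
    and x: "h + (\<Sum>r\<in>R. scale (c r) (e r)) \<in> N" and h: "h \<in> H"
  shows "h \<in> N" "r \<in> R \<Longrightarrow> c r \<noteq> 0 \<Longrightarrow> e r \<in> N"
proof -
  let ?v = "\<lambda>s. case s of None \<Rightarrow> h | Some r \<Rightarrow> scale (c r) (e r)"
  let ?w = "\<lambda>s. case s of None \<Rightarrow> (\<lambda>h. 0) | Some r \<Rightarrow> rt r"
  let ?S = "insert None (Some ` R)"
  have *: "\<forall>s\<in>?S. ?v s \<in> N"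
  proof (rule weight_components[where H = H and w = ?w])
    show "finite ?S" using finite_R by simp
    show "?v s \<in> carrier" if "s \<in> ?S" for s
      using that h H_carrier e_carrier by (auto simp: scale_carrier)
    show "bracket k (?v s) = scale (?w s k) (?v s)" if "s \<in> ?S" "k \<in> H" for s k
      using that h H_carrier e_carrier H_abelian e_weight
      by (auto simp: bracket_scale_right subsetD mult.commute)
    show "\<exists>h\<in>H. ?w s h \<noteq> ?w t h" if "s \<in> ?S" "t \<in> ?S" "s \<noteq> t" for s t
    proof -
      have "\<exists>h\<in>H. 0 \<noteq> rt r h" if "r \<in> R" for r using rt_nonzero[OF that] by metis
      then show ?thesis using that rt_nonzero rt_distinct by (auto dest: rt_eqD)
    qed
    have "(\<Sum>s\<in>?S. ?v s) = h + (\<Sum>r\<in>R. scale (c r) (e r))"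
      using finite_R by (simp add: sum.reindex)
    then show "(\<Sum>s\<in>?S. ?v s) \<in> N" using x by simp
  qed (use N H_carrier in auto)
  then show "h \<in> N" by auto
  assume r: "r \<in> R" "c r \<noteq> 0"
  then have "scale (inverse (c r)) (scale (c r) (e r)) \<in> N"
    using * by (intro subspace_scale[OF N(1), of "scale (c r) (e r)"]) auto
  then show "e r \<in> N" using r by simp
qed

lemma cartan: "cartan_subalgebra H"
  unfolding cartan_subalgebra_def
proof (intro conjI)
  have zero: "0 \<in> H" using H_subspace by (rule subspace_0)
  show "subalgebra H"
    unfolding subalgebra_def using H_subspace H_carrier H_abelian zero by auto
  have "{bracket x y |x y. x \<in> H \<and> y \<in> H} = {0}"
    using H_abelian zero by force
  then have "(bracket_span H ^^ 1) H = {0}"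
    by (simp add: bracket_span_def)
  then show "nilpotent H" unfolding nilpotent_def by blast
  show "normalizer H = H"
  proof
    show "H \<subseteq> normalizer H" using H_carrier H_abelian zero by (auto simp: normalizer_def)
    show "normalizer H \<subseteq> H"
    proof
      fix x assume "x \<in> normalizer H"
      then have x: "x \<in> carrier" and norm: "\<And>h. h \<in> H \<Longrightarrow> bracket x h \<in> H"
        by (auto simp: normalizer_def)
      obtain h0 c where h0: "h0 \<in> H" and xe: "x = h0 + (\<Sum>r\<in>R. scale (c r) (e r))"
        using decomposition[OF x] by blast
      have "c r = 0" if r: "r \<in> R" for r
      proof (rule ccontr)
        assume c: "c r \<noteq> 0"
        obtain h where h: "h \<in> H" "rt r h \<noteq> 0" using rt_nonzero[OF r] by blast
        have hc: "h \<in> carrier" and h0c: "h0 \<in> carrier" using h h0 H_carrier by auto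
        have "bracket h x = - bracket x h" using bracket_minus_swap x hc by blast
        then have "bracket h x \<in> H" using norm[OF h(1)] H_subspace by (simp add: subspace_neg)
        moreover have "bracket h x = 0 + (\<Sum>r\<in>R. scale (c r * rt r h) (e r))"
        proof -
          have ce: "scale (c r) (e r) \<in> carrier" if "r \<in> R" for r
            using e_carrier[OF that] subspace_carrier by (simp add: subspace_scale)
          have "bracket h x = bracket h h0 + bracket h (\<Sum>r\<in>R. scale (c r) (e r))"
            unfolding xe using hc h0c ce subspace_carrier by (intro bracket_add_right subspace_sum) auto
          also have "\<dots> = (\<Sum>r\<in>R. bracket h (scale (c r) (e r)))"
            using H_abelian[OF h(1) h0] bracket_sum_right[OF finite_R hc ce] by simp
          also have "\<dots> = (\<Sum>r\<in>R. scale (c r * rt r h) (e r))"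
            using hc h e_carrier e_weight by (intro sum.cong) (auto simp: bracket_scale_right)
          finally show ?thesis by simp
        qed
        ultimately have "0 + (\<Sum>r\<in>R. scale (c r * rt r h) (e r)) \<in> H" by simp
        then have "e r \<in> H"
          using components(2)[OF H_subspace _ _ zero, of "\<lambda>r. c r * rt r h" r] H_abelian zero r c h by auto
        then have "scale (rt r h) (e r) = 0" using H_abelian h e_weight r by metis
        then show False using h e_nonzero r by simp
      qed
      then show "x \<in> H" using xe h0 by simp
    qed
  qed
qed

text \<open>An ideal is graded by the roots.  It cannot contain a root vector \<open>e r\<close>, since it would
then contain the coroot, which acts on \<open>e r\<close> by the factor 2, and the ideal would not be
abelian; and it cannot contain a nonzero \<open>h\<close> in \<open>H\<close>, since some root is nonzero on \<open>h\<close>.\<close>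

lemma semisimple: "semisimple"
  unfolding semisimple_def
proof (intro allI impI)
  fix N assume "ideal N \<and> abelian N"
  then have N: "subspace N" "N \<subseteq> carrier" and stable: "\<And>x y. x \<in> carrier \<Longrightarrow> y \<in> N \<Longrightarrow> bracket x y \<in> N"
    and ab: "\<And>x y. x \<in> N \<Longrightarrow> y \<in> N \<Longrightarrow> bracket x y = 0"
    by (auto simp: ideal_def abelian_def)
  have stableH: "bracket h y \<in> N" if "h \<in> H" "y \<in> N" for h y
    using stable that H_carrier by auto
  have e_notin: "e r \<notin> N" if r: "r \<in> R" for r
  proof
    assume eN: "e r \<in> N"
    let ?h = "bracket (e r) (e (opp r))"
    have "?h = - bracket (e (opp r)) (e r)"
      using bracket_minus_swap r opp_R e_carrier by blast
    then have "?h \<in> N" using stable[OF e_carrier[OF opp_R[OF r]] eN] N by (simp add: subspace_neg)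
    then have "bracket ?h (e r) = 0" using ab eN by blast
    then have "scale 2 (e r) = 0"
      using e_weight[OF r bracket_opp[OF r]] rt_bracket_opp[OF r] by simp
    then show False using e_nonzero[OF r] by simp
  qed
  have "x = 0" if x: "x \<in> N" for x
  proof -
    obtain h c where h: "h \<in> H" and xe: "x = h + (\<Sum>r\<in>R. scale (c r) (e r))"
      using decomposition x N by blast
    have hN: "h \<in> N" and "\<And>r. r \<in> R \<Longrightarrow> c r \<noteq> 0 \<Longrightarrow> e r \<in> N"
      using components[OF N(1) stableH _ h] x xe by blast+
    then have c: "c r = 0" if "r \<in> R" for r using e_notin that by blast
    have "h = 0"
    proof (rule rt_separate[OF h])
      fix r assume r: "r \<in> R"
      have "scale (rt r h) (e r) = - bracket (e r) h"
        using e_weight[OF r h] bracket_minus_swap[of "e r" h] r h e_carrier H_carrier by auto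
      also have "\<dots> \<in> N" using stable[OF e_carrier[OF r] hN] N by (simp add: subspace_neg)
      finally have in_N: "scale (rt r h) (e r) \<in> N" .
      show "rt r h = 0"
      proof (rule ccontr)
        assume "rt r h \<noteq> 0"
        then have "scale (inverse (rt r h)) (scale (rt r h) (e r)) = e r" by simp
        then show False using in_N N e_notin[OF r] by (metis subspace_scale)
      qed
    qed
    then show ?thesis using c xe by simp
  qed
  then show "N = {0}" using N subspace_0 by blast
qed

lemma finite_dimensional: "finite_dim"
proof -
  obtain B where B: "finite B" "H = span B" using H_finite_dim by blast
  have "carrier = span (B \<union> e ` R)"
  proof
    show "span (B \<union> e ` R) \<subseteq> carrier"
      using B H_carrier e_carrier subspace_carrier span_superset[of B] by (intro span_minimal) auto
    show "carrier \<subseteq> span (B \<union> e ` R)"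
    proof
      fix x assume "x \<in> carrier"
      then obtain h c where h: "h \<in> H" and xe: "x = h + (\<Sum>r\<in>R. scale (c r) (e r))"
        using decomposition by blast
      have "h \<in> span (B \<union> e ` R)" using h B span_mono[of B "B \<union> e ` R"] by auto
      then show "x \<in> span (B \<union> e ` R)"
        unfolding xe by (intro span_add span_sum span_scale) (auto intro: span_base)
    qed
  qed
  then show ?thesis unfolding finite_dim_def using B finite_R by (intro exI[of _ "B \<union> e ` R"]) auto
qed

lemma e_root_space: "r \<in> R \<Longrightarrow> e r \<in> root_space H (rt r)"
  using e_carrier e_weight by (auto simp: root_space_def)

lemma is_root_rt:
  assumes "r \<in> R"
  shows "is_root H (rt r)"
  using assms rt_add rt_scale rt_nonzero e_root_space[OF assms] e_nonzero
  unfolding is_root_def by blast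

text \<open>A nonzero vector of a weight different from \<open>0\<close> and from all \<open>rt r\<close> would be independent of its own
decomposition.\<close>

lemma is_root_imp_rt:
  assumes f: "is_root H f"
  obtains r where "r \<in> R" "\<And>h. h \<in> H \<Longrightarrow> f h = rt r h"
proof (rule ccontr)
  assume no: "\<not> thesis"
  note obt = that
  have neq: "\<exists>h\<in>H. f h \<noteq> rt r h" if "r \<in> R" for r
    using no obt[OF that] by blast
  obtain k where k: "k \<in> H" "f k \<noteq> 0" using f by (auto simp: is_root_def)
  have "0 \<in> root_space H f"
    using subspace_0[OF subspace_carrier] H_carrier by (auto simp: root_space_def bracket_zero_right)
  then obtain x where x: "x \<in> root_space H f" "x \<noteq> 0" using f by (auto simp: is_root_def)
  then have xc: "x \<in> carrier" and xw: "\<And>h. h \<in> H \<Longrightarrow> bracket h x = scale (f h) x"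
    by (auto simp: root_space_def)
  obtain h c where h: "h \<in> H" and xe: "x = h + (\<Sum>r\<in>R. scale (c r) (e r))"
    using decomposition[OF xc] by blast
  define y where "y = scale (-1) x"
  have yc: "y \<in> carrier" unfolding y_def by (rule scale_carrier[OF xc])
  have yw: "bracket h y = scale (f h) y" if "h \<in> H" for h
    unfolding y_def using that H_carrier by (subst bracket_scale_right) (auto simp: xc xw)
  have y0: "y + (h + (\<Sum>r\<in>R. scale (c r) (e r))) = 0" "y \<noteq> 0"
    using x(2) by (simp_all add: y_def xe[symmetric])
  let ?v = "\<lambda>s. case s of None \<Rightarrow> y | Some None \<Rightarrow> h | Some (Some r) \<Rightarrow> scale (c r) (e r)"
  let ?w = "\<lambda>s. case s of None \<Rightarrow> f | Some None \<Rightarrow> (\<lambda>h. 0) | Some (Some r) \<Rightarrow> rt r"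
  let ?S = "insert None (insert (Some None) ((\<lambda>r. Some (Some r)) ` R))"
  have "\<forall>s\<in>?S. ?v s \<in> {0}"
  proof (rule weight_components[where H = H and w = ?w])
    show "finite ?S" using finite_R by simp
    show "?v s \<in> carrier" if "s \<in> ?S" for s
      using that h yc H_carrier e_carrier by (auto simp: scale_carrier)
    show "bracket k (?v s) = scale (?w s k) (?v s)" if "s \<in> ?S" "k \<in> H" for s k
      using that h yw H_carrier e_carrier H_abelian e_weight
      by (auto simp: bracket_scale_right subsetD mult.commute)
    show "\<exists>h\<in>H. ?w s h \<noteq> ?w t h" if "s \<in> ?S" "t \<in> ?S" "s \<noteq> t" for s t
    proof -
      have neq': "\<exists>h\<in>H. rt r h \<noteq> f h" if "r \<in> R" for r using neq[OF that] by metis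
      have nz': "\<exists>h\<in>H. 0 \<noteq> rt r h" if "r \<in> R" for r using rt_nonzero[OF that] by metis
      have k': "\<exists>h\<in>H. f h \<noteq> 0" "\<exists>h\<in>H. 0 \<noteq> f h" using k by auto
      show ?thesis using that rt_nonzero nz' rt_distinct neq neq' k' by (auto dest: rt_eqD)
    qed
    have "(\<Sum>s\<in>?S. ?v s) = y + (h + (\<Sum>r\<in>R. scale (c r) (e r)))"
    proof -
      have "(\<Sum>s\<in>(\<lambda>r. Some (Some r)) ` R. ?v s) = (\<Sum>r\<in>R. scale (c r) (e r))"
        by (subst sum.reindex) (auto simp: inj_on_def)
      then show ?thesis using finite_R by (subst sum.insert; auto)+
    qed
    then show "(\<Sum>s\<in>?S. ?v s) \<in> {0}" unfolding y0 by simp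
  qed (use H_carrier bracket_zero_right in auto)
  then show False using y0 by auto
qed

theorem has_typeI:
  assumes simple: "\<And>i. i \<in> {1..n} \<Longrightarrow> \<beta> i \<in> R"
    and indep: "\<And>c i. (\<And>h. h \<in> H \<Longrightarrow> (\<Sum>i=1..n. c i * rt (\<beta> i) h) = 0) \<Longrightarrow> i \<in> {1..n} \<Longrightarrow> c i = 0"
    and positive: "\<And>r. r \<in> R \<Longrightarrow> \<exists>m :: nat \<Rightarrow> nat.
        (\<forall>h\<in>H. rt r h = (\<Sum>i=1..n. of_nat (m i) * rt (\<beta> i) h)) \<or>
        (\<forall>h\<in>H. rt r h = - (\<Sum>i=1..n. of_nat (m i) * rt (\<beta> i) h))"
    and matrix: "\<And>i j. \<lbrakk>i \<in> {1..n}; j \<in> {1..n}\<rbrakk> \<Longrightarrow>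
        rt (\<beta> j) (bracket (e (\<beta> i)) (e (opp (\<beta> i)))) = of_int (A i j)"
  shows "has_type n A"
  unfolding has_type_def
proof (intro conjI finite_dimensional semisimple exI)
  show "cartan_subalgebra H" by (rule cartan)
  show "base_of_roots H n (\<lambda>i. rt (\<beta> i))"
    unfolding base_of_roots_def
  proof (intro conjI ballI allI impI)
    show "is_root H (rt (\<beta> i))" if "i \<in> {1..n}" for i
      using that simple is_root_rt by blast
    show "c i = 0" if "\<forall>h\<in>H. (\<Sum>i=1..n. c i * rt (\<beta> i) h) = 0" "i \<in> {1..n}" for c i
      using indep[of c i] that by blast
    fix f assume "is_root H f"
    then obtain r where r: "r \<in> R" "\<And>h. h \<in> H \<Longrightarrow> f h = rt r h"
      using is_root_imp_rt by blast
    then show "\<exists>m :: nat \<Rightarrow> nat.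
        (\<forall>h\<in>H. f h = (\<Sum>i=1..n. of_nat (m i) * rt (\<beta> i) h)) \<or>
        (\<forall>h\<in>H. f h = - (\<Sum>i=1..n. of_nat (m i) * rt (\<beta> i) h))"
      using positive[OF r(1)] by simp
  qed
  show "\<forall>i\<in>{1..n}. coroot H (rt (\<beta> i)) (bracket (e (\<beta> i)) (e (opp (\<beta> i))))"
  proof
    fix i assume "i \<in> {1..n}"
    then have r: "\<beta> i \<in> R" by (rule simple)
    have "e (opp (\<beta> i)) \<in> root_space H (\<lambda>x. - rt (\<beta> i) x)"
      using e_root_space[OF opp_R[OF r]] rt_opp[OF r] by (auto simp: root_space_def)
    then have "bracket (e (\<beta> i)) (e (opp (\<beta> i))) \<in> bracket_span (root_space H (rt (\<beta> i))) (root_space H (\<lambda>x. - rt (\<beta> i) x))"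
      unfolding bracket_span_def using e_root_space[OF r] by (intro span_base) blast
    then show "coroot H (rt (\<beta> i)) (bracket (e (\<beta> i)) (e (opp (\<beta> i))))"
      unfolding coroot_def using bracket_opp[OF r] rt_bracket_opp[OF r] by blast
  qed
  show "\<forall>i\<in>{1..n}. \<forall>j\<in>{1..n}. rt (\<beta> j) (bracket (e (\<beta> i)) (e (opp (\<beta> i)))) = of_int (A i j)"
    using matrix by blast
qed

end

section \<open>The invariant cubic form on triples of matrices\<close>

text \<open>The type \<open>3\<close> is the ring of integers modulo 3, so that \<open>t+1\<close> and \<open>t+2\<close> are the cyclic
successors.  Functions are used instead of vectors because the scalars of interest are complex
while the vector types carry real scalar multiplication.\<close>

type_synonym triple = "3 \<Rightarrow> 3 \<Rightarrow> 3 \<Rightarrow> complex"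

text \<open>The representatives are \<open>1, 2, 3\<close>, in agreement with the indexing of matrices.\<close>

lemma mod3_simps [simp]:
  "(4::3) = 1" "(5::3) = 2" "(0::3) = 3"
  by simp_all

lemma add3_simps [simp]:
  fixes i :: 3
  shows "i + 3 = i" "i + 1 + 1 = i + 2" "i + 1 + 2 = i" "i + 2 + 1 = i" "i + 2 + 2 = i + 1"
     "i + 1 \<noteq> i" "i + 2 \<noteq> i" "i + 1 \<noteq> i + 2" "i + 2 \<noteq> i + 1" "i \<noteq> i + 1" "i \<noteq> i + 2"
  using exhaust_3[of i] by auto

lemma sum3_from:
  fixes f :: "3 \<Rightarrow> 'a::comm_monoid_add"
  shows "(\<Sum>k\<in>UNIV. f k) = f i + f (i + 1) + f (i + 2)"
  using exhaust_3[of i] by (auto simp: sum_3 algebra_simps)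

lemma neq3_cases:
  fixes i j :: 3
  assumes "i \<noteq> j"
  obtains "j = i + 1" | "j = i + 2"
  using assms exhaust_3[of i] exhaust_3[of j] by auto

definition add_scaled :: "triple \<Rightarrow> complex \<Rightarrow> triple \<Rightarrow> triple" where
  "add_scaled u c v = (\<lambda>t i j. u t i j + c * v t i j)"

definition unit3 :: "3 \<Rightarrow> 3 \<Rightarrow> 3 \<Rightarrow> triple" where
  "unit3 s k l = (\<lambda>t i j. if t = s \<and> i = k \<and> j = l then 1 else 0)"

text \<open>The gradient of the cubic form \<open>\<Sum>\<^sub>t det M\<^sub>t - tr (M\<^sub>1 M\<^sub>2 M\<^sub>3)\<close> is quadratic, and this is its
polarisation.  Cyclic indices absorb the signs of the cofactors.\<close>

definition adj_polar :: "triple \<Rightarrow> triple \<Rightarrow> triple" where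
  "adj_polar u v = (\<lambda>t i j.
     u t (i+1) (j+1) * v t (i+2) (j+2) + v t (i+1) (j+1) * u t (i+2) (j+2)
     - u t (i+1) (j+2) * v t (i+2) (j+1) - v t (i+1) (j+2) * u t (i+2) (j+1)
     - (\<Sum>k\<in>UNIV. u (t+1) j k * v (t+2) k i + v (t+1) j k * u (t+2) k i))"

definition cubic_polar :: "triple \<Rightarrow> triple \<Rightarrow> triple \<Rightarrow> complex" where
  "cubic_polar u v w = (\<Sum>t\<in>UNIV. \<Sum>i\<in>UNIV. \<Sum>j\<in>UNIV. adj_polar u v t i j * w t i j)"

lemma cubic_polar_add_scaled:
  "cubic_polar (add_scaled u c u') v w = cubic_polar u v w + c * cubic_polar u' v w"
  "cubic_polar u (add_scaled v c v') w = cubic_polar u v w + c * cubic_polar u v' w"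
  "cubic_polar u v (add_scaled w c w') = cubic_polar u v w + c * cubic_polar u v w'"
  by (simp_all add: cubic_polar_def adj_polar_def add_scaled_def sum_distrib_left sum.distrib[symmetric] ring_distribs
     sum_subtractf[symmetric] algebra_simps)

lemma cubic_polar_sym12: "cubic_polar u v w = cubic_polar v u w"
  by (simp add: cubic_polar_def adj_polar_def algebra_simps)

lemma cubic_polar_sym23: "cubic_polar u v w = cubic_polar u w v"
  apply (simp add: cubic_polar_def adj_polar_def sum_3)
  apply (simp add: algebra_simps)
  done

lemma add3_eq_iff [simp]:
  fixes i j :: 3
  shows "i + 1 = j + 2 \<longleftrightarrow> i = j + 1" "i + 2 = j + 1 \<longleftrightarrow> i = j + 2"
proof -
  have "i + 1 = (j + 1) + 1 \<longleftrightarrow> i = j + 1" "i + 2 = (j + 2) + 2 \<longleftrightarrow> i = j + 2"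
    by (simp_all only: add_right_cancel)
  then show "i + 1 = j + 2 \<longleftrightarrow> i = j + 1" "i + 2 = j + 1 \<longleftrightarrow> i = j + 2"
    by simp_all
qed

lemma pair_unit3:
  "(\<Sum>t\<in>UNIV. \<Sum>i\<in>UNIV. \<Sum>j\<in>UNIV. unit3 s k l t i j * w t i j) = w s k l"
proof -
  have "(\<Sum>j\<in>UNIV. unit3 s k l t i j * w t i j) = (if t = s then if i = k then w s k l else 0 else 0)"
    for t i
  proof -
    have "(\<Sum>j\<in>UNIV. unit3 s k l t i j * w t i j) = (\<Sum>j\<in>UNIV. if j = l then (if t = s \<and> i = k then w s k l else 0) else 0)"
      by (rule sum.cong) (auto simp: unit3_def)
    then show ?thesis by simp
  qed
  moreover have "(\<Sum>i\<in>UNIV. if t = s then if i = k then w s k l else 0 else 0) = (if t = s then w s k l else 0)" for t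
    by simp
  ultimately show ?thesis by simp
qed

lemma sum_unit3_mult:
  "(\<Sum>n\<in>UNIV. unit3 s k l t j n * unit3 s' k' l' t' n i) =
    (if t = s \<and> j = k \<and> l = k' \<and> t' = s' \<and> i = l' then 1 else 0)"
proof -
  have "(\<Sum>n\<in>UNIV. unit3 s k l t j n * unit3 s' k' l' t' n i) =
    (\<Sum>n\<in>UNIV. if n = l then if t = s \<and> j = k \<and> l = k' \<and> t' = s' \<and> i = l' then 1 else 0 else 0)"
    by (rule sum.cong) (auto simp: unit3_def)
  then show ?thesis by simp
qed

lemma rel3: fixes i j :: 3 shows "j = i \<or> j = i + 1 \<or> j = i + 2"
  using exhaust_3[of i] exhaust_3[of j] by auto

lemma adj_polar_unit3_same:
  "adj_polar (unit3 t i j) (unit3 t k l) = (\<lambda>t' i' j'.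
     unit3 t i j t' (i'+1) (j'+1) * unit3 t k l t' (i'+2) (j'+2) + unit3 t k l t' (i'+1) (j'+1) * unit3 t i j t' (i'+2) (j'+2)
     - unit3 t i j t' (i'+1) (j'+2) * unit3 t k l t' (i'+2) (j'+1) - unit3 t k l t' (i'+1) (j'+2) * unit3 t i j t' (i'+2) (j'+1))"
proof (intro ext, goal_cases)
  case (1 t' i' j')
  show ?case unfolding adj_polar_def sum.distrib sum_unit3_mult
    using rel3[of t t'] by (elim disjE) simp_all
qed

lemma adj_polar_unit3_det:
  "adj_polar (unit3 t (i+1) (j+1)) (unit3 t (i+2) (j+2)) = unit3 t i j" (is ?A)
  "adj_polar (unit3 t (i+1) (j+2)) (unit3 t (i+2) (j+1)) = (\<lambda>t' i' j'. - unit3 t i j t' i' j')" (is ?B)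
proof -
  show ?A
  proof (intro ext, goal_cases)
    case (1 t' i' j')
    show ?case unfolding adj_polar_unit3_same unfolding unit3_def
      using rel3[of i i'] rel3[of j j'] by (elim disjE) simp_all
  qed
  show ?B
  proof (intro ext, goal_cases)
    case (1 t' i' j')
    show ?case unfolding adj_polar_unit3_same unfolding unit3_def
      using rel3[of i i'] rel3[of j j'] by (elim disjE) simp_all
  qed
qed

lemma adj_polar_unit3_trace:
  "adj_polar (unit3 (t+1) j k) (unit3 (t+2) k' i) = (\<lambda>t' i' j'. if k = k' then - unit3 t i j t' i' j' else 0)"
proof (intro ext, goal_cases)
  case (1 t' i' j')
  show ?case unfolding adj_polar_def sum.distrib sum_unit3_mult unfolding unit3_def
    using rel3[of t t'] by (elim disjE) auto
qed

lemma adj_polar_unit3_zero: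
  "adj_polar (unit3 t i j) (unit3 t i l) = (\<lambda>t' i' j'. 0)" (is ?A)
  "adj_polar (unit3 t i j) (unit3 t k j) = (\<lambda>t' i' j'. 0)" (is ?B)
proof -
  show ?A
  proof (intro ext, goal_cases)
    case (1 t' i' j')
    show ?case unfolding adj_polar_unit3_same unfolding unit3_def
      using rel3[of i i'] by (elim disjE) simp_all
  qed
  show ?B
  proof (intro ext, goal_cases)
    case (1 t' i' j')
    show ?case unfolding adj_polar_unit3_same unfolding unit3_def
      using rel3[of j j'] by (elim disjE) simp_all
  qed
qed

text \<open>This lemma and the next two list the 45 monomials of the cubic form: two matrix units either lie in
exactly one monomial, whose third member is then picked out with a sign, or in none.\<close>

lemma unit3_cubic_polar_det:
  "cubic_polar (unit3 t (i+1) (j+1)) (unit3 t (i+2) (j+2)) w = w t i j"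
  "cubic_polar (unit3 t (i+1) (j+2)) (unit3 t (i+2) (j+1)) w = - w t i j"
  by (simp_all add: cubic_polar_def adj_polar_unit3_det pair_unit3 sum_negf)

lemma unit3_cubic_polar_trace:
  "cubic_polar (unit3 (t+1) j k) (unit3 (t+2) k i) w = - w t i j"
  by (simp add: cubic_polar_def adj_polar_unit3_trace pair_unit3 sum_negf)

lemma unit3_cubic_polar_zero:
  "cubic_polar (unit3 t i j) (unit3 t i l) w = 0"
  "cubic_polar (unit3 t i j) (unit3 t k j) w = 0"
  "k \<noteq> k' \<Longrightarrow> cubic_polar (unit3 (t+1) j k) (unit3 (t+2) k' i) w = 0"
  by (simp_all add: cubic_polar_def adj_polar_unit3_zero adj_polar_unit3_trace)

definition clinear :: "(triple \<Rightarrow> triple) \<Rightarrow> bool" where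
  "clinear D \<longleftrightarrow> (\<forall>u c v. D (add_scaled u c v) = add_scaled (D u) c (D v))"

definition derivation :: "(triple \<Rightarrow> triple) \<Rightarrow> bool" where
  "derivation D \<longleftrightarrow> clinear D \<and> (\<forall>u. cubic_polar u u (D u) = 0)"

text \<open>Polarisation of the cubic identity \<open>cubic_polar u u (D u) = 0\<close>.\<close>

lemma derivation_cubic_polar:
  assumes "derivation D"
  shows "cubic_polar u v (D w) + cubic_polar v w (D u) + cubic_polar w u (D v) = 0"
proof -
  define s where "s u = cubic_polar u u (D u)" for u
  have D: "D (add_scaled u c v) = add_scaled (D u) c (D v)" for u c v
    using assms by (simp add: derivation_def clinear_def)
  have s0: "s u = 0" for u
    using assms by (simp add: derivation_def s_def)
  \<comment> \<open>The third difference of a cubic form is its polarisation.\<close>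
  have "s (add_scaled (add_scaled u 1 v) 1 w) - s (add_scaled u 1 v) - s (add_scaled v 1 w) - s (add_scaled w 1 u) + s u + s v + s w
     = 2 * (cubic_polar u v (D w) + cubic_polar v w (D u) + cubic_polar w u (D v))"
    by (simp add: s_def D cubic_polar_add_scaled cubic_polar_sym12 algebra_simps)
  then have "2 * (cubic_polar u v (D w) + cubic_polar v w (D u) + cubic_polar w u (D v)) = 0"
    by (simp only: s0) simp
  then show ?thesis by (simp only: mult_eq_0_iff) simp
qed

context
  fixes D :: "triple \<Rightarrow> triple"
  assumes D: "derivation D"
begin

text \<open>If \<open>x\<close> and \<open>y\<close> lie in a monomial with third member \<open>z\<close>, then the identity for \<open>(x, y, x)\<close> is
\<open>2\<close> times the \<open>z\<close>-coordinate of \<open>D x\<close>, because no monomial contains a matrix unit twice.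
So \<open>D\<close> has no entry between two units in a common monomial.\<close>

lemma entry_zero_same:
  assumes "i \<noteq> k" "j \<noteq> l"
  shows "D (unit3 t k l) t i j = 0"
proof -
  have *: "cubic_polar x y (D x) = 0" if "cubic_polar x x (D y) = 0" for x y
    using derivation_cubic_polar[OF D, of x y x] that by (simp add: cubic_polar_sym12)
  show ?thesis
    using assms(1)
  proof (cases rule: neq3_cases)
    case 1
    show ?thesis using assms(2)
    proof (cases rule: neq3_cases)
      case 1
      then show ?thesis
        using *[OF unit3_cubic_polar_zero(1), of t "i+1" "j+1" "unit3 t (i+2) (j+2)"] \<open>k = i+1\<close> by (simp add: unit3_cubic_polar_det)
    next
      case 2
      then show ?thesis
        using *[OF unit3_cubic_polar_zero(1), of t "i+1" "j+2" "unit3 t (i+2) (j+1)"] \<open>k = i+1\<close> by (simp add: unit3_cubic_polar_det)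
    qed
  next
    case 2
    show ?thesis using assms(2)
    proof (cases rule: neq3_cases)
      case 1
      then show ?thesis
        using *[OF unit3_cubic_polar_zero(1), of t "i+2" "j+1" "unit3 t (i+1) (j+2)"] \<open>k = i+2\<close>
        by (simp add: unit3_cubic_polar_det cubic_polar_sym12[of "unit3 t (i+2) (j+1)"])
    next
      case 2
      then show ?thesis
        using *[OF unit3_cubic_polar_zero(1), of t "i+2" "j+2" "unit3 t (i+1) (j+1)"] \<open>k = i+2\<close>
        by (simp add: unit3_cubic_polar_det cubic_polar_sym12[of "unit3 t (i+2) (j+2)"])
    qed
  qed
qed

lemma entry_zero_next: "D (unit3 (t+1) j k) t i j = 0"
  using derivation_cubic_polar[OF D, of "unit3 (t+1) j k" "unit3 (t+2) k i" "unit3 (t+1) j k"]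
  by (simp add: unit3_cubic_polar_zero(1) unit3_cubic_polar_trace cubic_polar_sym12[of "unit3 (t+2) k i"])

lemma entry_zero_prev: "D (unit3 (t+2) k i) t i j = 0"
  using derivation_cubic_polar[OF D, of "unit3 (t+1) j k" "unit3 (t+2) k i" "unit3 (t+2) k i"]
  by (simp add: unit3_cubic_polar_zero(1) unit3_cubic_polar_trace cubic_polar_sym12[of "unit3 (t+2) k i"])

text \<open>Each of the three terms of the identity for the members of a monomial is a diagonal entry, and the
signs agree.\<close>

lemma entry_diag_trace:
  "D (unit3 t i j) t i j + D (unit3 (t+1) j k) (t+1) j k + D (unit3 (t+2) k i) (t+2) k i = 0"
  using derivation_cubic_polar[OF D, of "unit3 t i j" "unit3 (t+1) j k" "unit3 (t+2) k i",
      unfolded unit3_cubic_polar_trace[of t j k i] unit3_cubic_polar_trace[of "t+1" k i j, unfolded add3_simps]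
       unit3_cubic_polar_trace[of "t+2" i j k, unfolded add3_simps]]
  by algebra

lemma entry_diag_det:
  "D (unit3 t i j) t i j + D (unit3 t (i+1) (j+1)) t (i+1) (j+1) + D (unit3 t (i+2) (j+2)) t (i+2) (j+2) = 0"
  using derivation_cubic_polar[OF D, of "unit3 t i j" "unit3 t (i+1) (j+1)" "unit3 t (i+2) (j+2)",
      unfolded unit3_cubic_polar_det(1)[of t i j] unit3_cubic_polar_det(1)[of t "i+1" "j+1", unfolded add3_simps]
       unit3_cubic_polar_det(1)[of t "i+2" "j+2", unfolded add3_simps]]
  by algebra

text \<open>The entries belonging to the root \<open>x t i - x t j\<close>.  As \<open>m\<close> and \<open>n\<close> are free, this ties all six of
them together.\<close>

lemma entry_dif:
  assumes "i \<noteq> j"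
  shows "D (unit3 t j m) t i m = - D (unit3 (t+2) n i) (t+2) n j"
  using derivation_cubic_polar[OF D, of "unit3 t j m" "unit3 (t+1) m n" "unit3 (t+2) n i",
      unfolded unit3_cubic_polar_trace[of t m n i] unit3_cubic_polar_trace[of "t+2" j m n, unfolded add3_simps]
       unit3_cubic_polar_zero(3)[OF assms, of "t+1" n m, unfolded add3_simps]]
  by algebra

text \<open>The entries belonging to the root \<open>x t i + x (t+1) j + x (t+2) k\<close>: there are two for each of the
three values of \<open>t\<close>.  They agree up to sign for fixed \<open>t\<close>, and \<open>entry_pos_cyc\<close> moves from \<open>t\<close> to
\<open>t+1\<close>.  The two lemmas after that do the same for the negative roots.\<close>

lemma entry_pos_sign:
  "D (unit3 (t+1) (j+2) k) t i (j+1) = - D (unit3 (t+1) (j+1) k) t i (j+2)"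
  using derivation_cubic_polar[OF D, of "unit3 (t+1) (j+1) k" "unit3 (t+1) (j+2) k" "unit3 (t+2) k i",
      unfolded cubic_polar_sym12[of "unit3 (t+2) k i"]
       unit3_cubic_polar_trace[of t "j+2" k i] unit3_cubic_polar_trace[of t "j+1" k i] unit3_cubic_polar_zero(2)]
  by algebra

lemma entry_pos_cyc:
  "D (unit3 (t+1) (j+1) k) t i (j+2) = D (unit3 (t+2) (k+1) i) (t+1) j (k+2)"
proof -
  have zero: "cubic_polar (unit3 (t+1) (j+1) k) (unit3 (t+2) (k+1) i) w = 0" for w
    using unit3_cubic_polar_zero(3)[of k "k+1" t "j+1" i w] by simp
  show ?thesis
  using derivation_cubic_polar[OF D, of "unit3 (t+1) (j+1) k" "unit3 (t+1) (j+2) (k+1)" "unit3 (t+2) (k+1) i",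
     unfolded cubic_polar_sym12[of "unit3 (t+2) (k+1) i"] unit3_cubic_polar_trace[of t "j+2" "k+1" i]
      unit3_cubic_polar_det(1)[of "t+1" j "k+2", unfolded add3_simps]
      zero]
  by algebra
qed

lemma entry_neg_sign:
  "D (unit3 (t+2) i (j+2)) t (j+1) k = - D (unit3 (t+2) i (j+1)) t (j+2) k"
  using derivation_cubic_polar[OF D, of "unit3 (t+2) i (j+1)" "unit3 (t+2) i (j+2)" "unit3 (t+1) k i",
      unfolded cubic_polar_sym12[of "unit3 (t+2) i (j+2)"]
       unit3_cubic_polar_trace[of t k i "j+2"] unit3_cubic_polar_trace[of t k i "j+1"] unit3_cubic_polar_zero(1)]
  by algebra

lemma entry_neg_cyc:
  "D (unit3 (t+2) i (j+1)) t (j+2) k = D (unit3 t j (k+1)) (t+1) (k+2) i"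
proof -
  have zero: "cubic_polar (unit3 (t+2) i (j+1)) (unit3 t j (k+1)) w = 0" for w
    using unit3_cubic_polar_zero(3)[of "j+1" j "t+1" i "k+1" w] by simp
  show ?thesis
  using derivation_cubic_polar[OF D, of "unit3 t j (k+1)" "unit3 t (j+1) (k+2)" "unit3 (t+2) i (j+1)",
     unfolded unit3_cubic_polar_det(1)[of "t" "j+2" "k", unfolded add3_simps]
       cubic_polar_sym12[of "unit3 t (j+1) (k+2)"]
       unit3_cubic_polar_trace[of "t+1" i "j+1" "k+2", unfolded add3_simps]
       zero]
  by algebra
qed

end

section \<open>Derivations of the cubic form\<close>

text \<open>A tensor indexed by \<open>(i\<^sub>1, i\<^sub>2, i\<^sub>3)\<close>, addressed by the cyclic rotation \<open>(i\<^sub>t, i\<^sub>t\<^sub>+\<^sub>1, i\<^sub>t\<^sub>+\<^sub>2)\<close> of its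
indices.  This makes all formulas uniform in \<open>t\<close>.\<close>

definition cyc_index :: "(3 \<Rightarrow> 3 \<Rightarrow> 3 \<Rightarrow> complex) \<Rightarrow> 3 \<Rightarrow> 3 \<Rightarrow> 3 \<Rightarrow> 3 \<Rightarrow> complex" where
  "cyc_index P t i j k = (if t = 1 then P i j k else if t = 2 then P k i j else P j k i)"

lemma cyc_index_cyc: "cyc_index P (t+1) j k i = cyc_index P t i j k" "cyc_index P (t+2) k i j = cyc_index P t i j k"
  using exhaust_3[of t] by (auto simp: cyc_index_def)

text \<open>The general element of the Lie algebra in the model \<open>3 sl(3) \<oplus> (3,3,3) \<oplus> (3*,3*,3*)\<close>.  The
matrices \<open>X\<close> act by \<open>M\<^sub>t \<mapsto> X\<^sub>t M\<^sub>t - M\<^sub>t X\<^sub>t\<^sub>+\<^sub>1\<close>.  For \<open>P = a\<^sub>1 \<otimes> a\<^sub>2 \<otimes> a\<^sub>3\<close> the part that contains \<open>P\<close> is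
the matrix \<open>a\<^sub>t (a\<^sub>t\<^sub>+\<^sub>1 \<times> M\<^sub>t\<^sub>+\<^sub>1 a\<^sub>t\<^sub>+\<^sub>2)\<^sup>T\<close>, and dually for \<open>Q\<close>.  The minus sign in front of the part with \<open>Q\<close>
makes the brackets of opposite root vectors coroots instead of their negatives.\<close>

definition e6_op :: "triple \<Rightarrow> triple \<Rightarrow> triple \<Rightarrow> triple \<Rightarrow> triple" where
  "e6_op X P Q M = (\<lambda>t i j.
     (\<Sum>k\<in>UNIV. X t i k * M t k j) - (\<Sum>k\<in>UNIV. M t i k * X (t+1) k j)
     + (\<Sum>k\<in>UNIV. cyc_index P t i (j+1) k * M (t+1) (j+2) k - cyc_index P t i (j+2) k * M (t+1) (j+1) k)
     - (\<Sum>k\<in>UNIV. cyc_index Q t (i+1) j k * M (t+2) k (i+2) - cyc_index Q t (i+2) j k * M (t+2) k (i+1)))"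

lemma sum3_shift:
  fixes f :: "3 \<Rightarrow> 'a::comm_monoid_add"
  shows "(\<Sum>t\<in>UNIV. f (t + 1)) = (\<Sum>t\<in>UNIV. f t)"
  by (simp add: sum_3 algebra_simps)

definition det3 :: "triple \<Rightarrow> 3 \<Rightarrow> complex" where
  "det3 u t = (\<Sum>j\<in>UNIV. u t 1 j * (u t 2 (j+1) * u t 3 (j+2) - u t 2 (j+2) * u t 3 (j+1)))"

definition cyc_prod :: "triple \<Rightarrow> 3 \<Rightarrow> 3 \<Rightarrow> 3 \<Rightarrow> complex" where
  "cyc_prod u t k i = (\<Sum>j\<in>UNIV. \<Sum>l\<in>UNIV. u t k j * u (t+1) j l * u (t+2) l i)"

text \<open>Both this and \<open>sharp_col\<close> combine Laplace expansion, along rows or columns, with the cyclic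
invariance of the trace.\<close>

lemma sharp_row:
  "(\<Sum>j\<in>UNIV. adj_polar u u t i j * u t k j) = 2 * ((if i = k then det3 u t else 0) - cyc_prod u t k i)"
proof -
  have "(\<Sum>j\<in>UNIV. adj_polar u u t i j * u t k j) =
    2 * ((\<Sum>j\<in>UNIV. (u t (i+1) (j+1) * u t (i+2) (j+2) - u t (i+1) (j+2) * u t (i+2) (j+1)) * u t k j) - cyc_prod u t k i)"
    by (simp add: adj_polar_def cyc_prod_def sum_distrib_left sum_distrib_right sum_subtractf[symmetric] algebra_simps)
  moreover have "(\<Sum>j\<in>UNIV. (u t (i+1) (j+1) * u t (i+2) (j+2) - u t (i+1) (j+2) * u t (i+2) (j+1)) * u t k j)
    = (if i = k then det3 u t else 0)"
    using exhaust_3[of i] exhaust_3[of k] by (elim disjE) (simp_all add: det3_def sum_3 algebra_simps)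
  ultimately show ?thesis by simp
qed

lemma sharp_col:
  "(\<Sum>i\<in>UNIV. adj_polar u u t i j * u t i k) = 2 * ((if j = k then det3 u t else 0) - cyc_prod u (t+1) j k)"
proof -
  have "(\<Sum>i\<in>UNIV. adj_polar u u t i j * u t i k) =
    2 * ((\<Sum>i\<in>UNIV. (u t (i+1) (j+1) * u t (i+2) (j+2) - u t (i+1) (j+2) * u t (i+2) (j+1)) * u t i k) -
       (\<Sum>i\<in>UNIV. \<Sum>l\<in>UNIV. u (t+1) j l * u (t+2) l i * u t i k))"
    by (simp add: adj_polar_def sum_distrib_left sum_distrib_right sum_subtractf[symmetric] algebra_simps)
  also have "(\<Sum>i\<in>UNIV. \<Sum>l\<in>UNIV. u (t+1) j l * u (t+2) l i * u t i k) = cyc_prod u (t+1) j k"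
    unfolding cyc_prod_def by (subst sum.swap) simp
  also have "(\<Sum>i\<in>UNIV. (u t (i+1) (j+1) * u t (i+2) (j+2) - u t (i+1) (j+2) * u t (i+2) (j+1)) * u t i k)
    = (if j = k then det3 u t else 0)"
    using exhaust_3[of j] exhaust_3[of k] by (elim disjE) (simp_all add: det3_def sum_3 algebra_simps)
  finally show ?thesis .
qed

text \<open>The determinants contribute multiples of the traces of the \<open>X\<^sub>t\<close>, and the contributions of
\<open>tr (M\<^sub>1 M\<^sub>2 M\<^sub>3)\<close> telescope around the cycle.\<close>

lemma cubic_polar_e6_op_X:
  assumes "\<And>t. (\<Sum>i\<in>UNIV. X t i i) = 0"
  shows "cubic_polar u u (\<lambda>t i j. (\<Sum>k\<in>UNIV. X t i k * u t k j) - (\<Sum>k\<in>UNIV. u t i k * X (t+1) k j)) = 0"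
proof -
  have "cubic_polar u u (\<lambda>t i j. (\<Sum>k\<in>UNIV. X t i k * u t k j) - (\<Sum>k\<in>UNIV. u t i k * X (t+1) k j)) =
     (\<Sum>t\<in>UNIV. \<Sum>i\<in>UNIV. \<Sum>k\<in>UNIV. X t i k * (\<Sum>j\<in>UNIV. adj_polar u u t i j * u t k j))
     - (\<Sum>t\<in>UNIV. \<Sum>j\<in>UNIV. \<Sum>k\<in>UNIV. X (t+1) k j * (\<Sum>i\<in>UNIV. adj_polar u u t i j * u t i k))"
  proof -
    have 1: "(\<Sum>j\<in>UNIV. adj_polar u u t i j * (\<Sum>k\<in>UNIV. X t i k * u t k j)) =
      (\<Sum>k\<in>UNIV. X t i k * (\<Sum>j\<in>UNIV. adj_polar u u t i j * u t k j))" for t i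
      unfolding sum_distrib_left by (subst sum.swap) (simp add: mult_ac)
    have 2: "(\<Sum>i\<in>UNIV. \<Sum>j\<in>UNIV. adj_polar u u t i j * (\<Sum>k\<in>UNIV. u t i k * X (t+1) k j)) =
      (\<Sum>j\<in>UNIV. \<Sum>k\<in>UNIV. X (t+1) k j * (\<Sum>i\<in>UNIV. adj_polar u u t i j * u t i k))" for t
    proof (subst sum.swap, rule sum.cong[OF refl])
      fix j :: 3
      show "(\<Sum>i\<in>UNIV. adj_polar u u t i j * (\<Sum>k\<in>UNIV. u t i k * X (t+1) k j)) =
         (\<Sum>k\<in>UNIV. X (t+1) k j * (\<Sum>i\<in>UNIV. adj_polar u u t i j * u t i k))"
        unfolding sum_distrib_left by (subst sum.swap) (simp add: mult_ac)
    qed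
    show ?thesis unfolding cubic_polar_def right_diff_distrib sum_subtractf 1 2 ..
  qed
  also have "\<dots> =
     2 * ((\<Sum>t\<in>UNIV. (\<Sum>i\<in>UNIV. X t i i) * det3 u t) - (\<Sum>t\<in>UNIV. \<Sum>i\<in>UNIV. \<Sum>k\<in>UNIV. X t i k * cyc_prod u t k i))
     - 2 * ((\<Sum>t\<in>UNIV. (\<Sum>i\<in>UNIV. X (t+1) i i) * det3 u t) - (\<Sum>t\<in>UNIV. \<Sum>j\<in>UNIV. \<Sum>k\<in>UNIV. X (t+1) k j * cyc_prod u (t+1) j k))"
  proof -
    have d: "x * (2 * ((if b then y else 0) - z)) = 2 * (if b then x * y else 0) - 2 * (x * z)" for x y z :: complex and b
      by (simp add: algebra_simps)
    show ?thesis
      unfolding sharp_row sharp_col d sum_subtractf sum_distrib_left[symmetric] sum_distrib_right by simp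
  qed
  also have "\<dots> = 0"
  proof -
    have "(\<Sum>t\<in>UNIV. \<Sum>j\<in>UNIV. \<Sum>k\<in>UNIV. X (t+1) k j * cyc_prod u (t+1) j k) = (\<Sum>t\<in>UNIV. \<Sum>i\<in>UNIV. \<Sum>k\<in>UNIV. X t i k * cyc_prod u t k i)"
      unfolding sum3_shift[of "\<lambda>t. \<Sum>j\<in>UNIV. \<Sum>k\<in>UNIV. X t k j * cyc_prod u t j k"]
      by (intro sum.cong refl sum.swap)
    then show ?thesis by (simp add: assms)
  qed
  finally show ?thesis .
qed

lemma sum3_from2:
  fixes f :: "3 \<Rightarrow> 3 \<Rightarrow> 'a::comm_monoid_add"
  shows "(\<Sum>k\<in>UNIV. \<Sum>l\<in>UNIV. f k l) =
    (f i j + f i (j+1) + f i (j+2)) + (f (i+1) j + f (i+1) (j+1) + f (i+1) (j+2))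
    + (f (i+2) j + f (i+2) (j+1) + f (i+2) (j+2))"
  unfolding sum3_from[of "\<lambda>k. sum (f k) UNIV" i] by (simp only: sum3_from[of _ j])

lemma sum_cyc_index:
  "(\<Sum>t\<in>UNIV. \<Sum>i\<in>UNIV. \<Sum>j\<in>UNIV. \<Sum>k\<in>UNIV. cyc_index P t i j k * a t i j k) =
    (\<Sum>i\<in>UNIV. \<Sum>j\<in>UNIV. \<Sum>k\<in>UNIV. P i j k * (a 1 i j k + a 2 j k i + a 3 k i j))"
proof -
  have 2: "(\<Sum>i\<in>UNIV. \<Sum>j\<in>UNIV. \<Sum>k\<in>UNIV. f k i j) = (\<Sum>i\<in>UNIV. \<Sum>j\<in>UNIV. \<Sum>k\<in>UNIV. f i j k)" for f :: "3 \<Rightarrow> 3 \<Rightarrow> 3 \<Rightarrow> complex"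
    by (simp add: sum_3 algebra_simps)
  show ?thesis
    unfolding sum_3[of "\<lambda>t. \<Sum>i\<in>UNIV. \<Sum>j\<in>UNIV. \<Sum>k\<in>UNIV. cyc_index P t i j k * a t i j k"]
     2[of "\<lambda>i j k. cyc_index P 2 j k i * a 2 j k i"]
     2[of "\<lambda>i j k. cyc_index P 3 j k i * a 3 j k i"]
     2[of "\<lambda>i j k. cyc_index P 3 k i j * a 3 k i j"]
    by (simp add: cyc_index_def sum.distrib ring_distribs)
qed

lemma adj_polar_diag:
  "adj_polar u u t i j = 2 * (u t (i+1) (j+1) * u t (i+2) (j+2) - u t (i+1) (j+2) * u t (i+2) (j+1)
     - (u (t+1) j k * u (t+2) k i + u (t+1) j (k+1) * u (t+2) (k+1) i + u (t+1) j (k+2) * u (t+2) (k+2) i))"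
  by (simp add: adj_polar_def sum3_from[of _ k])

lemma add3_nums: "1 + 1 = (2::3)" "1 + 2 = (3::3)" "2 + 1 = (3::3)" "2 + 2 = (1::3)" "3 + 1 = (1::3)" "3 + 2 = (2::3)"
  by simp_all

text \<open>By linearity in \<open>P\<close> only a single tensor index \<open>(i, j, k)\<close> matters.  For it the determinant terms of
each \<open>t\<close> cancel against trace terms of a neighbouring one.\<close>

lemma cubic_polar_pos:
  "cubic_polar u u (\<lambda>t i j. \<Sum>k\<in>UNIV. cyc_index P t i (j+1) k * u (t+1) (j+2) k - cyc_index P t i (j+2) k * u (t+1) (j+1) k) = 0"
proof -
  define a where "a t i j k = u (t+1) (j+1) k * adj_polar u u t i (j+2) - u (t+1) (j+2) k * adj_polar u u t i (j+1)" for t i j k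
  have shift: "(\<Sum>j\<in>UNIV. f (j+1) * g j) = (\<Sum>j\<in>UNIV. f j * g (j+2))"
     "(\<Sum>j\<in>UNIV. f (j+2) * g j) = (\<Sum>j\<in>UNIV. f j * g (j+1))" for f g :: "3 \<Rightarrow> complex"
    by (simp_all add: sum_3 algebra_simps)
  have row: "(\<Sum>j\<in>UNIV. adj_polar u u t i j * (\<Sum>k\<in>UNIV. cyc_index P t i (j+1) k * u (t+1) (j+2) k - cyc_index P t i (j+2) k * u (t+1) (j+1) k))
     = (\<Sum>j\<in>UNIV. \<Sum>k\<in>UNIV. cyc_index P t i j k * a t i j k)" for t i
    by (simp add: sum_3 a_def algebra_simps)
  have "cubic_polar u u (\<lambda>t i j. \<Sum>k\<in>UNIV. cyc_index P t i (j+1) k * u (t+1) (j+2) k - cyc_index P t i (j+2) k * u (t+1) (j+1) k)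
    = (\<Sum>t\<in>UNIV. \<Sum>i\<in>UNIV. \<Sum>j\<in>UNIV. \<Sum>k\<in>UNIV. cyc_index P t i j k * a t i j k)"
    unfolding cubic_polar_def row ..
  also have "\<dots> = (\<Sum>i\<in>UNIV. \<Sum>j\<in>UNIV. \<Sum>k\<in>UNIV. P i j k * (a 1 i j k + a 2 j k i + a 3 k i j))"
    by (rule sum_cyc_index)
  also have "\<dots> = 0"
  proof -
    have "a 1 i j k + a 2 j k i + a 3 k i j = 0" for i j k
      unfolding a_def adj_polar_diag[of u 1 _ _ k] adj_polar_diag[of u 2 _ _ i] adj_polar_diag[of u 3 _ _ j]
      by (simp only: add3_simps add3_nums) algebra
    then show ?thesis by simp
  qed
  finally show ?thesis .
qed

lemma cubic_polar_neg:
  "cubic_polar u u (\<lambda>t i j. \<Sum>k\<in>UNIV. cyc_index Q t (i+1) j k * u (t+2) k (i+2) - cyc_index Q t (i+2) j k * u (t+2) k (i+1)) = 0"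
proof -
  define a where "a t i j k = u (t+2) k (i+1) * adj_polar u u t (i+2) j - u (t+2) k (i+2) * adj_polar u u t (i+1) j" for t i j k
  have row: "(\<Sum>i\<in>UNIV. \<Sum>j\<in>UNIV. adj_polar u u t i j * (\<Sum>k\<in>UNIV. cyc_index Q t (i+1) j k * u (t+2) k (i+2) - cyc_index Q t (i+2) j k * u (t+2) k (i+1)))
     = (\<Sum>i\<in>UNIV. \<Sum>j\<in>UNIV. \<Sum>k\<in>UNIV. cyc_index Q t i j k * a t i j k)" for t
    by (subst (1 2) sum.swap) (simp add: sum_3 a_def algebra_simps)
  have "cubic_polar u u (\<lambda>t i j. \<Sum>k\<in>UNIV. cyc_index Q t (i+1) j k * u (t+2) k (i+2) - cyc_index Q t (i+2) j k * u (t+2) k (i+1))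
    = (\<Sum>t\<in>UNIV. \<Sum>i\<in>UNIV. \<Sum>j\<in>UNIV. \<Sum>k\<in>UNIV. cyc_index Q t i j k * a t i j k)"
    unfolding cubic_polar_def row ..
  also have "\<dots> = (\<Sum>i\<in>UNIV. \<Sum>j\<in>UNIV. \<Sum>k\<in>UNIV. Q i j k * (a 1 i j k + a 2 j k i + a 3 k i j))"
    by (rule sum_cyc_index)
  also have "\<dots> = 0"
  proof -
    have "a 1 i j k + a 2 j k i + a 3 k i j = 0" for i j k
      unfolding a_def adj_polar_diag[of u 1 _ _ k] adj_polar_diag[of u 2 _ _ i] adj_polar_diag[of u 3 _ _ j]
      by (simp only: add3_simps add3_nums) algebra
    then show ?thesis by simp
  qed
  finally show ?thesis .
qed

lemma e6_op_add_scaled: "e6_op X P Q (add_scaled u c v) = add_scaled (e6_op X P Q u) c (e6_op X P Q v)"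
  by (simp add: e6_op_def add_scaled_def sum3_from[of _ 1] algebra_simps)

lemma derivation_e6_op:
  assumes "\<And>t. (\<Sum>i\<in>UNIV. X t i i) = 0"
  shows "derivation (e6_op X P Q)"
  unfolding derivation_def clinear_def
proof (intro conjI allI e6_op_add_scaled)
  fix u
  have "e6_op X P Q u = add_scaled (add_scaled (\<lambda>t i j. (\<Sum>k\<in>UNIV. X t i k * u t k j) - (\<Sum>k\<in>UNIV. u t i k * X (t+1) k j))
     1 (\<lambda>t i j. \<Sum>k\<in>UNIV. cyc_index P t i (j+1) k * u (t+1) (j+2) k - cyc_index P t i (j+2) k * u (t+1) (j+1) k))
     (-1) (\<lambda>t i j. \<Sum>k\<in>UNIV. cyc_index Q t (i+1) j k * u (t+2) k (i+2) - cyc_index Q t (i+2) j k * u (t+2) k (i+1))"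
    unfolding e6_op_def add_scaled_def by simp
  then show "cubic_polar u u (e6_op X P Q u) = 0"
    by (simp add: cubic_polar_add_scaled cubic_polar_e6_op_X[of X, OF assms] cubic_polar_pos cubic_polar_neg)
qed

text \<open>Expansion in the basis of matrix units, for arbitrary functionals that are linear with respect to
\<open>add_scaled\<close>.\<close>

lemma linear_functional_unit3:
  assumes F: "\<And>u c v. F (add_scaled u c v) = F u + c * F v"
  shows "F M = (\<Sum>s\<in>UNIV. \<Sum>k\<in>UNIV. \<Sum>l\<in>UNIV. F (unit3 s k l) * M s k l)"
proof -
  define z :: triple where "z = (\<lambda>_ _ _. 0)"
  have "F (add_scaled z (-1) z) = F z + (-1) * F z" by (rule F)
  then have Fz: "F z = 0"
    by (simp add: add_scaled_def z_def)
  have *: "F (\<lambda>t i j. if (t,i,j) \<in> S then M t i j else 0) = (\<Sum>(s,k,l)\<in>S. F (unit3 s k l) * M s k l)"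
    if "finite S" for S
    using that
  proof (induction S)
    case empty
    then show ?case using Fz by (simp add: z_def)
  next
    case (insert x S)
    obtain s k l where x: "x = (s,k,l)" by (cases x)
    have eq: "(\<lambda>t i j. if (t,i,j) \<in> insert x S then M t i j else 0) =
        add_scaled (\<lambda>t i j. if (t,i,j) \<in> S then M t i j else 0) (M s k l) (unit3 s k l)"
      using insert.hyps by (auto simp: add_scaled_def unit3_def x fun_eq_iff)
    show ?case unfolding eq F using insert by (simp add: x)
  qed
  from this[of UNIV] show ?thesis
    by (simp add: UNIV_Times_UNIV[symmetric] sum.cartesian_product[symmetric] del: UNIV_Times_UNIV)
qed

text \<open>The parameters are recovered as row averages.  The relations for the monomials in \<open>tr (M\<^sub>1 M\<^sub>2 M\<^sub>3)\<close>
give the difference form, those for the determinants give tracelessness.\<close>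

lemma derivation_diagonal:
  assumes D: "derivation D"
  obtains x where "\<And>t. (\<Sum>i\<in>UNIV. x t i) = 0" "\<And>t i j. D (unit3 t i j) t i j = x t i - x (t+1) j"
proof
  define e where "e t i j = D (unit3 t i j) t i j" for t i j
  define x where "x t i = (\<Sum>j\<in>UNIV. e t i j) / 3" for t i
  have tr: "e t i j + e (t+1) j k + e (t+2) k i = 0" for t i j k
    unfolding e_def by (rule entry_diag_trace[OF D])
  have det: "e t i j + e t (i+1) (j+1) + e t (i+2) (j+2) = 0" for t i j
    unfolding e_def by (rule entry_diag_det[OF D])
  have tot: "(\<Sum>i\<in>UNIV. \<Sum>j\<in>UNIV. e t i j) = 0" for t
    using det[of t 1 1] det[of t 1 2] det[of t 1 3] unfolding sum_3 by simp algebra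
  show "(\<Sum>i\<in>UNIV. x t i) = 0" for t
    using tot[of t] by (simp add: x_def sum_divide_distrib[symmetric])
  have col: "(\<Sum>k\<in>UNIV. e (t+2) k i) = - 3 * x t i" for t i
  proof -
    have "0 = (\<Sum>j\<in>UNIV. \<Sum>k\<in>UNIV. e t i j + e (t+1) j k + e (t+2) k i)"
      by (simp add: tr)
    also have "\<dots> = 3 * (\<Sum>j\<in>UNIV. e t i j) + (\<Sum>j\<in>UNIV. \<Sum>k\<in>UNIV. e (t+1) j k) + 3 * (\<Sum>k\<in>UNIV. e (t+2) k i)"
      by (simp add: sum.distrib sum_distrib_left)
    also have "\<dots> = 3 * (3 * x t i + (\<Sum>k\<in>UNIV. e (t+2) k i))"
      by (simp add: tot x_def algebra_simps)
    finally show ?thesis by (simp add: add_eq_0_iff)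
  qed
  show "D (unit3 t i j) t i j = x t i - x (t+1) j" for t i j
  proof -
    have "0 = (\<Sum>k\<in>UNIV. e t i j + e (t+1) j k + e (t+2) k i)"
      by (simp add: tr)
    also have "\<dots> = 3 * (e t i j + x (t+1) j - x t i)"
      by (simp only: sum.distrib col) (simp add: x_def algebra_simps)
    finally show ?thesis unfolding e_def by simp algebra
  qed
qed

text \<open>Each parameter is read off from one entry of its root, and the preceding relations between the entries
of a derivation show that the choice of the entry is immaterial.\<close>

theorem derivation_imp_e6_op:
  assumes D: "derivation D"
  obtains X P Q where "\<And>t. (\<Sum>i\<in>UNIV. X t i i) = 0" "D = e6_op X P Q"
proof -
  have cl: "clinear D" using D by (simp add: derivation_def)
  obtain x where x0: "\<And>t. (\<Sum>i\<in>UNIV. x t i) = 0" and x: "\<And>t i j. D (unit3 t i j) t i j = x t i - x (t+1) j"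
    using derivation_diagonal[OF D] by blast
  define X where "X t i j = (if i = j then x t i else D (unit3 t j 1) t i 1)" for t i j
  define P where "P i j k = D (unit3 2 (j+1) k) 1 i (j+2)" for i j k
  define Q where "Q j k i = - D (unit3 3 i (j+1)) 1 (j+2) k" for i j k
  have Xd: "X t i i = x t i" for t i
    by (simp add: X_def)
  have X1: "D (unit3 t j m) t i m = X t i j" if "i \<noteq> j" for t i j m
    using that entry_dif[OF D that, of t m 1] entry_dif[OF D that, of t 1 1] by (simp add: X_def)
  have X2: "D (unit3 t m i) t m j = - X (t+1) i j" if "i \<noteq> j" for t i j m
    using entry_dif[OF D that, of "t+1" 1 m, unfolded add3_simps] X1[OF that, of "t+1" 1] by algebra
  have P1: "D (unit3 (t+1) (j+1) k) t i (j+2) = cyc_index P t i j k" for t i j k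
  proof -
    have 1: "D (unit3 2 (j+1) k) 1 i (j+2) = cyc_index P 1 i j k" for i j k
      by (simp add: P_def cyc_index_def)
    have 2: "D (unit3 3 (j+1) k) 2 i (j+2) = cyc_index P 2 i j k" for i j k
      using entry_pos_cyc[OF D, of 1 i j k] 1 cyc_index_cyc(1)[of P 1] by (simp add: cyc_index_cyc)
    have 3: "D (unit3 1 (j+1) k) 3 i (j+2) = cyc_index P 3 i j k" for i j k
      using entry_pos_cyc[OF D, of 2 i j k] 2 cyc_index_cyc(1)[of P 2] by (simp add: cyc_index_cyc)
    show ?thesis using exhaust_3[of t] 1 2 3 by auto
  qed
  have P2: "D (unit3 (t+1) (j+2) k) t i (j+1) = - cyc_index P t i j k" for t i j k
    using entry_pos_sign[OF D] P1 by simp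
  have Q1: "D (unit3 (t+2) i (j+1)) t (j+2) k = - cyc_index Q t j k i" for t i j k
  proof -
    have 1: "D (unit3 3 i (j+1)) 1 (j+2) k = - cyc_index Q 1 j k i" for i j k
      by (simp add: Q_def cyc_index_def)
    have 2: "D (unit3 1 i (j+1)) 2 (j+2) k = - cyc_index Q 2 j k i" for i j k
      using entry_neg_cyc[OF D, of 1 k i j] 1 cyc_index_cyc(1)[of Q 1] by (simp add: cyc_index_cyc)
    have 3: "D (unit3 2 i (j+1)) 3 (j+2) k = - cyc_index Q 3 j k i" for i j k
      using entry_neg_cyc[OF D, of 2 k i j] 2 cyc_index_cyc(1)[of Q 2] by (simp add: cyc_index_cyc)
    show ?thesis using exhaust_3[of t] 1 2 3 by auto
  qed
  have Q2: "D (unit3 (t+2) i (j+2)) t (j+1) k = cyc_index Q t j k i" for t i j k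
    using entry_neg_sign[OF D] Q1 by simp
  have "D M t i j = e6_op X P Q M t i j" for M t i j
  proof -
    have lin: "D (add_scaled u c v) t i j = D u t i j + c * D v t i j" for u c v
      using cl by (simp add: clinear_def add_scaled_def)
    have s0: "(\<Sum>k\<in>UNIV. \<Sum>l\<in>UNIV. D (unit3 t k l) t i j * M t k l) =
       (\<Sum>k\<in>UNIV. X t i k * M t k j) - (\<Sum>k\<in>UNIV. M t i k * X (t+1) k j)"
      unfolding sum3_from2[of "\<lambda>k l. D (unit3 t k l) t i j * M t k l" i j]
        sum3_from[of "\<lambda>k. X t i k * M t k j" i] sum3_from[of "\<lambda>k. M t i k * X (t+1) k j" j]
      by (simp add: X1 X2 x Xd entry_zero_same[OF D] left_diff_distrib)
    have s1: "(\<Sum>k\<in>UNIV. \<Sum>l\<in>UNIV. D (unit3 (t+1) k l) t i j * M (t+1) k l) =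
       (\<Sum>k\<in>UNIV. cyc_index P t i (j+1) k * M (t+1) (j+2) k - cyc_index P t i (j+2) k * M (t+1) (j+1) k)"
      unfolding sum3_from[of "\<lambda>k. \<Sum>l\<in>UNIV. D (unit3 (t+1) k l) t i j * M (t+1) k l" j]
      using P1[of t "j+1" _ i] P2[of t "j+2" _ i]
      by (simp add: entry_zero_next[OF D] sum_subtractf sum_negf)
    have s2: "(\<Sum>k\<in>UNIV. \<Sum>l\<in>UNIV. D (unit3 (t+2) k l) t i j * M (t+2) k l) =
       - (\<Sum>k\<in>UNIV. cyc_index Q t (i+1) j k * M (t+2) k (i+2) - cyc_index Q t (i+2) j k * M (t+2) k (i+1))"
      using Q1[of t _ "i+1" j] Q2[of t _ "i+2" j]
      unfolding sum_negf[symmetric] by (intro sum.cong refl, subst sum3_from[of _ i]) (simp add: entry_zero_prev[OF D])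
    show ?thesis
      by (simp only: linear_functional_unit3[of "\<lambda>M. D M t i j" M, OF lin] e6_op_def sum3_from[of "\<lambda>s. \<Sum>k\<in>UNIV. \<Sum>l\<in>UNIV. D (unit3 s k l) t i j * M s k l" t] s0 s1 s2 diff_conv_add_uminus)
  qed
  then have "D = e6_op X P Q" by (intro ext)
  moreover have "(\<Sum>i\<in>UNIV. X t i i) = 0" for t
    using x0 by (simp add: Xd)
  ultimately show ?thesis using that by blast
qed

section \<open>Exponentials of bounded endomorphisms\<close>

text \<open>A copy of the bounded endomorphisms with composition as multiplication.  As an instance
of a Banach algebra it inherits the exponential function.\<close>

typedef (overloaded) 'a endo = "UNIV :: ('a::{banach,perfect_space} \<Rightarrow>\<^sub>L 'a) set"
  morphisms endo_fun Endo by simp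

setup_lifting type_definition_endo

instantiation endo :: ("{banach,perfect_space}") real_vector
begin

lift_definition zero_endo :: "'a endo" is 0 .
lift_definition plus_endo :: "'a endo \<Rightarrow> 'a endo \<Rightarrow> 'a endo" is "(+)" .
lift_definition minus_endo :: "'a endo \<Rightarrow> 'a endo \<Rightarrow> 'a endo" is "(-)" .
lift_definition uminus_endo :: "'a endo \<Rightarrow> 'a endo" is uminus .
lift_definition scaleR_endo :: "real \<Rightarrow> 'a endo \<Rightarrow> 'a endo" is scaleR .

instance
  by standard (transfer; simp add: algebra_simps)+

end

instantiation endo :: ("{banach,perfect_space}") real_normed_algebra_1
begin

lift_definition one_endo :: "'a endo" is id_blinfun .
lift_definition times_endo :: "'a endo \<Rightarrow> 'a endo \<Rightarrow> 'a endo" is blinfun_compose .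
lift_definition norm_endo :: "'a endo \<Rightarrow> real" is norm .

definition sgn_endo :: "'a endo \<Rightarrow> 'a endo" where "sgn_endo x = x /\<^sub>R norm x"
definition dist_endo :: "'a endo \<Rightarrow> 'a endo \<Rightarrow> real" where "dist_endo x y = norm (x - y)"
definition uniformity_endo :: "('a endo \<times> 'a endo) filter" where
  "uniformity_endo = (INF e\<in>{0<..}. principal {(x, y). dist x y < e})"
definition open_endo :: "'a endo set \<Rightarrow> bool" where
  "open_endo U = (\<forall>x\<in>U. \<forall>\<^sub>F (x', y) in uniformity. x' = x \<longrightarrow> y \<in> U)"

instance
proof
  fix a b c :: "'a endo" and r s :: real
  show "a * b * c = a * (b * c)" by transfer (rule blinfun_eqI, simp)
  show "1 * a = a" by transfer (rule blinfun_eqI, simp)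
  show "a * 1 = a" by transfer (rule blinfun_eqI, simp)
  show "(a + b) * c = a * c + b * c" by transfer (rule blinfun_eqI, simp add: blinfun.bilinear_simps)
  show "a * (b + c) = a * b + a * c" by transfer (rule blinfun_eqI, simp add: blinfun.bilinear_simps)
  show "r *\<^sub>R a * b = r *\<^sub>R (a * b)" by transfer (rule blinfun_eqI, simp add: blinfun.bilinear_simps)
  show "a * r *\<^sub>R b = r *\<^sub>R (a * b)" by transfer (rule blinfun_eqI, simp add: blinfun.bilinear_simps)
  show n1: "norm (1 :: 'a endo) = 1" by transfer simp
  have "norm (0 :: 'a endo) = 0" by transfer simp
  then show "(0 :: 'a endo) \<noteq> 1" using n1 by auto
  show "dist a b = norm (a - b)" by (rule dist_endo_def)
  show "sgn a = a /\<^sub>R norm a" by (rule sgn_endo_def)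
  show "(uniformity :: ('a endo \<times> 'a endo) filter) = (INF e\<in>{0<..}. principal {(x, y). dist x y < e})"
    by (rule uniformity_endo_def)
  show "open U = (\<forall>x\<in>U. \<forall>\<^sub>F (x', y) in uniformity. x' = x \<longrightarrow> y \<in> U)" for U :: "'a endo set"
    by (rule open_endo_def)
  show "norm a = 0 \<longleftrightarrow> a = 0" by transfer simp
  show "norm (a + b) \<le> norm a + norm b" by transfer (rule norm_triangle_ineq)
  show "norm (r *\<^sub>R a) = \<bar>r\<bar> * norm a" by transfer simp
  show "norm (a * b) \<le> norm a * norm b" by transfer (rule norm_blinfun_compose)
qed

end

lemma bounded_linear_endo_fun: "bounded_linear endo_fun"
  by (rule bounded_linear_intro[where K = 1])
    (simp_all add: plus_endo.rep_eq scaleR_endo.rep_eq norm_endo.rep_eq)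

instance endo :: ("{banach,perfect_space}") banach
proof
  fix X :: "nat \<Rightarrow> 'a endo"
  assume "Cauchy X"
  then have "Cauchy (\<lambda>n. endo_fun (X n))"
    by (simp add: Cauchy_def dist_norm norm_endo.rep_eq minus_endo.rep_eq)
  then obtain L where "(\<lambda>n. endo_fun (X n)) \<longlonglongrightarrow> L"
    using Cauchy_convergent_iff convergent_def by blast
  then have "X \<longlonglongrightarrow> Endo L"
    by (simp add: LIMSEQ_iff norm_endo.rep_eq minus_endo.rep_eq Endo_inverse)
  then show "convergent X" by (auto simp: convergent_def)
qed

lemma one_parameter_group:
  fixes X :: "'a::{banach,perfect_space} \<Rightarrow>\<^sub>L 'a"
  obtains \<gamma> where "\<gamma> 0 = id_blinfun" "\<And>t. (\<gamma> has_vector_derivative X o\<^sub>L \<gamma> t) (at t)"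
proof
  let ?\<gamma> = "\<lambda>t. endo_fun (exp (t *\<^sub>R Endo X))"
  show "?\<gamma> 0 = id_blinfun" by (simp add: one_endo.rep_eq)
  show "(?\<gamma> has_vector_derivative X o\<^sub>L ?\<gamma> t) (at t)" for t
    using bounded_linear.has_vector_derivative[OF bounded_linear_endo_fun exp_scaleR_has_vector_derivative_left[of "Endo X" t]]
    by (simp add: times_endo.rep_eq Endo_inverse)
qed

section \<open>Hermitian octonionic matrices as triples of complex matrices\<close>

definition colour :: "3 \<Rightarrow> octunit" where
  "colour i = (if i = 1 then I else if i = 2 then J else K)"

definition colourL :: "3 \<Rightarrow> octunit" where
  "colourL i = (if i = 1 then IL else if i = 2 then JL else KL)"

text \<open>The off-diagonal entries are numbered by the index that they miss: \<open>b\<close>, \<open>c\<close>, \<open>a\<close> belong to \<open>1, 2, 3\<close>.\<close>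

definition off_diag :: "herm3 \<Rightarrow> 3 \<Rightarrow> oct" where
  "off_diag x i = herm_mat x $ (i+2) $ (i+1)"

text \<open>The first matrix is the image of the Hermitian matrix under the projection of the octonions to
\<open>span {1, L} \<cong> \<complex>\<close>.  The third matrix is the conjugate transpose of the second; this identifies the
Hermitian matrices with a real form of the space of triples.\<close>

definition coord :: "herm3 \<Rightarrow> triple" where
  "coord x = (\<lambda>t i j.
     if t = 1 then Complex (herm_mat x $ i $ j $ One) (herm_mat x $ i $ j $ L)
     else if t = 2 then Complex (off_diag x i $ colour j) (off_diag x i $ colourL j)
     else Complex (off_diag x j $ colour i) (- off_diag x j $ colourL i))"

lemma herm_mat_linear: "herm_mat (x + r *\<^sub>R y) = herm_mat x + r *\<^sub>R herm_mat y"
  by (cases x; cases y) (auto simp: vec_eq_iff[where 'b=3] forall_3 oct_of_real_def algebra_simps)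

lemma coord_linear: "coord (x + r *\<^sub>R y) = add_scaled (coord x) (of_real r) (coord y)"
  by (intro ext) (simp add: coord_def off_diag_def herm_mat_linear add_scaled_def complex_eq_iff)

definition off_diag_part :: "(complex \<Rightarrow> real) \<Rightarrow> triple \<Rightarrow> 3 \<Rightarrow> oct" where
  "off_diag_part f M i = (\<chi> u. f (case u of
      One \<Rightarrow> (M 1 (i+2) (i+1) + M 1 (i+1) (i+2)) / 2
    | L \<Rightarrow> - \<i> * (M 1 (i+2) (i+1) - M 1 (i+1) (i+2)) / 2
    | I \<Rightarrow> (M 2 i 1 + M 3 1 i) / 2 | IL \<Rightarrow> - \<i> * (M 2 i 1 - M 3 1 i) / 2
    | J \<Rightarrow> (M 2 i 2 + M 3 2 i) / 2 | JL \<Rightarrow> - \<i> * (M 2 i 2 - M 3 2 i) / 2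
    | K \<Rightarrow> (M 2 i 3 + M 3 3 i) / 2 | KL \<Rightarrow> - \<i> * (M 2 i 3 - M 3 3 i) / 2))"

text \<open>With \<open>Re\<close> or \<open>Im\<close> for \<open>f\<close>, one of the two components of the inverse of \<open>complex_coord\<close>.\<close>

definition coord_part :: "(complex \<Rightarrow> real) \<Rightarrow> triple \<Rightarrow> herm3" where
  "coord_part f M = (f (M 1 1 1), f (M 1 2 2), f (M 1 3 3), off_diag_part f M 3, off_diag_part f M 1, off_diag_part f M 2)"

definition complex_coord :: "herm3 \<times> herm3 \<Rightarrow> triple" where
  "complex_coord v = add_scaled (coord (fst v)) \<i> (coord (snd v))"

definition coord_inv :: "triple \<Rightarrow> herm3 \<times> herm3" where
  "coord_inv M = (coord_part Re M, coord_part Im M)"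

lemma complex_coord_coord_inv: "complex_coord (coord_inv M) = M"
proof (intro ext)
  fix t i j
  show "complex_coord (coord_inv M) t i j = M t i j"
    using exhaust_3[of t] exhaust_3[of i] exhaust_3[of j]
    by (elim disjE) (simp_all add: complex_coord_def coord_inv_def coord_part_def off_diag_part_def coord_def add_scaled_def off_diag_def
      colour_def colourL_def oct_cnj_def oct_of_real_def octunit_vec_def axis_def complex_eq_iff field_simps)
qed

lemma coord_inv_complex_coord: "coord_inv (complex_coord v) = v"
proof -
  obtain p m n a b c p' m' n' a' b' c' where v: "v = ((p,m,n,a,b,c),(p',m',n',a',b',c'))"
    by (metis surj_pair)
  show ?thesis unfolding v
    by (simp add: complex_coord_def coord_inv_def coord_part_def off_diag_part_def coord_def add_scaled_def off_diag_def oct_eq_iff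
      colour_def colourL_def oct_cnj_def oct_of_real_def octunit_vec_def axis_def complex_eq_iff field_simps)
qed

text \<open>Euler's relation for the cubic form; the factor 6 comes from polarisation.\<close>

lemma cubic_polar_cube:
  "cubic_polar u u u = 6 * ((\<Sum>t\<in>UNIV. det3 u t) - (\<Sum>i\<in>UNIV. cyc_prod u 1 i i))"
proof -
  have shift: "(\<Sum>i\<in>UNIV. cyc_prod u (t+1) i i) = (\<Sum>i\<in>UNIV. cyc_prod u t i i)" for t
    unfolding cyc_prod_def by (simp add: sum_3 algebra_simps)
  have "cubic_polar u u u = (\<Sum>t\<in>UNIV. \<Sum>i\<in>UNIV. 2 * (det3 u t - cyc_prod u t i i))"
    unfolding cubic_polar_def sharp_row by simp
  also have "\<dots> = (\<Sum>t\<in>UNIV. 6 * det3 u t - 2 * (\<Sum>i\<in>UNIV. cyc_prod u t i i))"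
    by (simp add: sum_distrib_left[symmetric] sum_subtractf)
  also have "\<dots> = 6 * ((\<Sum>t\<in>UNIV. det3 u t) - (\<Sum>i\<in>UNIV. cyc_prod u 1 i i))"
    using shift[of 1] shift[of 2] unfolding sum_3[of "\<lambda>t. 6 * det3 u t - _ t"]
    by (simp add: sum_3[of "det3 u"])
  finally show ?thesis .
qed

lemma norm_oct: "(norm x)\<^sup>2 = (x$One)\<^sup>2 + (x$I)\<^sup>2 + (x$J)\<^sup>2 + (x$K)\<^sup>2 + (x$KL)\<^sup>2 + (x$JL)\<^sup>2 + (x$IL)\<^sup>2 + (x$L)\<^sup>2" for x :: oct
  by (simp only: power2_norm_eq_inner inner_vec_def UNIV_octunit) (simp add: power2_eq_square)

text \<open>An identity of real polynomials in 27 variables, checked separately for the real and the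
imaginary part.\<close>

lemma herm_det_cubic_polar: "6 * complex_of_real (herm_det x) = cubic_polar (coord x) (coord x) (coord x)"
proof -
  obtain p m n a b c where x: "x = (p,m,n,a,b,c)" by (metis surj_pair)
  show ?thesis unfolding cubic_polar_cube x
    apply (simp add: det3_def cyc_prod_def sum_3 coord_def off_diag_def colour_def colourL_def oct_Re_def octmult_nth
       oct_cnj_def oct_of_real_def octunit_vec_def axis_def norm_oct del: mult_cancel_left)
    apply (simp only: power2_eq_square complex_Re_numeral complex_Im_numeral complex_eq_iff complex.sel plus_complex.sel minus_complex.sel uminus_complex.sel times_complex.sel Re_complex_of_real Im_complex_of_real)
    apply (rule conjI)
    apply algebra
    apply algebra
    done
qed

section \<open>The complexified Lie algebra as derivations\<close>

lemma cubic_polar_has_vector_derivative: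
  assumes [derivative_intros]: "\<And>t i j. ((\<lambda>s. u s t i j) has_vector_derivative u' t i j) (at s)"
    "\<And>t i j. ((\<lambda>s. v s t i j) has_vector_derivative v' t i j) (at s)"
    "\<And>t i j. ((\<lambda>s. w s t i j) has_vector_derivative w' t i j) (at s)"
  shows "((\<lambda>s. cubic_polar (u s) (v s) (w s)) has_vector_derivative
    cubic_polar u' (v s) (w s) + cubic_polar (u s) v' (w s) + cubic_polar (u s) (v s) w') (at s)"
proof -
  have b: "((\<lambda>s. adj_polar (u s) (v s) t i j) has_vector_derivative adj_polar u' (v s) t i j + adj_polar (u s) v' t i j) (at s)" for t i j
    unfolding adj_polar_def
    by (rule derivative_eq_intros assms refl has_vector_derivative_mult has_vector_derivative_sum)+
      (simp add: sum.distrib algebra_simps)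
  show ?thesis
    unfolding cubic_polar_def
    by (rule derivative_eq_intros assms b refl has_vector_derivative_mult has_vector_derivative_sum)+
      (simp add: sum.distrib algebra_simps)
qed

lemma coord_bounded_linear: "bounded_linear (\<lambda>x. coord x t i j)"
proof -
  have "coord (x + y) t i j = coord x t i j + coord y t i j" for x y
    using coord_linear[of x 1 y] by (simp add: add_scaled_def)
  moreover have "coord (r *\<^sub>R x) t i j = r *\<^sub>R coord x t i j" for r x
  proof -
    have "coord 0 t i j = 0" using coord_linear[of 0 1 0] by (simp add: add_scaled_def fun_eq_iff)
    then show ?thesis using coord_linear[of 0 r x] by (simp add: add_scaled_def scaleR_conv_of_real)
  qed
  ultimately have "linear (\<lambda>x. coord x t i j)" by (intro linearI) auto
  then show ?thesis by (simp add: linear_conv_bounded_linear)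
qed

lemma cubic_polar_det_derivative:
  assumes "(\<gamma> has_vector_derivative y) (at s)"
  shows "((\<lambda>s. complex_of_real (herm_det (\<gamma> s))) has_vector_derivative
     cubic_polar (coord (\<gamma> s)) (coord (\<gamma> s)) (coord y) / 2) (at s)"
proof -
  have c: "((\<lambda>s. coord (\<gamma> s) t i j) has_vector_derivative coord y t i j) (at s)" for t i j
    by (rule bounded_linear.has_vector_derivative[OF coord_bounded_linear assms])
  have eq: "complex_of_real (herm_det x) = cubic_polar (coord x) (coord x) (coord x) / 6" for x
    unfolding herm_det_cubic_polar[symmetric] by simp
  have "((\<lambda>s. cubic_polar (coord (\<gamma> s)) (coord (\<gamma> s)) (coord (\<gamma> s)) / 6) has_vector_derivative
     (cubic_polar (coord y) (coord (\<gamma> s)) (coord (\<gamma> s)) + cubic_polar (coord (\<gamma> s)) (coord y) (coord (\<gamma> s))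
       + cubic_polar (coord (\<gamma> s)) (coord (\<gamma> s)) (coord y)) / 6) (at s)"
    by (intro has_vector_derivative_divide cubic_polar_has_vector_derivative c)
  moreover have "cubic_polar (coord y) (coord (\<gamma> s)) (coord (\<gamma> s)) = cubic_polar (coord (\<gamma> s)) (coord (\<gamma> s)) (coord y)"
    "cubic_polar (coord (\<gamma> s)) (coord y) (coord (\<gamma> s)) = cubic_polar (coord (\<gamma> s)) (coord (\<gamma> s)) (coord y)"
    by (metis cubic_polar_sym12 cubic_polar_sym23)+
  ultimately show ?thesis unfolding eq by simp
qed

text \<open>A curve through the identity in the group is differentiated for one direction.  Conversely
\<open>cubic_polar y y (X y) = 0\<close> is the vanishing of the derivative of the determinant along the
one-parameter group generated by \<open>X\<close>.\<close>

theorem sl3O_iff: "X \<in> sl3O \<longleftrightarrow> (\<forall>x. cubic_polar (coord x) (coord x) (coord (blinfun_apply X x)) = 0)"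
proof
  assume "X \<in> sl3O"
  then obtain \<gamma> where g: "\<And>t. \<gamma> t \<in> SL3O" "\<gamma> 0 = id_blinfun" "(\<gamma> has_vector_derivative X) (at 0)"
    unfolding sl3O_def by blast
  show "\<forall>x. cubic_polar (coord x) (coord x) (coord (blinfun_apply X x)) = 0"
  proof
    fix x
    have "((\<lambda>t. blinfun_apply (\<gamma> t) x) has_vector_derivative blinfun_apply X x) (at 0)"
      by (rule bounded_linear.has_vector_derivative[OF blinfun.bounded_linear_left g(3)])
    note d = cubic_polar_det_derivative[OF this]
    have "((\<lambda>t. complex_of_real (herm_det x)) has_vector_derivative cubic_polar (coord x) (coord x) (coord (blinfun_apply X x)) / 2) (at 0)"
    proof -
      have "herm_det (blinfun_apply (\<gamma> t) x) = herm_det x" for t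
        using g(1)[of t] unfolding SL3O_def by blast
      then show ?thesis using d by (simp add: g(2))
    qed
    then have "cubic_polar (coord x) (coord x) (coord (blinfun_apply X x)) / 2 = 0"
      using has_vector_derivative_const by (rule vector_derivative_unique_at)
    then show "cubic_polar (coord x) (coord x) (coord (blinfun_apply X x)) = 0" by simp
  qed
next
  assume X: "\<forall>x. cubic_polar (coord x) (coord x) (coord (blinfun_apply X x)) = 0"
  obtain \<gamma> where g: "\<gamma> 0 = id_blinfun" "\<And>t. (\<gamma> has_vector_derivative X o\<^sub>L \<gamma> t) (at t)"
    using one_parameter_group[of X] by blast
  have "\<gamma> t \<in> SL3O" for t
    unfolding SL3O_def
  proof (intro CollectI allI)
    fix x
    have d: "((\<lambda>t. complex_of_real (herm_det (blinfun_apply (\<gamma> t) x))) has_vector_derivative 0) (at t)" for t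
    proof -
      have "((\<lambda>t. blinfun_apply (\<gamma> t) x) has_vector_derivative blinfun_apply (X o\<^sub>L \<gamma> t) x) (at t)"
        by (rule bounded_linear.has_vector_derivative[OF blinfun.bounded_linear_left g(2)])
      from cubic_polar_det_derivative[OF this] show ?thesis using X by simp
    qed
    obtain c where "\<And>t. complex_of_real (herm_det (blinfun_apply (\<gamma> t) x)) = c"
      using has_vector_derivative_zero_constant[of UNIV "\<lambda>t. complex_of_real (herm_det (blinfun_apply (\<gamma> t) x))"] d
      by auto
    then have "complex_of_real (herm_det (blinfun_apply (\<gamma> t) x)) = complex_of_real (herm_det (blinfun_apply (\<gamma> 0) x))"
      by metis
    then show "herm_det (blinfun_apply (\<gamma> t) x) = herm_det x" by (simp add: g(1))
  qed
  moreover have "X o\<^sub>L id_blinfun = X" by (rule blinfun_eqI) simp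
  then have "(\<gamma> has_vector_derivative X) (at 0)" using g(2)[of 0] by (simp add: g(1))
  ultimately show "X \<in> sl3O" unfolding sl3O_def using g(1) by blast
qed

text \<open>Being a derivative of the real determinant, the pairing is real; here it is expressed by
three values of the determinant.\<close>

lemma cubic_polar_coord_real: "cubic_polar (coord x) (coord x) (coord y) \<in> \<real>"
proof -
  have "cubic_polar (coord x) (coord x) (coord y) =
     ((6 * of_real (herm_det (x + 1 *\<^sub>R y)) - 6 * of_real (herm_det (x + (-1) *\<^sub>R y))) / 2 - 6 * of_real (herm_det y)) / 3"
    unfolding herm_det_cubic_polar coord_linear cubic_polar_add_scaled
    using cubic_polar_sym12[of "coord x" "coord y"] cubic_polar_sym23[of _ "coord x" "coord y"]
    by (simp add: algebra_simps)
  also have "\<dots> \<in> \<real>" by simp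
  finally show ?thesis .
qed

definition complex_act :: "(herm3 \<Rightarrow>\<^sub>L herm3) \<times> (herm3 \<Rightarrow>\<^sub>L herm3) \<Rightarrow> herm3 \<times> herm3 \<Rightarrow> herm3 \<times> herm3" where
  "complex_act w v = (blinfun_apply (fst w) (fst v) - blinfun_apply (snd w) (snd v),
              blinfun_apply (fst w) (snd v) + blinfun_apply (snd w) (fst v))"

text \<open>The complex-linear operator on triples that represents the element \<open>X + \<i> Y\<close> of the complexification.\<close>

definition complex_op :: "(herm3 \<Rightarrow>\<^sub>L herm3) \<times> (herm3 \<Rightarrow>\<^sub>L herm3) \<Rightarrow> triple \<Rightarrow> triple" where
  "complex_op w M = complex_coord (complex_act w (coord_inv M))"

lemma complex_coord_add_scaled: "complex_coord (v + cscale c w) = add_scaled (complex_coord v) c (complex_coord w)"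
proof (intro ext)
  fix t i j
  interpret bl: bounded_linear "\<lambda>x. coord x t i j" by (rule coord_bounded_linear)
  show "complex_coord (v + cscale c w) t i j = add_scaled (complex_coord v) c (complex_coord w) t i j"
    by (simp add: complex_coord_def add_scaled_def cscale_def bl.add bl.diff bl.scaleR complex_eq_iff algebra_simps)
qed

lemma coord_inv_add_scaled: "coord_inv (add_scaled u c v) = coord_inv u + cscale c (coord_inv v)"
  by (metis complex_coord_add_scaled complex_coord_coord_inv coord_inv_complex_coord)

lemma complex_op_add_scaled: "complex_op w (add_scaled u c v) = add_scaled (complex_op w u) c (complex_op w v)"
proof -
  have "complex_act w (x + cscale c y) = complex_act w x + cscale c (complex_act w y)" for x y
    by (simp add: complex_act_def cscale_def blinfun.bilinear_simps algebra_simps)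
  then show ?thesis by (simp add: complex_op_def coord_inv_add_scaled complex_coord_add_scaled)
qed

lemma complex_op_add: "complex_op (w + cscale c w') M = add_scaled (complex_op w M) c (complex_op w' M)"
proof -
  have "complex_act (w + cscale c w') x = complex_act w x + cscale c (complex_act w' x)" for x
    by (simp add: complex_act_def cscale_def blinfun.bilinear_simps algebra_simps)
  then show ?thesis by (simp add: complex_op_def complex_coord_add_scaled)
qed

lemma complex_op_zero: "complex_op 0 M = (\<lambda>_ _ _. 0)"
proof -
  have "complex_op (0 + cscale (-1) 0) M = add_scaled (complex_op 0 M) (-1) (complex_op 0 M)" by (rule complex_op_add)
  then show ?thesis by (simp add: add_scaled_def cscale_def zero_prod_def[symmetric])
qed

lemma complex_op_bracket: "complex_op (cbracket commutator w w') M = add_scaled (complex_op w (complex_op w' M)) (-1) (complex_op w' (complex_op w M))"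
proof -
  have "complex_act (cbracket commutator w w') x = complex_act w (complex_act w' x) + cscale (-1) (complex_act w' (complex_act w x))" for x
    by (simp add: complex_act_def cscale_def cbracket_def commutator_def blinfun.bilinear_simps algebra_simps)
  then show ?thesis by (simp only: complex_op_def coord_inv_complex_coord complex_coord_add_scaled)
qed

lemma complex_op_inject: "complex_op w = complex_op w' \<longleftrightarrow> w = w'"
proof
  assume eq: "complex_op w = complex_op w'"
  have "complex_act w x = complex_act w' x" for x
    using fun_cong[OF eq, of "complex_coord x"] unfolding complex_op_def coord_inv_complex_coord by (metis coord_inv_complex_coord)
  from this[of "(_, 0)"] show "w = w'"
    by (auto simp: complex_act_def prod_eq_iff intro!: blinfun_eqI)
qed simp

text \<open>The inverse of \<open>complex_op\<close>, by restriction to the real form.\<close>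

definition of_complex_op :: "(triple \<Rightarrow> triple) \<Rightarrow> (herm3 \<Rightarrow>\<^sub>L herm3) \<times> (herm3 \<Rightarrow>\<^sub>L herm3)" where
  "of_complex_op D = (Blinfun (\<lambda>x. fst (coord_inv (D (coord x)))), Blinfun (\<lambda>x. snd (coord_inv (D (coord x)))))"

lemma complex_op_of_complex_op:
  assumes "clinear D"
  shows "complex_op (of_complex_op D) = D"
proof -
  have D: "D (add_scaled u c v) = add_scaled (D u) c (D v)" for u c v
    using assms by (simp add: clinear_def)
  have lin: "coord_inv (D (coord (x + r *\<^sub>R y))) = coord_inv (D (coord x)) + r *\<^sub>R coord_inv (D (coord y))" for x y r
    unfolding coord_linear D coord_inv_add_scaled by (simp add: cscale_def prod_eq_iff)
  have lin2: "linear (\<lambda>x. coord_inv (D (coord x)))"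
  proof (rule linearI)
    show *: "coord_inv (D (coord (x + y))) = coord_inv (D (coord x)) + coord_inv (D (coord y))" for x y
      using lin[of x 1 y] by simp
    have "coord_inv (D (coord 0)) = 0" using *[of 0 0] by simp
    then show "coord_inv (D (coord (r *\<^sub>R x))) = r *\<^sub>R coord_inv (D (coord x))" for r x
      using lin[of 0 r x] by simp
  qed
  have bl: "bounded_linear (\<lambda>x. coord_inv (D (coord x)))"
    using lin2 by (simp add: linear_conv_bounded_linear)
  have f: "blinfun_apply (fst (of_complex_op D)) x = fst (coord_inv (D (coord x)))"
    "blinfun_apply (snd (of_complex_op D)) x = snd (coord_inv (D (coord x)))" for x
    unfolding of_complex_op_def using bl
    by (simp_all add: bounded_linear_Blinfun_apply bounded_linear_fst_comp bounded_linear_snd_comp)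
  show ?thesis
  proof
    fix M
    obtain x y where xy: "coord_inv M = (x, y)" by (cases "coord_inv M")
    have M: "M = add_scaled (coord x) \<i> (coord y)"
      using complex_coord_coord_inv[of M] by (simp add: xy complex_coord_def)
    have "complex_act (of_complex_op D) (x, y) = coord_inv (D (coord x)) + cscale \<i> (coord_inv (D (coord y)))"
      by (simp add: complex_act_def f cscale_def prod_eq_iff)
    also have "\<dots> = coord_inv (D M)" unfolding M D coord_inv_add_scaled ..
    finally show "complex_op (of_complex_op D) M = D M" by (simp add: complex_op_def xy complex_coord_coord_inv)
  qed
qed

text \<open>A cubic polynomial that vanishes on the real form vanishes everywhere: on \<open>x + s y\<close> it is a cubic
polynomial in \<open>s\<close>, which may be evaluated at \<open>s = \<i>\<close> once its coefficients are known to be zero.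
On the real form the conditions for \<open>X\<close> and \<open>Y\<close> separate by \<open>cubic_polar_coord_real\<close>.\<close>

theorem complexified_sl3O_iff: "w \<in> complexification sl3O \<longleftrightarrow> derivation (complex_op w)"
proof -
  have uc: "coord_inv (coord x) = (x, 0)" for x
  proof -
    have "coord 0 = (\<lambda>_ _ _. 0)"
      using coord_linear[of 0 1 0] by (simp add: add_scaled_def fun_eq_iff)
    then have "complex_coord (x, 0) = coord x" by (simp add: complex_coord_def add_scaled_def)
    then show ?thesis by (metis coord_inv_complex_coord)
  qed
  have copc: "complex_op w (coord x) = add_scaled (coord (blinfun_apply (fst w) x)) \<i> (coord (blinfun_apply (snd w) x))" for x
    by (simp add: complex_op_def uc complex_act_def complex_coord_def)
  have P: "cubic_polar (coord x) (coord x) (complex_op w (coord x)) = 0 \<longleftrightarrow>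
     cubic_polar (coord x) (coord x) (coord (blinfun_apply (fst w) x)) = 0 \<and>
     cubic_polar (coord x) (coord x) (coord (blinfun_apply (snd w) x)) = 0" for x
    unfolding copc cubic_polar_add_scaled
    using cubic_polar_coord_real[of x "blinfun_apply (fst w) x"] cubic_polar_coord_real[of x "blinfun_apply (snd w) x"]
    by (auto elim!: Reals_cases simp: complex_eq_iff)
  \<comment> \<open>The middle coefficients \<open>b\<close> and \<open>c\<close> vanish because the values at \<open>1\<close> and \<open>-1\<close> do.\<close>
  have Q: "cubic_polar u u (complex_op w u) = 0" if *: "\<And>x. cubic_polar (coord x) (coord x) (complex_op w (coord x)) = 0" for u
  proof -
    obtain x y where xy: "coord_inv u = (x, y)" by (cases "coord_inv u")
    have u: "u = add_scaled (coord x) \<i> (coord y)"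
      using complex_coord_coord_inv[of u] by (simp add: xy complex_coord_def)
    define a b c d where "a = cubic_polar (coord x) (coord x) (complex_op w (coord x))"
      and "b = 2 * cubic_polar (coord x) (coord y) (complex_op w (coord x)) + cubic_polar (coord x) (coord x) (complex_op w (coord y))"
      and "c = 2 * cubic_polar (coord x) (coord y) (complex_op w (coord y)) + cubic_polar (coord y) (coord y) (complex_op w (coord x))"
      and "d = cubic_polar (coord y) (coord y) (complex_op w (coord y))"
    have ex: "cubic_polar (add_scaled (coord x) s (coord y)) (add_scaled (coord x) s (coord y)) (complex_op w (add_scaled (coord x) s (coord y)))
      = a + s * b + s^2 * c + s^3 * d" for s
      by (simp add: complex_op_add_scaled cubic_polar_add_scaled a_def b_def c_def d_def cubic_polar_sym12[of "coord y" "coord x"]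
         power2_eq_square power3_eq_cube algebra_simps)
    have zero: "a + of_real r * b + of_real r ^2 * c + of_real r ^ 3 * d = 0" for r
      unfolding ex[symmetric] coord_linear[symmetric] by (rule *)
    have ad: "a = 0" "d = 0" using * by (simp_all add: a_def d_def)
    have "b = 0" "c = 0" using zero[of 1] zero[of "-1"] ad by (simp_all add: eq_neg_iff_add_eq_0)
    then show ?thesis unfolding u ex using ad by simp
  qed
  show ?thesis
    unfolding derivation_def clinear_def complexification_def
    using P Q complex_op_add_scaled by (auto simp: sl3O_iff mem_Times_iff)
qed

abbreviation zero_triple :: triple where "zero_triple \<equiv> \<lambda>_ _ _. 0"

definition traceless :: "(3 \<Rightarrow> 3 \<Rightarrow> complex) \<Rightarrow> bool" where
  "traceless x \<longleftrightarrow> (\<forall>t. (\<Sum>i\<in>UNIV. x t i) = 0)"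

lemma complex_op_eqI: "(\<And>M. complex_op w M = complex_op w' M) \<Longrightarrow> w = w'"
  by (subst complex_op_inject[symmetric]) (rule ext)

lemma complex_op_plus: "complex_op (w + w') M = add_scaled (complex_op w M) 1 (complex_op w' M)"
  using complex_op_add[of w 1 w' M] by (simp add: cscale_def)

lemma complex_op_cscale: "complex_op (cscale c w) M = add_scaled zero_triple c (complex_op w M)"
  using complex_op_add[of 0 c w M] by (simp add: complex_op_zero)

lemma clinear_complex_op: "clinear (complex_op w)"
  by (simp add: clinear_def complex_op_add_scaled)

text \<open>By the polarised identity for \<open>u, u, D' u\<close> the two compositions give the same value, as the trilinear
form is symmetric.\<close>

lemma derivation_commutator:
  assumes D: "derivation D" and D': "derivation D'"
  shows "cubic_polar u u (add_scaled (D (D' u)) (-1) (D' (D u))) = 0"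
proof -
  have "cubic_polar u u (D (D' u)) = - 2 * cubic_polar u (D' u) (D u)"
    using derivation_cubic_polar[OF D, of u u "D' u", unfolded cubic_polar_sym12[of "D' u" u]] by algebra
  moreover have "cubic_polar u u (D' (D u)) = - 2 * cubic_polar u (D u) (D' u)"
    using derivation_cubic_polar[OF D', of u u "D u", unfolded cubic_polar_sym12[of "D u" u]] by algebra
  ultimately show ?thesis by (simp add: cubic_polar_add_scaled cubic_polar_sym23[of u "D u"])
qed

lemma lie_algebra_sl3O: "lie_algebra cscale (cbracket commutator) (complexification sl3O)"
proof
  have z: "cubic_polar u u zero_triple = 0" for u by (simp add: cubic_polar_def)
  show "cplx.subspace (complexification sl3O)"
    unfolding cplx.subspace_def
    by (auto simp: complexified_sl3O_iff derivation_def clinear_complex_op complex_op_zero complex_op_plus complex_op_cscale cubic_polar_add_scaled z)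
  note simps = complex_op_bracket complex_op_plus complex_op_cscale complex_op_zero complex_op_add_scaled
  fix x y z c
  show "cbracket commutator x y \<in> complexification sl3O"
    if "x \<in> complexification sl3O" "y \<in> complexification sl3O"
    using that derivation_commutator[of "complex_op x" "complex_op y"]
    unfolding complexified_sl3O_iff derivation_def[of "complex_op (cbracket commutator x y)"]
    by (simp add: clinear_complex_op complex_op_bracket)
  show "cbracket commutator (x + y) z = cbracket commutator x z + cbracket commutator y z"
    by (rule complex_op_eqI) (simp add: simps, simp add: add_scaled_def algebra_simps)
  show "cbracket commutator x (y + z) = cbracket commutator x y + cbracket commutator x z"
    by (rule complex_op_eqI) (simp add: simps, simp add: add_scaled_def algebra_simps)
  have cz: "complex_op w zero_triple = zero_triple" for w
    using complex_op_add_scaled[of w zero_triple "-1" zero_triple] by (simp add: add_scaled_def)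
  show "cbracket commutator (cscale c x) y = cscale c (cbracket commutator x y)"
    by (rule complex_op_eqI) (simp add: simps cz, simp add: add_scaled_def algebra_simps)
  show "cbracket commutator x (cscale c y) = cscale c (cbracket commutator x y)"
    by (rule complex_op_eqI) (simp add: simps cz, simp add: add_scaled_def algebra_simps)
  show "cbracket commutator x x = 0"
    by (rule complex_op_eqI) (simp add: simps, simp add: add_scaled_def algebra_simps)
  show "cbracket commutator x (cbracket commutator y z) + cbracket commutator y (cbracket commutator z x) +
      cbracket commutator z (cbracket commutator x y) = 0"
    by (rule complex_op_eqI) (simp add: simps, simp add: add_scaled_def algebra_simps)
qed

section \<open>The six one-parameter families\<close>

definition diag_op :: "(3 \<Rightarrow> 3 \<Rightarrow> complex) \<Rightarrow> triple \<Rightarrow> triple" where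
  "diag_op x M = (\<lambda>t i j. (x t i - x (t+1) j) * M t i j)"

lemma clinear_diag_op: "clinear (diag_op x)"
  by (simp add: clinear_def diag_op_def add_scaled_def algebra_simps)

lemma of_complex_op_apply:
  assumes "clinear D"
  shows "blinfun_apply (fst (of_complex_op D)) x = coord_part Re (D (coord x))"
    and "blinfun_apply (snd (of_complex_op D)) x = coord_part Im (D (coord x))"
proof -
  have "complex_coord (complex_act (of_complex_op D) (x, 0)) = D (coord x)"
  proof -
    have "coord 0 = (\<lambda>_ _ _. 0)"
      using coord_linear[of 0 1 0] by (simp add: add_scaled_def fun_eq_iff)
    then have "complex_coord (x, 0) = coord x" by (simp add: complex_coord_def add_scaled_def)
    moreover have "complex_op (of_complex_op D) (complex_coord (x, 0)) = complex_coord (complex_act (of_complex_op D) (x, 0))"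
      by (simp add: complex_op_def coord_inv_complex_coord)
    ultimately show ?thesis by (simp add: complex_op_of_complex_op[OF assms])
  qed
  then have "complex_act (of_complex_op D) (x, 0) = coord_inv (D (coord x))" by (metis coord_inv_complex_coord)
  then show "blinfun_apply (fst (of_complex_op D)) x = coord_part Re (D (coord x))"
    and "blinfun_apply (snd (of_complex_op D)) x = coord_part Im (D (coord x))"
    by (simp_all add: complex_act_def coord_inv_def)
qed

text \<open>In finite dimension, convergence of operators in norm may be tested on a basis.\<close>

lemma has_vector_derivative_blinfunI:
  fixes f :: "real \<Rightarrow> ('a::euclidean_space \<Rightarrow>\<^sub>L 'b::real_normed_vector)"
  assumes "\<And>x. ((\<lambda>s. blinfun_apply (f s) x) has_vector_derivative blinfun_apply f' x) (at s)"
  shows "(f has_vector_derivative f') (at s)"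
  unfolding has_vector_derivative_def has_derivative_within
proof (intro conjI tendsto_componentwise1)
  show "bounded_linear (\<lambda>r. r *\<^sub>R f')" by (rule bounded_linear_scaleR_left)
  fix j :: 'a
  show "((\<lambda>r. blinfun_apply ((1 / norm (r - s)) *\<^sub>R (f r - (f s + (r - s) *\<^sub>R f'))) j) \<longlongrightarrow> blinfun_apply 0 j) (at s)"
    using assms[of j] by (simp add: has_vector_derivative_def has_derivative_within blinfun.bilinear_simps)
qed

lemma bounded_bilinear_octmult: "bounded_bilinear (\<odot>)"
  unfolding bilinear_conv_bounded_bilinear[symmetric] bilinear_def
  using linear_octmult_left linear_octmult_right by blast

lemma bounded_linear_oct_cnj: "bounded_linear oct_cnj"
  unfolding linear_conv_bounded_linear[symmetric] by (rule linearI) simp_all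

lemma bounded_linear_oct_Re: "bounded_linear oct_Re"
  unfolding linear_conv_bounded_linear[symmetric] by (rule linearI) (simp_all add: oct_Re_def)

lemma oct_of_real_1: "oct_of_real 1 \<odot> x = x" "x \<odot> oct_of_real 1 = x" "oct_cnj (oct_of_real r) = oct_of_real r"
  "0 \<odot> x = 0" "x \<odot> 0 = 0"
  by (simp_all add: oct_eq_iff octmult_nth oct_cnj_def oct_of_real_def octunit_vec_def axis_def)

lemma conj_block1:
  "blinfun_apply (conj_action (block1 (diag2 v w))) (p,m,n,a,b,c) =
    (oct_Re ((v \<odot> oct_of_real p) \<odot> oct_cnj v), oct_Re ((w \<odot> oct_of_real m) \<odot> oct_cnj w), n,
     (w \<odot> a) \<odot> oct_cnj v, b \<odot> oct_cnj w, v \<odot> c)"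
  by (simp add: conj_action.rep_eq herm_coords_def omat_mult_def omat_dagger_def block1_def diag2_def sum_3 oct_of_real_1 del: oct_one_mult)

lemma conj_block2:
  "blinfun_apply (conj_action (block2 (diag2 v w))) (p,m,n,a,b,c) =
    (p, oct_Re ((v \<odot> oct_of_real m) \<odot> oct_cnj v), oct_Re ((w \<odot> oct_of_real n) \<odot> oct_cnj w),
     v \<odot> a, (w \<odot> b) \<odot> oct_cnj v, c \<odot> oct_cnj w)"
  by (simp add: conj_action.rep_eq herm_coords_def omat_mult_def omat_dagger_def block2_def diag2_def sum_3 oct_of_real_1 del: oct_one_mult)

context
  fixes v w :: "real \<Rightarrow> oct" and v' w' :: oct and s :: real
  assumes v: "(v has_vector_derivative v') (at s)" and w: "(w has_vector_derivative w') (at s)"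
begin

lemma conj_block1_derivative:
  "((\<lambda>s. blinfun_apply (conj_action (block1 (diag2 (v s) (w s)))) (p,m,n,a,b,c)) has_vector_derivative
    (oct_Re ((v s \<odot> oct_of_real p) \<odot> oct_cnj v' + (v' \<odot> oct_of_real p) \<odot> oct_cnj (v s)),
     oct_Re ((w s \<odot> oct_of_real m) \<odot> oct_cnj w' + (w' \<odot> oct_of_real m) \<odot> oct_cnj (w s)), 0,
     (w s \<odot> a) \<odot> oct_cnj v' + (w' \<odot> a) \<odot> oct_cnj (v s), b \<odot> oct_cnj w', v' \<odot> c)) (at s)"
proof -
  note mult = bounded_bilinear.has_vector_derivative[OF bounded_bilinear_octmult]
  have cnjd: "((\<lambda>s. oct_cnj (f s)) has_vector_derivative oct_cnj f') (at s)"
    if "(f has_vector_derivative f') (at s)" for f f'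
    using bounded_linear.has_vector_derivative[OF bounded_linear_oct_cnj that] .
  have multc: "((\<lambda>s. f s \<odot> x) has_vector_derivative f' \<odot> x) (at s)"  "((\<lambda>s. x \<odot> f s) has_vector_derivative x \<odot> f') (at s)"
    if "(f has_vector_derivative f') (at s)" for f f' x
    using mult[OF that has_vector_derivative_const[of x]] mult[OF has_vector_derivative_const[of x] that]
    by (simp_all add: oct_of_real_1)
  show ?thesis unfolding conj_block1
    by (intro has_vector_derivative_Pair bounded_linear.has_vector_derivative[OF bounded_linear_oct_Re]
        has_vector_derivative_const mult cnjd multc v w)
qed

lemma conj_block2_derivative:
  "((\<lambda>s. blinfun_apply (conj_action (block2 (diag2 (v s) (w s)))) (p,m,n,a,b,c)) has_vector_derivative
    (0, oct_Re ((v s \<odot> oct_of_real m) \<odot> oct_cnj v' + (v' \<odot> oct_of_real m) \<odot> oct_cnj (v s)),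
     oct_Re ((w s \<odot> oct_of_real n) \<odot> oct_cnj w' + (w' \<odot> oct_of_real n) \<odot> oct_cnj (w s)),
     v' \<odot> a, (w s \<odot> b) \<odot> oct_cnj v' + (w' \<odot> b) \<odot> oct_cnj (v s), c \<odot> oct_cnj w')) (at s)"
proof -
  note mult = bounded_bilinear.has_vector_derivative[OF bounded_bilinear_octmult]
  have cnjd: "((\<lambda>s. oct_cnj (f s)) has_vector_derivative oct_cnj f') (at s)"
    if "(f has_vector_derivative f') (at s)" for f f'
    using bounded_linear.has_vector_derivative[OF bounded_linear_oct_cnj that] .
  have multc: "((\<lambda>s. f s \<odot> x) has_vector_derivative f' \<odot> x) (at s)"  "((\<lambda>s. x \<odot> f s) has_vector_derivative x \<odot> f') (at s)"
    if "(f has_vector_derivative f') (at s)" for f f' x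
    using mult[OF that has_vector_derivative_const[of x]] mult[OF has_vector_derivative_const[of x] that]
    by (simp_all add: oct_of_real_1)
  show ?thesis unfolding conj_block2
    by (intro has_vector_derivative_Pair bounded_linear.has_vector_derivative[OF bounded_linear_oct_Re]
        has_vector_derivative_const mult cnjd multc v w)
qed

end

definition oct_of_complex :: "complex \<Rightarrow> oct" where
  "oct_of_complex z = Re z *\<^sub>R octunit_vec One + Im z *\<^sub>R octunit_vec L"

lemma bounded_linear_oct_of_complex: "bounded_linear oct_of_complex"
  unfolding linear_conv_bounded_linear[symmetric]
  by (rule linearI) (simp_all add: oct_of_complex_def algebra_simps)

lemma oct_of_complex_mult: "oct_of_complex z \<odot> oct_of_complex w = oct_of_complex (z * w)"
  by (simp add: oct_eq_iff octmult_nth oct_of_complex_def octunit_vec_def axis_def)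

text \<open>The exponential series of an element of \<open>span {1, L}\<close> may be computed in the complex numbers.\<close>

lemma oct_exp_of_complex: "oct_exp (oct_of_complex z) = oct_of_complex (exp z)"
proof -
  have p: "oct_power (oct_of_complex z) n = oct_of_complex (z ^ n)" for n
  proof (induction n)
    case 0
    then show ?case by (simp add: oct_of_complex_def oct_of_real_def)
  next
    case (Suc n)
    then show ?case by (simp add: oct_of_complex_mult)
  qed
  have "oct_of_complex (exp z) = oct_of_complex (\<Sum>n. z ^ n /\<^sub>R fact n)"
    by (simp add: exp_def)
  also have "\<dots> = (\<Sum>n. oct_of_complex (z ^ n /\<^sub>R fact n))"
    by (rule bounded_linear.suminf[OF bounded_linear_oct_of_complex]) (rule summable_exp_generic)
  also have "\<dots> = oct_exp (oct_of_complex z)"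
    unfolding oct_exp_def p
    by (simp add: linear_scale[OF bounded_linear.linear[OF bounded_linear_oct_of_complex]])
  finally show ?thesis ..
qed

definition row3 :: "'a \<Rightarrow> 'a \<Rightarrow> 'a \<Rightarrow> 3 \<Rightarrow> 'a" where
  "row3 a b c i = (if i = 1 then a else if i = 2 then b else c)"

lemma row3_simps [simp]: "row3 a b c 1 = a" "row3 a b c 2 = b" "row3 a b c 3 = c"
  by (simp_all add: row3_def)

text \<open>The parameters of the diagonal operators that the generators turn out to be; \<open>xR\<close> is that of a single
plane rotation \<open>R1\<close>, where the third row
singles out one of the planes \<open>(I, IL)\<close>, \<open>(J, JL)\<close>, \<open>(K, KL)\<close>.\<close>

abbreviation xB1 :: "3 \<Rightarrow> 3 \<Rightarrow> complex" where "xB1 \<equiv> row3 (row3 (1/2) (-1/2) 0) (row3 (-1/2) (1/2) 0) (row3 0 0 0)"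
abbreviation xB2 :: "3 \<Rightarrow> 3 \<Rightarrow> complex" where "xB2 \<equiv> row3 (row3 0 (1/2) (-1/2)) (row3 0 (-1/2) (1/2)) (row3 0 0 0)"
abbreviation xRx :: "3 \<Rightarrow> 3 \<Rightarrow> complex" where "xRx \<equiv> row3 (row3 (\<i>/2) (-\<i>/2) 0) (row3 (\<i>/2) (-\<i>/2) 0) (row3 0 0 0)"
abbreviation xR :: "complex \<Rightarrow> complex \<Rightarrow> complex \<Rightarrow> 3 \<Rightarrow> 3 \<Rightarrow> complex" where
  "xR a b c \<equiv> row3 (row3 (\<i>/6) (\<i>/6) (-\<i>/3)) (row3 (\<i>/6) (\<i>/6) (-\<i>/3)) (row3 (\<i>*a) (\<i>*b) (\<i>*c))"

definition diag_elem :: "(3 \<Rightarrow> 3 \<Rightarrow> complex) \<Rightarrow> herm3 \<Rightarrow>\<^sub>L herm3" where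
  "diag_elem x = fst (of_complex_op (diag_op x))"

lemmas explicit_simps = diag_elem_def of_complex_op_apply[OF clinear_diag_op] coord_part_def off_diag_part_def diag_op_def coord_def off_diag_def colour_def colourL_def
  oct_eq_iff octmult_nth oct_cnj_def oct_of_real_def octunit_vec_def axis_def oct_Re_def

lemma B1tz_derivative: "(B1tz has_vector_derivative diag_elem xB1) (at 0)"
proof (rule has_vector_derivative_blinfunI)
  fix x :: herm3
  obtain p m n a b c where x: "x = (p,m,n,a,b,c)" by (metis surj_pair)
  have v: "((\<lambda>\<alpha>. oct_of_real (exp (\<alpha> / 2))) has_vector_derivative oct_of_real (1/2)) (at 0)"
      "((\<lambda>\<alpha>. oct_of_real (exp (- \<alpha> / 2))) has_vector_derivative oct_of_real (-1/2)) (at 0)"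
    unfolding oct_of_real_def by (auto intro!: derivative_eq_intros)
  show "((\<lambda>s. blinfun_apply (B1tz s) x) has_vector_derivative blinfun_apply (diag_elem xB1) x) (at 0)"
    unfolding B1tz_def Btz_mat_def x
    by (rule has_vector_derivative_eq_rhs[OF conj_block1_derivative[OF v]]) (simp add: explicit_simps field_simps)
qed

lemma B2tz_derivative: "(B2tz has_vector_derivative diag_elem xB2) (at 0)"
proof (rule has_vector_derivative_blinfunI)
  fix x :: herm3
  obtain p m n a b c where x: "x = (p,m,n,a,b,c)" by (metis surj_pair)
  have v: "((\<lambda>\<alpha>. oct_of_real (exp (\<alpha> / 2))) has_vector_derivative oct_of_real (1/2)) (at 0)"
      "((\<lambda>\<alpha>. oct_of_real (exp (- \<alpha> / 2))) has_vector_derivative oct_of_real (-1/2)) (at 0)"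
    unfolding oct_of_real_def by (auto intro!: derivative_eq_intros)
  show "((\<lambda>s. blinfun_apply (B2tz s) x) has_vector_derivative blinfun_apply (diag_elem xB2) x) (at 0)"
    unfolding B2tz_def Btz_mat_def x
    by (rule has_vector_derivative_eq_rhs[OF conj_block2_derivative[OF v]]) (simp add: explicit_simps field_simps)
qed

lemma R1xl_derivative: "(R1xl has_vector_derivative diag_elem xRx) (at 0)"
proof (rule has_vector_derivative_blinfunI)
  fix x :: herm3
  obtain p m n a b c where x: "x = (p,m,n,a,b,c)" by (metis surj_pair)
  have e: "oct_exp (r *\<^sub>R octunit_vec L) = cos r *\<^sub>R octunit_vec One + sin r *\<^sub>R octunit_vec L" for r
    using oct_exp_of_complex[of "\<i> * of_real r"] by (simp add: oct_of_complex_def exp_Euler cos_of_real sin_of_real)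
  have e0: "oct_exp 0 = octunit_vec One" using e[of 0] by simp
  have v: "((\<lambda>\<alpha>. oct_exp ((\<alpha> / 2) *\<^sub>R octunit_vec L)) has_vector_derivative (1/2) *\<^sub>R octunit_vec L) (at 0)"
      "((\<lambda>\<alpha>. oct_exp ((- \<alpha> / 2) *\<^sub>R octunit_vec L)) has_vector_derivative (-1/2) *\<^sub>R octunit_vec L) (at 0)"
    unfolding e by (auto intro!: derivative_eq_intros)
  show "((\<lambda>s. blinfun_apply (R1xl s) x) has_vector_derivative blinfun_apply (diag_elem xRx) x) (at 0)"
    unfolding R1xl_def x
    by (rule has_vector_derivative_eq_rhs[OF conj_block1_derivative[OF v]]) (simp add: e0 explicit_simps field_simps)
qed

text \<open>The derivative of \<open>R1 p q\<close> at \<open>0\<close>, with the inner factor, which does not depend on the angle,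
evaluated first.\<close>

lemma R1_has_derivative:
  assumes x: "\<And>p' m n a b c.
    (let u = - octunit_vec p; v = octunit_vec p; v' = (1/2) *\<^sub>R octunit_vec q;
       P = oct_Re ((u \<odot> oct_of_real p') \<odot> oct_cnj u); M = oct_Re ((u \<odot> oct_of_real m) \<odot> oct_cnj u);
       a' = (u \<odot> a) \<odot> oct_cnj u; b' = b \<odot> oct_cnj u; c' = u \<odot> c in
    (oct_Re ((v \<odot> oct_of_real P) \<odot> oct_cnj v' + (v' \<odot> oct_of_real P) \<odot> oct_cnj v),
     oct_Re ((v \<odot> oct_of_real M) \<odot> oct_cnj v' + (v' \<odot> oct_of_real M) \<odot> oct_cnj v), 0,
     (v \<odot> a') \<odot> oct_cnj v' + (v' \<odot> a') \<odot> oct_cnj v, b' \<odot> oct_cnj v', v' \<odot> c')) =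
     blinfun_apply X (p',m,n,a,b,c)"
  shows "(R1 p q has_vector_derivative X) (at 0)"
proof (rule has_vector_derivative_blinfunI)
  fix y :: herm3
  obtain p' m n a b c where y: "y = (p',m,n,a,b,c)" by (metis surj_pair)
  have v: "((\<lambda>\<alpha>. cos (\<alpha> / 2) *\<^sub>R octunit_vec p + sin (\<alpha> / 2) *\<^sub>R octunit_vec q) has_vector_derivative (1/2) *\<^sub>R octunit_vec q) (at 0)"
    by (auto intro!: derivative_eq_intros)
  show "((\<lambda>s. blinfun_apply (R1 p q s) y) has_vector_derivative blinfun_apply X y) (at 0)"
    unfolding R1_def Let_def y x[symmetric] blinfun_apply_blinfun_compose conj_block1[of "- octunit_vec p"]
    by (rule has_vector_derivative_eq_rhs[OF conj_block1_derivative[OF v v]]) simp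
qed

text \<open>The effect of conjugation with the unit \<open>p\<close>, by \<open>conj_unit\<close>.  Inserting this
closed form first keeps the products of octonions in \<open>R1_derivatives\<close> shallow.\<close>

definition flip :: "octunit \<Rightarrow> oct \<Rightarrow> oct" where
  "flip p a = (\<chi> u. if u = One \<or> u = p then a $ u else - a $ u)"

lemma octmult_minus: "(- x) \<odot> y = - (x \<odot> y)" "x \<odot> (- y) = - (x \<odot> y)" "oct_cnj (- x) = - oct_cnj x"
  by (simp_all add: oct_eq_iff octmult_nth oct_cnj_def)

lemma conj_unit:
  assumes "p \<noteq> One"
  shows "(octunit_vec p \<odot> a) \<odot> oct_cnj (octunit_vec p) = flip p a"
  using assms by (cases p) (simp_all add: flip_def oct_eq_iff octmult_nth oct_cnj_def octunit_vec_def axis_def)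

lemma oct_Re_flip: "oct_Re (flip p (oct_of_real r)) = r"
  by (simp add: flip_def oct_Re_def oct_of_real_def octunit_vec_def axis_def)

lemma flip_flip: "flip p (flip p a) = a"
  by (simp add: flip_def vec_eq_iff)

lemma unit_unit_mult:
  assumes "p \<noteq> One"
  shows "octunit_vec p \<odot> (octunit_vec p \<odot> c) = - c" "(b \<odot> octunit_vec p) \<odot> octunit_vec p = - b"
    "oct_cnj (octunit_vec p) = - octunit_vec p"
  using assms by (cases p; simp add: oct_eq_iff octmult_nth octunit_vec_def axis_def oct_cnj_def)+

lemma R1_zero:
  assumes "p \<noteq> One"
  shows "R1 p q 0 = id_blinfun"
proof (rule blinfun_eqI)
  fix y :: herm3
  obtain p' m n a b c where y: "y = (p',m,n,a,b,c)" by (metis surj_pair)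
  show "blinfun_apply (R1 p q 0) y = blinfun_apply id_blinfun y"
    by (simp add: R1_def Let_def y conj_block1 octmult_minus conj_unit[OF assms] oct_Re_flip flip_flip del: oct_one_mult)
      (simp add: unit_unit_mult[OF assms] octmult_minus)
qed

lemma R1_derivatives:
  "(R1 IL I has_vector_derivative diag_elem (xR (2/3) (-1/3) (-1/3))) (at 0)"
  "(R1 JL J has_vector_derivative diag_elem (xR (-1/3) (2/3) (-1/3))) (at 0)"
  "(R1 KL K has_vector_derivative diag_elem (xR (-1/3) (-1/3) (2/3))) (at 0)"
  by (rule R1_has_derivative; simp add: Let_def octmult_minus conj_unit oct_Re_flip del: oct_one_mult;
      simp add: explicit_simps del: mult_cancel_left; simp add: flip_def)+

lemma of_complex_op_diag_op_linear: "of_complex_op (diag_op (\<lambda>t i. x t i + c * y t i)) = of_complex_op (diag_op x) + cscale c (of_complex_op (diag_op y))"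
proof -
  have "complex_op (of_complex_op (diag_op (\<lambda>t i. x t i + c * y t i))) M = complex_op (of_complex_op (diag_op x) + cscale c (of_complex_op (diag_op y))) M" for M
    unfolding complex_op_add complex_op_of_complex_op[OF clinear_diag_op] by (simp add: diag_op_def add_scaled_def algebra_simps)
  then show ?thesis unfolding complex_op_inject[symmetric] by (rule ext)
qed

lemma diag_elem_linear: "diag_elem (\<lambda>t i. x t i + of_real r * y t i) = diag_elem x + r *\<^sub>R diag_elem y"
  by (simp add: diag_elem_def of_complex_op_diag_op_linear cscale_def)

abbreviation xA :: "3 \<Rightarrow> 3 \<Rightarrow> complex" where "xA \<equiv> row3 (row3 0 0 0) (row3 0 0 0) (row3 \<i> (-\<i>) 0)"
abbreviation xG :: "3 \<Rightarrow> 3 \<Rightarrow> complex" where "xG \<equiv> row3 (row3 0 0 0) (row3 0 0 0) (row3 \<i> \<i> (-2*\<i>))"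
abbreviation xS :: "3 \<Rightarrow> 3 \<Rightarrow> complex" where "xS \<equiv> row3 (row3 (\<i>/2) (\<i>/2) (-\<i>)) (row3 (\<i>/2) (\<i>/2) (-\<i>)) (row3 0 0 0)"

lemma blinfun_compose_id: "id_blinfun o\<^sub>L Z = Z" "Z o\<^sub>L id_blinfun = Z"
  by (intro blinfun_eqI, simp)+

lemma compose_derivative_at_id:
  fixes f g :: "real \<Rightarrow> 'a::real_normed_vector \<Rightarrow>\<^sub>L 'a"
  assumes "(f has_vector_derivative X) (at 0)" "(g has_vector_derivative probe) (at 0)"
    and "f 0 = id_blinfun" "g 0 = id_blinfun"
  shows "((\<lambda>s. f s o\<^sub>L g s) has_vector_derivative X + probe) (at 0)"
  using bounded_bilinear.has_vector_derivative[OF bounded_bilinear_blinfun_compose assms(1,2)]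
  by (simp add: assms(3,4) blinfun_compose_id add.commute)

lemma rescale_derivative:
  fixes f :: "real \<Rightarrow> 'a::real_normed_vector"
  assumes "(f has_vector_derivative X) (at 0)"
  shows "((\<lambda>s. f (r * s)) has_vector_derivative r *\<^sub>R X) (at 0)"
proof -
  have "((\<lambda>s. r * s) has_vector_derivative r) (at 0)"
    by (auto intro!: derivative_eq_intros)
  from vector_diff_chain_at[OF this] assms show ?thesis by (simp add: o_def)
qed

lemma A_l_derivative: "(A_l has_vector_derivative diag_elem xA) (at 0)"
proof -
  have "((\<lambda>\<alpha>. R1 IL I \<alpha> o\<^sub>L R1 JL J ((-1) * \<alpha>)) has_vector_derivative diag_elem (xR (2/3) (-1/3) (-1/3)) + (-1) *\<^sub>R diag_elem (xR (-1/3) (2/3) (-1/3))) (at 0)"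
    by (rule compose_derivative_at_id[OF R1_derivatives(1) rescale_derivative[OF R1_derivatives(2)]])
      (simp_all add: R1_zero)
  moreover have "xA = (\<lambda>t i. xR (2/3) (-1/3) (-1/3) t i + of_real (-1) * xR (-1/3) (2/3) (-1/3) t i)"
    by (simp add: fun_eq_iff forall_3 algebra_simps)
  ultimately show ?thesis
    unfolding diag_elem_linear[symmetric] A_l_def by simp
qed

lemma G_l_derivative: "(G_l has_vector_derivative diag_elem xG) (at 0)"
proof -
  have "((\<lambda>\<alpha>. R1 IL I \<alpha> o\<^sub>L R1 JL J \<alpha> o\<^sub>L R1 KL K ((-2) * \<alpha>)) has_vector_derivative
     diag_elem (xR (2/3) (-1/3) (-1/3)) + diag_elem (xR (-1/3) (2/3) (-1/3)) + (-2) *\<^sub>R diag_elem (xR (-1/3) (-1/3) (2/3))) (at 0)"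
    by (rule compose_derivative_at_id[OF compose_derivative_at_id[OF R1_derivatives(1,2)] rescale_derivative[OF R1_derivatives(3)]])
      (simp_all add: R1_zero blinfun_compose_id)
  moreover have "xG = (\<lambda>t i. xR (2/3) (-1/3) (-1/3) t i + of_real 1 * xR (-1/3) (2/3) (-1/3) t i + of_real (-2) * xR (-1/3) (-1/3) (2/3) t i)"
    by (simp add: fun_eq_iff forall_3 algebra_simps)
  ultimately show ?thesis
    unfolding G_l_def by (simp only: diag_elem_linear scaleR_one)
qed

lemma S1_l_derivative: "(S1_l has_vector_derivative diag_elem xS) (at 0)"
proof -
  have "((\<lambda>\<alpha>. R1 IL I \<alpha> o\<^sub>L R1 JL J \<alpha> o\<^sub>L R1 KL K \<alpha>) has_vector_derivative
     diag_elem (xR (2/3) (-1/3) (-1/3)) + diag_elem (xR (-1/3) (2/3) (-1/3)) + diag_elem (xR (-1/3) (-1/3) (2/3))) (at 0)"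
    by (rule compose_derivative_at_id[OF compose_derivative_at_id[OF R1_derivatives(1,2)] R1_derivatives(3)])
      (simp_all add: R1_zero blinfun_compose_id)
  moreover have "xS = (\<lambda>t i. xR (2/3) (-1/3) (-1/3) t i + of_real 1 * xR (-1/3) (2/3) (-1/3) t i + of_real 1 * xR (-1/3) (-1/3) (2/3) t i)"
    by (simp add: fun_eq_iff forall_3 algebra_simps)
  ultimately show ?thesis
    unfolding S1_l_def by (simp only: diag_elem_linear scaleR_one)
qed

text \<open>The imaginary part vanishes iff the diagonal operator preserves the real form.\<close>

lemma diag_elem_real:
  assumes "\<And>h. coord_part Im (diag_op x (coord h)) = 0"
  shows "of_complex_op (diag_op x) = (diag_elem x, 0)"
proof -
  have "snd (of_complex_op (diag_op x)) = 0"
    by (rule blinfun_eqI) (simp add: of_complex_op_apply[OF clinear_diag_op] assms)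
  then show ?thesis by (simp add: diag_elem_def prod_eq_iff)
qed

lemma diag_elem_real_simps:
  "of_complex_op (diag_op xB1) = (diag_elem xB1, 0)" "of_complex_op (diag_op xB2) = (diag_elem xB2, 0)" "of_complex_op (diag_op xRx) = (diag_elem xRx, 0)"
  "of_complex_op (diag_op xA) = (diag_elem xA, 0)" "of_complex_op (diag_op xG) = (diag_elem xG, 0)" "of_complex_op (diag_op xS) = (diag_elem xS, 0)"
  by (rule diag_elem_real; clarsimp simp: explicit_simps zero_prod_def)+

section \<open>Root vectors\<close>

text \<open>Names for the 72 roots; the roots named \<open>Dif t i j\<close> are those with \<open>i \<noteq> j\<close>.\<close>

datatype root = Dif 3 3 3 | Pos 3 3 3 | Neg 3 3 3

definition roots :: "root set" where
  "roots = {Dif t i j |t i j. i \<noteq> j} \<union> {Pos i j k |i j k. True} \<union> {Neg i j k |i j k. True}"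

fun root_value :: "root \<Rightarrow> (3 \<Rightarrow> 3 \<Rightarrow> complex) \<Rightarrow> complex" where
  "root_value (Dif t i j) x = x t i - x t j"
| "root_value (Pos i j k) x = x 1 i + x 2 j + x 3 k"
| "root_value (Neg i j k) x = - (x 1 i + x 2 j + x 3 k)"

text \<open>The root vectors are the operators with a single nonzero parameter.\<close>

fun root_op :: "root \<Rightarrow> triple \<Rightarrow> triple" where
  "root_op (Dif t i j) = e6_op (unit3 t i j) zero_triple zero_triple"
| "root_op (Pos i j k) = e6_op zero_triple (unit3 i j k) zero_triple"
| "root_op (Neg i j k) = e6_op zero_triple zero_triple (unit3 i j k)"

fun opposite :: "root \<Rightarrow> root" where
  "opposite (Dif t i j) = Dif t j i"
| "opposite (Pos i j k) = Neg i j k"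
| "opposite (Neg i j k) = Pos i j k"

fun coroot_param :: "root \<Rightarrow> 3 \<Rightarrow> 3 \<Rightarrow> complex" where
  "coroot_param (Dif t i j) = (\<lambda>s m. if s = t then (if m = i then 1 else 0) - (if m = j then 1 else 0) else 0)"
| "coroot_param (Pos i j k) = (\<lambda>s m. if m = row3 i j k s then 2/3 else -1/3)"
| "coroot_param (Neg i j k) = (\<lambda>s m. if m = row3 i j k s then -2/3 else 1/3)"

lemma cyc_index_unit3: "cyc_index (unit3 i j k) a b c e =
    (if b = row3 i j k a \<and> c = row3 i j k (a+1) \<and> e = row3 i j k (a+2) then 1 else 0)"
  using exhaust_3[of a] by (elim disjE) (simp_all add: cyc_index_def unit3_def conj_ac)

lemma cyc_index_zero_triple [simp]: "cyc_index zero_triple t i j k = 0"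
  by (simp add: cyc_index_def)

lemma root_op_Dif: "root_op (Dif t i j) M a b d = (if a = t \<and> b = i then M a j d else 0) - (if a + 1 = t \<and> d = j then M a b i else 0)"
proof -
  have "(\<Sum>k\<in>UNIV. unit3 t i j a b k * M a k d) = (\<Sum>k\<in>UNIV. if k = j then (if a = t \<and> b = i then M a j d else 0) else 0)"
    by (rule sum.cong) (auto simp: unit3_def)
  moreover have "(\<Sum>k\<in>UNIV. M a b k * unit3 t i j (a+1) k d) = (\<Sum>k\<in>UNIV. if k = i then (if a + 1 = t \<and> d = j then M a b i else 0) else 0)"
    by (rule sum.cong) (auto simp: unit3_def)
  ultimately show ?thesis by (simp add: e6_op_def)
qed

text \<open>With \<open>\<iota> = (i, j, k)\<close>, the unit tensor \<open>P\<close> only affects row \<open>\<iota> a\<close> of the \<open>a\<close>-th matrix, in the two columns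
different from \<open>\<iota> (a+1)\<close>.\<close>

lemma root_op_Pos:
  fixes i j k :: 3
  defines "\<iota> \<equiv> row3 i j k"
  shows "root_op (Pos i j k) M a b d = (if b = \<iota> a then
     (if d = \<iota> (a+1) + 2 then M (a+1) (\<iota> (a+1) + 1) (\<iota> (a+2)) else 0)
     - (if d = \<iota> (a+1) + 1 then M (a+1) (\<iota> (a+1) + 2) (\<iota> (a+2)) else 0) else 0)"
proof -
  have 1: "root_op (Pos i j k) M a b d = (\<Sum>e\<in>UNIV. (if b = \<iota> a \<and> d + 1 = \<iota> (a+1) \<and> e = \<iota> (a+2) then 1 else 0) * M (a+1) (d+2) e -
      (if b = \<iota> a \<and> d + 2 = \<iota> (a+1) \<and> e = \<iota> (a+2) then 1 else 0) * M (a+1) (d+1) e)"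
    by (simp add: e6_op_def cyc_index_unit3 \<iota>_def)
  have 2: "(if b = \<iota> a \<and> d + 1 = \<iota> (a+1) \<and> e = \<iota> (a+2) then 1 else 0) * M (a+1) (d+2) e -
      (if b = \<iota> a \<and> d + 2 = \<iota> (a+1) \<and> e = \<iota> (a+2) then 1 else 0) * M (a+1) (d+1) e
    = (if e = \<iota> (a+2) then if b = \<iota> a then (if d + 1 = \<iota> (a+1) then M (a+1) (d+2) (\<iota> (a+2)) else 0) -
       (if d + 2 = \<iota> (a+1) then M (a+1) (d+1) (\<iota> (a+2)) else 0) else 0 else 0)" for e
    by simp
  show ?thesis unfolding 1 2 using rel3[of "\<iota> (a+1)" d] by (elim disjE) simp_all
qed

lemma root_op_Neg:
  fixes i j k :: 3
  defines "\<iota> \<equiv> row3 i j k"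
  shows "root_op (Neg i j k) M a b d = (if d = \<iota> (a+1) then
     (if b = \<iota> a + 1 then M (a+2) (\<iota> (a+2)) (\<iota> a + 2) else 0)
     - (if b = \<iota> a + 2 then M (a+2) (\<iota> (a+2)) (\<iota> a + 1) else 0) else 0)"
proof -
  have 1: "root_op (Neg i j k) M a b d = - (\<Sum>e\<in>UNIV. (if b + 1 = \<iota> a \<and> d = \<iota> (a+1) \<and> e = \<iota> (a+2) then 1 else 0) * M (a+2) e (b+2) -
      (if b + 2 = \<iota> a \<and> d = \<iota> (a+1) \<and> e = \<iota> (a+2) then 1 else 0) * M (a+2) e (b+1))"
    by (simp add: e6_op_def cyc_index_unit3 \<iota>_def)
  have 2: "(if b + 1 = \<iota> a \<and> d = \<iota> (a+1) \<and> e = \<iota> (a+2) then 1 else 0) * M (a+2) e (b+2) -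
      (if b + 2 = \<iota> a \<and> d = \<iota> (a+1) \<and> e = \<iota> (a+2) then 1 else 0) * M (a+2) e (b+1)
    = (if e = \<iota> (a+2) then if d = \<iota> (a+1) then (if b + 1 = \<iota> a then M (a+2) (\<iota> (a+2)) (b+2) else 0) -
       (if b + 2 = \<iota> a then M (a+2) (\<iota> (a+2)) (b+1) else 0) else 0 else 0)" for e
    by simp
  show ?thesis unfolding 1 2 using rel3[of "\<iota> a" b] by (elim disjE) simp_all
qed

text \<open>The diagonal operators act on the parameters of \<open>e6_op\<close> by the roots.  Tracelessness turns
\<open>- x (t+1) j - x (t+1) (j+2)\<close> into \<open>x (t+1) (j+1)\<close> in the tensor parts.\<close>

lemma diag_op_e6_op:
  assumes "traceless x"
  shows "add_scaled (diag_op x (e6_op X P Q M)) (-1) (e6_op X P Q (diag_op x M)) =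
    e6_op (\<lambda>t i j. (x t i - x t j) * X t i j) (\<lambda>i j k. (x 1 i + x 2 j + x 3 k) * P i j k)
      (\<lambda>i j k. - (x 1 i + x 2 j + x 3 k) * Q i j k) M"
proof (intro ext)
  fix a b d
  have tr: "x t (i+1) + x t (i+2) = - x t i" for t i
    using assms sum3_from[of "x t" i] by (simp add: traceless_def add_eq_0_iff algebra_simps)
  have r: "cyc_index (\<lambda>i j k. (x 1 i + x 2 j + x 3 k) * P i j k) t i j k = (x t i + x (t+1) j + x (t+2) k) * cyc_index P t i j k"
      "cyc_index (\<lambda>i j k. - (x 1 i + x 2 j + x 3 k) * P i j k) t i j k = - (x t i + x (t+1) j + x (t+2) k) * cyc_index P t i j k"
     for P t i j k using exhaust_3[of t] by (auto simp: cyc_index_def algebra_simps)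
  have s1: "x a (d+1) = - x a d - x a (d+2)" for a d using tr[of a d] by algebra
  show "add_scaled (diag_op x (e6_op X P Q M)) (-1) (e6_op X P Q (diag_op x M)) a b d =
    e6_op (\<lambda>t i j. (x t i - x t j) * X t i j) (\<lambda>i j k. (x 1 i + x 2 j + x 3 k) * P i j k)
      (\<lambda>i j k. - (x 1 i + x 2 j + x 3 k) * Q i j k) M a b d"
    unfolding add_scaled_def e6_op_def r diag_op_def sum3_from[of _ d]
    by (simp only: add3_simps s1[of _ d] s1[of _ b]) algebra
qed

lemma e6_op_scale: "e6_op (\<lambda>t i j. c * X t i j) (\<lambda>i j k. c * P i j k) (\<lambda>i j k. c * Q i j k) M = add_scaled zero_triple c (e6_op X P Q M)"
proof -
  have "cyc_index (\<lambda>i j k. c * P i j k) t i j k = c * cyc_index P t i j k" for P t i j k by (simp add: cyc_index_def)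
  then show ?thesis by (simp add: e6_op_def add_scaled_def sum3_from[of _ 1] algebra_simps)
qed

lemma root_op_weight:
  assumes "traceless x"
  shows "add_scaled (diag_op x (root_op r M)) (-1) (root_op r (diag_op x M)) = add_scaled zero_triple (root_value r x) (root_op r M)"
proof -
  have u: "(\<lambda>s k l. f s k l * unit3 t i j s k l) = (\<lambda>s k l. f t i j * unit3 t i j s k l)" for f t i j
    by (auto simp: unit3_def fun_eq_iff)
  show ?thesis
  proof (cases r)
    case (Dif t i j)
    show ?thesis unfolding Dif root_op.simps diag_op_e6_op[OF assms] u[of "\<lambda>t i j. x t i - x t j"]
      using e6_op_scale[of "x t i - x t j" "unit3 t i j" zero_triple zero_triple M] by simp
  next
    case (Pos i j k)
    show ?thesis unfolding Pos root_op.simps diag_op_e6_op[OF assms] u[of "\<lambda>i j k. x 1 i + x 2 j + x 3 k"]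
      using e6_op_scale[of "x 1 i + x 2 j + x 3 k" zero_triple "unit3 i j k" zero_triple M] by simp
  next
    case (Neg i j k)
    show ?thesis unfolding Neg root_op.simps diag_op_e6_op[OF assms] u[of "\<lambda>i j k. - (x 1 i + x 2 j + x 3 k)"]
      using e6_op_scale[of "- (x 1 i + x 2 j + x 3 k)" zero_triple zero_triple "unit3 i j k" M] by simp
  qed
qed

lemma root_op_bracket_Pos_Neg:
  "add_scaled (root_op (Pos i j k) (root_op (Neg i j k) M)) (-1) (root_op (Neg i j k) (root_op (Pos i j k) M)) = diag_op (coroot_param (Pos i j k)) M"
proof (intro ext)
  fix a b d
  define \<iota> where "\<iota> = row3 i j k"
  show "add_scaled (root_op (Pos i j k) (root_op (Neg i j k) M)) (-1) (root_op (Neg i j k) (root_op (Pos i j k) M)) a b d = diag_op (coroot_param (Pos i j k)) M a b d"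
    unfolding add_scaled_def root_op_Pos root_op_Neg diag_op_def coroot_param.simps \<iota>_def[symmetric]
    using rel3[of "\<iota> a" b] rel3[of "\<iota> (a+1)" d]
    by (elim disjE) simp_all
qed

lemma root_op_bracket_opposite:
  assumes "r \<in> roots"
  shows "add_scaled (root_op r (root_op (opposite r) M)) (-1) (root_op (opposite r) (root_op r M)) = diag_op (coroot_param r) M"
proof (cases r)
  case (Dif t i j)
  then have ij: "i \<noteq> j" using assms by (auto simp: roots_def)
  show ?thesis
  proof (intro ext)
    fix a b d
    show "add_scaled (root_op r (root_op (opposite r) M)) (-1) (root_op (opposite r) (root_op r M)) a b d = diag_op (coroot_param r) M a b d"
      unfolding Dif opposite.simps add_scaled_def root_op_Dif diag_op_def coroot_param.simps
      using ij rel3[of a t] by (elim disjE) auto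
  qed
next
  case (Pos i j k)
  then show ?thesis using root_op_bracket_Pos_Neg by simp
next
  case (Neg i j k)
  have "add_scaled (root_op (Neg i j k) (root_op (Pos i j k) M)) (-1) (root_op (Pos i j k) (root_op (Neg i j k) M)) =
    add_scaled zero_triple (-1) (add_scaled (root_op (Pos i j k) (root_op (Neg i j k) M)) (-1) (root_op (Neg i j k) (root_op (Pos i j k) M)))"
    by (simp add: add_scaled_def)
  moreover have "diag_op (coroot_param (Neg i j k)) M = add_scaled zero_triple (-1) (diag_op (coroot_param (Pos i j k)) M)"
    by (intro ext) (auto simp: diag_op_def add_scaled_def)
  ultimately show ?thesis unfolding Neg opposite.simps root_op_bracket_Pos_Neg by simp
qed

text \<open>This is the complex span of the six generators, by \<open>cartan_H_span\<close>.\<close>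

definition cartan_H :: "((herm3 \<Rightarrow>\<^sub>L herm3) \<times> (herm3 \<Rightarrow>\<^sub>L herm3)) set" where
  "cartan_H = {of_complex_op (diag_op x) |x. traceless x}"

text \<open>A linear extension of the inverse of \<open>x \<mapsto> of_complex_op (diag_op x)\<close> (on traceless \<open>x\<close>) from the diagonal
elements to the whole algebra, by averaging diagonal entries over a row.\<close>

definition diag_param :: "(herm3 \<Rightarrow>\<^sub>L herm3) \<times> (herm3 \<Rightarrow>\<^sub>L herm3) \<Rightarrow> 3 \<Rightarrow> 3 \<Rightarrow> complex" where
  "diag_param w t i = (\<Sum>j\<in>UNIV. complex_op w (unit3 t i j) t i j) / 3"

lemma diag_param_diag_op:
  assumes "traceless x"
  shows "diag_param (of_complex_op (diag_op x)) = x"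
proof (intro ext)
  fix t i
  have "(\<Sum>j\<in>UNIV. diag_op x (unit3 t i j) t i j) = (\<Sum>j\<in>UNIV. x t i - x (t+1) j)"
    by (simp add: diag_op_def unit3_def)
  also have "\<dots> = 3 * x t i"
    using assms by (simp add: sum_subtractf traceless_def)
  finally show "diag_param (of_complex_op (diag_op x)) t i = x t i"
    by (simp add: diag_param_def complex_op_of_complex_op[OF clinear_diag_op])
qed

lemma of_complex_op_diag_op_inject:
  assumes "traceless x" "traceless y" "of_complex_op (diag_op x) = of_complex_op (diag_op y)"
  shows "x = y"
  using assms diag_param_diag_op by metis

lemma diag_param_linear: "diag_param (v + cscale c w) t i = diag_param v t i + c * diag_param w t i"
  by (simp add: diag_param_def complex_op_add add_scaled_def sum.distrib sum_distrib_left[symmetric] add_divide_distrib)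

lemma root_value_linear: "root_value r (\<lambda>t i. x t i + c * y t i) = root_value r x + c * root_value r y"
  by (cases r) (simp_all add: algebra_simps)

lemma traceless_linear: "traceless x \<Longrightarrow> traceless y \<Longrightarrow> traceless (\<lambda>t i. x t i + c * y t i)"
  by (simp add: traceless_def sum.distrib sum_distrib_left[symmetric])

lemma traceless_zero: "traceless (\<lambda>_ _. 0)"
  by (simp add: traceless_def)

lemma of_complex_op_diag_op_zero: "of_complex_op (diag_op (\<lambda>_ _. 0)) = 0"
  by (rule complex_op_eqI) (simp add: complex_op_of_complex_op[OF clinear_diag_op] complex_op_zero diag_op_def)

lemma cartan_H_subspace: "cplx.subspace cartan_H"
  unfolding cplx.subspace_def
proof (intro conjI ballI allI)
  show "0 \<in> cartan_H" unfolding cartan_H_def using traceless_zero of_complex_op_diag_op_zero by (metis (mono_tags, lifting) mem_Collect_eq)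
  have *: "of_complex_op (diag_op x) + cscale c (of_complex_op (diag_op y)) \<in> cartan_H" if "traceless x" "traceless y" for x y c
    unfolding of_complex_op_diag_op_linear[symmetric] cartan_H_def using traceless_linear[OF that] by blast
  show "v + w \<in> cartan_H" if "v \<in> cartan_H" "w \<in> cartan_H" for v w
    using that *[of _ _ 1] by (auto simp: cartan_H_def)
  show "cscale c v \<in> cartan_H" if "v \<in> cartan_H" for v c
    using that *[OF traceless_zero, of _ c] by (auto simp: cartan_H_def of_complex_op_diag_op_zero)
qed

lemma diag_op_eq_e6_op: "diag_op x = e6_op (\<lambda>t i j. if i = j then x t i else 0) zero_triple zero_triple"
proof (intro ext)
  fix M :: triple and a b d :: 3
  have "(\<Sum>k\<in>UNIV. (if b = k then x a b else 0) * M a k d) = (\<Sum>k\<in>UNIV. if k = b then x a b * M a b d else 0)"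
    by (rule sum.cong) auto
  moreover have "(\<Sum>k\<in>UNIV. M a b k * (if k = d then x (a+1) (k::3) else 0)) = (\<Sum>k\<in>UNIV. if k = d then M a b d * x (a+1) d else 0)"
    by (rule sum.cong) auto
  ultimately show "diag_op x M a b d = e6_op (\<lambda>t i j. if i = j then x t i else 0) zero_triple zero_triple M a b d"
    by (simp add: diag_op_def e6_op_def algebra_simps)
qed

lemma clinear_root_op: "clinear (root_op r)"
  by (cases r) (simp_all add: clinear_def e6_op_add_scaled)

lemma derivation_diag_op: "traceless x \<Longrightarrow> derivation (diag_op x)"
  unfolding diag_op_eq_e6_op by (rule derivation_e6_op) (simp add: traceless_def)

lemma derivation_root_op:
  assumes "r \<in> roots"
  shows "derivation (root_op r)"
proof (cases r)
  case (Dif t i j)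
  then have "i \<noteq> j" using assms by (auto simp: roots_def)
  then have "unit3 t i j s k k = 0" for s k by (auto simp: unit3_def)
  then show ?thesis unfolding Dif root_op.simps by (intro derivation_e6_op) simp
qed (simp_all add: derivation_e6_op)

lemma diag_op_commute: "add_scaled (diag_op x (diag_op y M)) (-1) (diag_op y (diag_op x M)) = zero_triple"
  by (simp add: diag_op_def add_scaled_def fun_eq_iff)

lemma sum_roots:
  fixes f :: "root \<Rightarrow> complex"
  shows "(\<Sum>r\<in>roots. f r) = (\<Sum>t\<in>UNIV. \<Sum>i\<in>UNIV. \<Sum>j\<in>UNIV. if i = j then 0 else f (Dif t i j))
    + (\<Sum>i\<in>UNIV. \<Sum>j\<in>UNIV. \<Sum>k\<in>UNIV. f (Pos i j k)) + (\<Sum>i\<in>UNIV. \<Sum>j\<in>UNIV. \<Sum>k\<in>UNIV. f (Neg i j k))"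
    and finite_roots: "finite roots"
proof -
  let ?D = "(\<lambda>(t,i,j). Dif t i j) ` {(t,i,j). i \<noteq> j}" and ?P = "(\<lambda>(i,j,k). Pos i j k) ` UNIV" and ?N = "(\<lambda>(i,j,k). Neg i j k) ` UNIV"
  have R: "roots = (?D \<union> ?P) \<union> ?N"
    unfolding roots_def by (auto simp: image_iff Bex_def)
  show "finite roots" unfolding R by simp
  have triple_sum: "(\<Sum>x\<in>UNIV. g x) = (\<Sum>i\<in>UNIV. \<Sum>j\<in>UNIV. \<Sum>k\<in>UNIV. g (i,j,k))" for g :: "3 \<times> 3 \<times> 3 \<Rightarrow> complex"
    by (simp add: UNIV_Times_UNIV[symmetric] sum.cartesian_product del: UNIV_Times_UNIV)
  have D: "sum f ?D = (\<Sum>t\<in>UNIV. \<Sum>i\<in>UNIV. \<Sum>j\<in>UNIV. if i = j then 0 else f (Dif t i j))"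
  proof -
    have "sum f ?D = (\<Sum>x\<in>{(t,i,j). i \<noteq> j}. f (case x of (t,i,j) \<Rightarrow> Dif t i j))"
      by (subst sum.reindex) (auto simp: inj_on_def)
    also have "\<dots> = (\<Sum>x\<in>UNIV. case x of (t,i,j) \<Rightarrow> if i = j then 0 else f (Dif t i j))"
      by (rule sum.mono_neutral_cong_left) auto
    finally show ?thesis unfolding triple_sum by simp
  qed
  have P: "sum f ?P = (\<Sum>i\<in>UNIV. \<Sum>j\<in>UNIV. \<Sum>k\<in>UNIV. f (Pos i j k))"
    by (subst sum.reindex) (auto simp: inj_on_def triple_sum)
  have N: "sum f ?N = (\<Sum>i\<in>UNIV. \<Sum>j\<in>UNIV. \<Sum>k\<in>UNIV. f (Neg i j k))"
    by (subst sum.reindex) (auto simp: inj_on_def triple_sum)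
  have "?D \<inter> ?P = {}" "(?D \<union> ?P) \<inter> ?N = {}" by auto
  then show "(\<Sum>r\<in>roots. f r) = (\<Sum>t\<in>UNIV. \<Sum>i\<in>UNIV. \<Sum>j\<in>UNIV. if i = j then 0 else f (Dif t i j))
    + (\<Sum>i\<in>UNIV. \<Sum>j\<in>UNIV. \<Sum>k\<in>UNIV. f (Pos i j k)) + (\<Sum>i\<in>UNIV. \<Sum>j\<in>UNIV. \<Sum>k\<in>UNIV. f (Neg i j k))"
    unfolding R D[symmetric] P[symmetric] N[symmetric] by (simp add: sum.union_disjoint)
qed

lemma e6_op_expand:
  "e6_op X P Q M t i j = (\<Sum>a\<in>UNIV. \<Sum>b\<in>UNIV. \<Sum>c\<in>UNIV. e6_op (unit3 a b c) zero_triple zero_triple M t i j * X a b c)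
    + (\<Sum>a\<in>UNIV. \<Sum>b\<in>UNIV. \<Sum>c\<in>UNIV. e6_op zero_triple (unit3 a b c) zero_triple M t i j * P a b c)
    + (\<Sum>a\<in>UNIV. \<Sum>b\<in>UNIV. \<Sum>c\<in>UNIV. e6_op zero_triple zero_triple (unit3 a b c) M t i j * Q a b c)"
proof -
  have rl: "cyc_index (add_scaled u c v) t i j k = cyc_index u t i j k + c * cyc_index v t i j k" for u c v t i j k
    by (simp add: cyc_index_def add_scaled_def)
  have "e6_op X zero_triple zero_triple M t i j = (\<Sum>a\<in>UNIV. \<Sum>b\<in>UNIV. \<Sum>c\<in>UNIV. e6_op (unit3 a b c) zero_triple zero_triple M t i j * X a b c)"
    by (rule linear_functional_unit3[of "\<lambda>X. e6_op X zero_triple zero_triple M t i j"])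
      (simp add: e6_op_def add_scaled_def sum3_from[of _ 1] algebra_simps)
  moreover have "e6_op zero_triple P zero_triple M t i j = (\<Sum>a\<in>UNIV. \<Sum>b\<in>UNIV. \<Sum>c\<in>UNIV. e6_op zero_triple (unit3 a b c) zero_triple M t i j * P a b c)"
    by (rule linear_functional_unit3[of "\<lambda>P. e6_op zero_triple P zero_triple M t i j"])
      (simp add: e6_op_def rl sum3_from[of _ 1] algebra_simps)
  moreover have "e6_op zero_triple zero_triple Q M t i j = (\<Sum>a\<in>UNIV. \<Sum>b\<in>UNIV. \<Sum>c\<in>UNIV. e6_op zero_triple zero_triple (unit3 a b c) M t i j * Q a b c)"
    by (rule linear_functional_unit3[of "\<lambda>Q. e6_op zero_triple zero_triple Q M t i j"])
      (simp add: e6_op_def rl sum3_from[of _ 1] algebra_simps)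
  moreover have "e6_op X P Q M t i j = e6_op X zero_triple zero_triple M t i j + e6_op zero_triple P zero_triple M t i j + e6_op zero_triple zero_triple Q M t i j"
    by (simp add: e6_op_def)
  ultimately show ?thesis by simp
qed

lemma e6_op_decomposition:
  "e6_op X P Q M t i j = diag_op (\<lambda>t i. X t i i) M t i j +
    (\<Sum>r\<in>roots. (case r of Dif a b c \<Rightarrow> X a b c | Pos a b c \<Rightarrow> P a b c | Neg a b c \<Rightarrow> Q a b c) * root_op r M t i j)"
proof -
  have "(\<Sum>a\<in>UNIV. \<Sum>b\<in>UNIV. \<Sum>c\<in>UNIV. e6_op (unit3 a b c) zero_triple zero_triple M t i j * X a b c) =
    (\<Sum>a\<in>UNIV. \<Sum>b\<in>UNIV. \<Sum>c\<in>UNIV. e6_op (unit3 a b c) zero_triple zero_triple M t i j * (if b = c then X a b b else 0))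
    + (\<Sum>a\<in>UNIV. \<Sum>b\<in>UNIV. \<Sum>c\<in>UNIV. if b = c then 0 else X a b c * e6_op (unit3 a b c) zero_triple zero_triple M t i j)"
    unfolding sum.distrib[symmetric] by (intro sum.cong refl) auto
  also have "(\<Sum>a\<in>UNIV. \<Sum>b\<in>UNIV. \<Sum>c\<in>UNIV. e6_op (unit3 a b c) zero_triple zero_triple M t i j * (if b = c then X a b b else 0)) = diag_op (\<lambda>t i. X t i i) M t i j"
    unfolding diag_op_eq_e6_op
    by (rule linear_functional_unit3[of "\<lambda>X. e6_op X zero_triple zero_triple M t i j", symmetric])
      (simp add: e6_op_def add_scaled_def sum3_from[of _ 1] algebra_simps)
  finally show ?thesis
    unfolding e6_op_expand[of X P Q] sum_roots by (simp add: mult.commute cong del: if_weak_cong)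
qed

lemma complex_op_sum: "finite S \<Longrightarrow> complex_op (\<Sum>r\<in>S. cscale (c r) (w r)) M t i j = (\<Sum>r\<in>S. c r * complex_op (w r) M t i j)"
proof (induction S rule: finite_induct)
  case empty
  show ?case by (simp add: complex_op_zero)
next
  case (insert x S)
  then show ?case by (simp add: complex_op_plus complex_op_cscale add_scaled_def)
qed

lemma sl3O_decomposition:
  assumes "w \<in> complexification sl3O"
  shows "\<exists>h\<in>cartan_H. \<exists>c. w = h + (\<Sum>r\<in>roots. cscale (c r) (of_complex_op (root_op r)))"
proof -
  have "derivation (complex_op w)" using assms complexified_sl3O_iff by blast
  then obtain X P Q where X: "\<And>t. (\<Sum>i\<in>UNIV. X t i i) = 0" and w: "complex_op w = e6_op X P Q"
    using derivation_imp_e6_op by blast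
  let ?c = "\<lambda>r. case r of Dif a b c \<Rightarrow> X a b c | Pos a b c \<Rightarrow> P a b c | Neg a b c \<Rightarrow> Q a b c"
  have "w = of_complex_op (diag_op (\<lambda>t i. X t i i)) + (\<Sum>r\<in>roots. cscale (?c r) (of_complex_op (root_op r)))"
  proof (rule complex_op_eqI, intro ext)
    fix M t i j
    show "complex_op w M t i j = complex_op (of_complex_op (diag_op (\<lambda>t i. X t i i)) + (\<Sum>r\<in>roots. cscale (?c r) (of_complex_op (root_op r)))) M t i j"
      unfolding w complex_op_plus add_scaled_def complex_op_sum[OF finite_roots] complex_op_of_complex_op[OF clinear_diag_op] complex_op_of_complex_op[OF clinear_root_op]
      using e6_op_decomposition[of X P Q M t i j] by simp
  qed
  moreover have "of_complex_op (diag_op (\<lambda>t i. X t i i)) \<in> cartan_H"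
    unfolding cartan_H_def traceless_def using X by auto
  ultimately show ?thesis by blast
qed

section \<open>The Cartan subalgebra and the roots\<close>

text \<open>The first two rows of \<open>x\<close> split into a part with equal rows, covered by \<open>xRx\<close> and \<open>xS\<close>, and one with
opposite rows, covered by \<open>xB1\<close> and \<open>xB2\<close>; the third row is covered by \<open>xA\<close> and \<open>xG\<close>.\<close>

lemma diag_op_linear_combination:
  assumes "traceless x"
  shows "x = (\<lambda>t i. 0 + (x 1 1 - x 2 1) * xB1 t i + (x 1 1 - x 2 1 + x 1 2 - x 2 2) * xB2 t i
     + (- \<i> * (x 1 1 + x 2 1 - x 1 2 - x 2 2) / 2) * xRx t i
     + (- \<i> * (x 3 1 - x 3 2) / 2) * xA t i + (- \<i> * (x 3 1 + x 3 2) / 2) * xG t i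
     + (- \<i> * (x 1 1 + x 2 1 + x 1 2 + x 2 2) / 2) * xS t i)"
proof (intro ext)
  fix t i
  have tr: "x t 3 = - x t 1 - x t 2" for t
    using assms by (simp add: traceless_def sum_3 add_eq_0_iff algebra_simps)
  show "x t i = 0 + (x 1 1 - x 2 1) * xB1 t i + (x 1 1 - x 2 1 + x 1 2 - x 2 2) * xB2 t i
     + (- \<i> * (x 1 1 + x 2 1 - x 1 2 - x 2 2) / 2) * xRx t i
     + (- \<i> * (x 3 1 - x 3 2) / 2) * xA t i + (- \<i> * (x 3 1 + x 3 2) / 2) * xG t i
     + (- \<i> * (x 1 1 + x 2 1 + x 1 2 + x 2 2) / 2) * xS t i"
  proof -
    have i: "\<i> * (\<i> * z) = - z" for z by (simp add: mult.assoc[symmetric])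
    show ?thesis using exhaust_3[of t] exhaust_3[of i]
    apply (elim disjE)
    apply (simp_all only: row3_simps tr)
    apply (simp_all add: field_simps i)
    done
  qed
qed

lemma traceless_x: "traceless xB1" "traceless xB2" "traceless xRx" "traceless xA" "traceless xG" "traceless xS"
  by (simp_all add: traceless_def forall_3 sum_3)

lemma cartan_H_span:
  "cartan_H = cplx.span ((\<lambda>X. (X, 0)) ` {diag_elem xB1, diag_elem xB2, diag_elem xRx, diag_elem xA, diag_elem xG, diag_elem xS})"
  (is "_ = cplx.span ?B")
proof
  have B: "?B = {of_complex_op (diag_op xB1), of_complex_op (diag_op xB2), of_complex_op (diag_op xRx), of_complex_op (diag_op xA), of_complex_op (diag_op xG), of_complex_op (diag_op xS)}"
    unfolding diag_elem_real_simps by simp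
  have "?B \<subseteq> cartan_H" unfolding B cartan_H_def using traceless_x by blast
  then show "cplx.span ?B \<subseteq> cartan_H" using cartan_H_subspace by (rule cplx.span_minimal)
  show "cartan_H \<subseteq> cplx.span ?B"
  proof
    fix h assume "h \<in> cartan_H"
    then obtain x where x: "traceless x" "h = of_complex_op (diag_op x)" by (auto simp: cartan_H_def)
    show "h \<in> cplx.span ?B"
      unfolding x(2)
      apply (subst diag_op_linear_combination[OF x(1)])
      unfolding of_complex_op_diag_op_linear of_complex_op_diag_op_zero B
      by (intro cplx.span_add cplx.span_scale cplx.span_zero cplx.span_base) simp_all
  qed
qed

lemma diag_elem_independent:
  fixes r :: "nat \<Rightarrow> real"
  assumes "r 1 *\<^sub>R diag_elem xB1 + r 2 *\<^sub>R diag_elem xB2 + r 3 *\<^sub>R diag_elem xRx + r 4 *\<^sub>R diag_elem xA + r 5 *\<^sub>R diag_elem xG + r 6 *\<^sub>R diag_elem xS = 0"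
  shows "r 1 = 0" "r 2 = 0" "r 3 = 0" "r 4 = 0" "r 5 = 0" "r 6 = 0"
proof -
  let ?x = "\<lambda>t i. 0 + of_real (r 1) * xB1 t i + of_real (r 2) * xB2 t i + of_real (r 3) * xRx t i
    + of_real (r 4) * xA t i + of_real (r 5) * xG t i + of_real (r 6) * xS t i"
  have "of_complex_op (diag_op ?x) = (r 1 *\<^sub>R diag_elem xB1 + r 2 *\<^sub>R diag_elem xB2 + r 3 *\<^sub>R diag_elem xRx + r 4 *\<^sub>R diag_elem xA + r 5 *\<^sub>R diag_elem xG + r 6 *\<^sub>R diag_elem xS, 0)"
    unfolding of_complex_op_diag_op_linear of_complex_op_diag_op_zero diag_elem_real_simps by (simp add: cscale_def)
  then have "of_complex_op (diag_op ?x) = of_complex_op (diag_op (\<lambda>_ _. 0))"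
    unfolding assms of_complex_op_diag_op_zero by (simp add: zero_prod_def)
  moreover have "traceless ?x" by (intro traceless_linear traceless_x traceless_zero)
  ultimately have "?x = (\<lambda>_ _. 0)" using of_complex_op_diag_op_inject traceless_zero by blast
  then have x: "?x t i = 0" for t i by metis
  show "r 1 = 0" "r 2 = 0" "r 3 = 0" "r 4 = 0" "r 5 = 0" "r 6 = 0"
    using x[of 1 1] x[of 2 1] x[of 1 2] x[of 3 1] x[of 3 2] by (simp_all add: complex_eq_iff)
qed

text \<open>Test parameters that separate the roots: the numbers \<open>1, 2, -3\<close> have sum zero, are distinct up to
sign, and have six distinct differences.\<close>

definition probe :: "3 \<Rightarrow> 3 \<Rightarrow> 3 \<Rightarrow> complex" where
  "probe s = (\<lambda>t i. if t = s then row3 1 2 (-3) i else 0)"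

lemma traceless_probe: "traceless (probe s)"
  by (simp add: traceless_def probe_def sum_3)

lemma row3_probe: fixes i j k l :: 3
  defines "y \<equiv> row3 1 2 (-3) :: 3 \<Rightarrow> complex"
  shows "y i = y j \<longleftrightarrow> i = j" "y i \<noteq> 0" "y i \<noteq> - y j" "- y i \<noteq> y j"
    "i \<noteq> j \<Longrightarrow> k \<noteq> l \<Longrightarrow> y i - y j = y k - y l \<Longrightarrow> i = k \<and> j = l"
  unfolding y_def using exhaust_3[of i] exhaust_3[of j] exhaust_3[of k] exhaust_3[of l]
  by (elim disjE; simp)+

lemma root_value_probe:
  "root_value (Dif t i j) (probe s) = (if t = s then row3 1 2 (-3) i - row3 1 2 (-3) j else 0)"
  "root_value (Pos i j k) (probe s) = row3 1 2 (-3) (row3 i j k s)"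
  "root_value (Neg i j k) (probe s) = - row3 1 2 (-3) (row3 i j k s)"
  using exhaust_3[of s] by (auto simp: probe_def)

lemma root_value_distinct:
  assumes "r \<in> roots" "s \<in> roots" and eq: "\<And>t. root_value r (probe t) = root_value s (probe t)"
  shows "r = s"
proof (cases r)
  case (Dif t i j)
  then have ij: "i \<noteq> j" using assms by (auto simp: roots_def)
  show ?thesis
  proof (cases s)
    case (Dif t' k l)
    then have kl: "k \<noteq> l" using assms by (auto simp: roots_def)
    show ?thesis
      using eq[of t] ij kl row3_probe(1)[of i j] row3_probe(5)[of i j k l] unfolding Dif \<open>r = _\<close> root_value_probe by (auto split: if_splits)
  next
    case (Pos k l m)
    then show ?thesis using eq[of "t+1"] unfolding Pos \<open>r = _\<close> root_value_probe by (simp add: row3_probe(2)[symmetric])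
  next
    case (Neg k l m)
    then show ?thesis using eq[of "t+1"] unfolding Neg \<open>r = _\<close> root_value_probe by (simp add: row3_probe(2)[symmetric])
  qed
next
  case (Pos i j k)
  show ?thesis
  proof (cases s)
    case (Dif t k l)
    then show ?thesis using eq[of "t+1"] unfolding Dif \<open>r = _\<close> root_value_probe by (simp add: row3_probe(2))
  next
    case (Pos l m n)
    then show ?thesis using eq[of 1] eq[of 2] eq[of 3] unfolding Pos \<open>r = _\<close> root_value_probe by (simp add: row3_probe(1))
  next
    case (Neg l m n)
    then show ?thesis using eq[of 1] unfolding Neg \<open>r = _\<close> root_value_probe by (simp add: row3_probe(3))
  qed
next
  case (Neg i j k)
  show ?thesis
  proof (cases s)
    case (Dif t k l)
    then show ?thesis using eq[of "t+1"] unfolding Dif \<open>r = _\<close> root_value_probe by (simp add: row3_probe(2))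
  next
    case (Pos l m n)
    then show ?thesis using eq[of 1] unfolding Pos \<open>r = _\<close> root_value_probe by (simp add: row3_probe(4))
  next
    case (Neg l m n)
    then show ?thesis using eq[of 1] eq[of 2] eq[of 3] unfolding Neg \<open>r = _\<close> root_value_probe by (simp add: row3_probe(1))
  qed
qed

lemma root_value_nonzero:
  assumes "r \<in> roots"
  shows "\<exists>s. root_value r (probe s) \<noteq> 0"
proof (cases r)
  case (Dif t i j)
  then have "i \<noteq> j" using assms by (auto simp: roots_def)
  then have "root_value r (probe t) \<noteq> 0" unfolding Dif root_value_probe by (simp add: row3_probe(1))
  then show ?thesis ..
next
  case (Pos i j k)
  have "root_value r (probe 1) \<noteq> 0" unfolding Pos root_value_probe by (simp add: row3_probe(2))
  then show ?thesis ..
next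
  case (Neg i j k)
  have "root_value r (probe 1) \<noteq> 0" unfolding Neg root_value_probe by (simp add: row3_probe(2))
  then show ?thesis ..
qed

lemma root_value_separate:
  assumes "traceless x" "\<And>r. r \<in> roots \<Longrightarrow> root_value r x = 0"
  shows "x = (\<lambda>_ _. 0)"
proof (intro ext)
  fix t i
  have eq: "x t j = x t i" for j
  proof (cases "j = i")
    case False
    then have "Dif t j i \<in> roots" by (auto simp: roots_def)
    from assms(2)[OF this] show ?thesis by simp
  qed simp
  have "(\<Sum>j\<in>UNIV. x t j) = (\<Sum>j\<in>(UNIV :: 3 set). x t i)" by (intro sum.cong refl eq)
  then show "x t i = 0" using assms(1) by (simp add: traceless_def)
qed

lemma traceless_coroot: "traceless (coroot_param r)"
proof (cases r)
  case (Dif s i j)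
  have "(\<Sum>m\<in>UNIV. coroot_param r t m) = 0" for t
    unfolding Dif by (cases "t = s") (simp_all add: sum_subtractf)
  then show ?thesis by (simp add: traceless_def)
next
  case (Pos i j k)
  have "(\<Sum>m\<in>UNIV. coroot_param r t m) = 0" for t
    unfolding Pos sum3_from[of _ "row3 i j k t"] by simp
  then show ?thesis by (simp add: traceless_def)
next
  case (Neg i j k)
  have "(\<Sum>m\<in>UNIV. coroot_param r t m) = 0" for t
    unfolding Neg sum3_from[of _ "row3 i j k t"] by simp
  then show ?thesis by (simp add: traceless_def)
qed

lemma root_value_coroot:
  assumes "r \<in> roots"
  shows "root_value r (coroot_param r) = 2"
  using assms by (cases r) (auto simp: roots_def)

lemma opposite_roots: "r \<in> roots \<Longrightarrow> opposite r \<in> roots"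
  by (cases r) (auto simp: roots_def)

lemma root_value_opposite: "root_value (opposite r) x = - root_value r x"
  by (cases r) auto

lemma bracket_diag_root_vector:
  assumes "traceless x"
  shows "cbracket commutator (of_complex_op (diag_op x)) (of_complex_op (root_op r)) = cscale (root_value r x) (of_complex_op (root_op r))"
  by (rule complex_op_eqI) (simp add: complex_op_bracket complex_op_cscale complex_op_of_complex_op[OF clinear_diag_op] complex_op_of_complex_op[OF clinear_root_op] root_op_weight[OF assms])

lemma bracket_root_vectors_opposite:
  assumes "r \<in> roots"
  shows "cbracket commutator (of_complex_op (root_op r)) (of_complex_op (root_op (opposite r))) = of_complex_op (diag_op (coroot_param r))"
  by (rule complex_op_eqI) (simp add: complex_op_bracket complex_op_of_complex_op[OF clinear_diag_op] complex_op_of_complex_op[OF clinear_root_op] root_op_bracket_opposite[OF assms])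

lemma bracket_diag_diag: "cbracket commutator (of_complex_op (diag_op x)) (of_complex_op (diag_op y)) = 0"
  by (rule complex_op_eqI) (simp add: complex_op_bracket complex_op_zero complex_op_of_complex_op[OF clinear_diag_op] diag_op_commute)

theorem root_decomposition_sl3O:
  "root_decomposition cscale (cbracket commutator) (complexification sl3O) cartan_H roots
     (\<lambda>r w. root_value r (diag_param w)) (\<lambda>r. of_complex_op (root_op r)) opposite"
proof (intro root_decomposition.intro root_decomposition_axioms.intro lie_algebra_sl3O)
  show "cplx.subspace cartan_H" by (rule cartan_H_subspace)
  show "cartan_H \<subseteq> complexification sl3O"
    unfolding cartan_H_def by (auto simp: complexified_sl3O_iff complex_op_of_complex_op[OF clinear_diag_op] derivation_diag_op)
  show "\<exists>B. finite B \<and> cartan_H = cplx.span B" by (rule exI, rule conjI[OF _ cartan_H_span]) simp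
  show "cbracket commutator x y = 0" if "x \<in> cartan_H" "y \<in> cartan_H" for x y
    using that bracket_diag_diag by (auto simp: cartan_H_def)
  show "finite roots" by (rule finite_roots)
  show "of_complex_op (root_op r) \<in> complexification sl3O" if "r \<in> roots" for r
    by (simp add: complexified_sl3O_iff complex_op_of_complex_op[OF clinear_root_op] derivation_root_op[OF that])
  show "cbracket commutator h (of_complex_op (root_op r)) = cscale (root_value r (diag_param h)) (of_complex_op (root_op r))" if "r \<in> roots" "h \<in> cartan_H" for r h
    using that bracket_diag_root_vector by (auto simp: cartan_H_def diag_param_diag_op)
  show "of_complex_op (root_op r) \<noteq> 0" if r: "r \<in> roots" for r
  proof
    assume "of_complex_op (root_op r) = 0"
    then have "of_complex_op (diag_op (coroot_param r)) = cbracket commutator 0 (of_complex_op (root_op (opposite r)))"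
      using bracket_root_vectors_opposite[OF r] by simp
    also have "\<dots> = 0" by (simp add: cbracket_def commutator_def zero_prod_def)
    finally have "of_complex_op (diag_op (coroot_param r)) = of_complex_op (diag_op (\<lambda>_ _. 0))" by (simp add: of_complex_op_diag_op_zero)
    then have "coroot_param r = (\<lambda>_ _. 0)" using of_complex_op_diag_op_inject traceless_coroot traceless_zero by blast
    moreover have "root_value r (\<lambda>_ _. 0) = 0" by (cases r) auto
    ultimately show False using root_value_coroot[OF r] by simp
  qed
  show "root_value r (diag_param (x + y)) = root_value r (diag_param x) + root_value r (diag_param y)" for r x y
  proof -
    have "diag_param (x + y) = (\<lambda>t i. diag_param x t i + 1 * diag_param y t i)"
      using diag_param_linear[of x 1 y] by (intro ext) (simp add: cscale_def)
    then show ?thesis by (simp only: root_value_linear) simp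
  qed
  show "root_value r (diag_param (cscale c x)) = c * root_value r (diag_param x)" for r c x
  proof -
    have "diag_param 0 = (\<lambda>_ _. 0)" by (intro ext) (simp add: diag_param_def complex_op_zero)
    then have "diag_param (cscale c x) = (\<lambda>t i. (\<lambda>_ _. 0) t i + c * diag_param x t i)"
      using diag_param_linear[of 0 c x] by (intro ext) simp
    then have "root_value r (diag_param (cscale c x)) = root_value r (\<lambda>_ _. 0) + c * root_value r (diag_param x)" by (simp only: root_value_linear)
    moreover have "root_value r (\<lambda>_ _. 0) = 0" by (cases r) auto
    ultimately show ?thesis by simp
  qed
  have probe: "of_complex_op (diag_op (probe s)) \<in> cartan_H" "diag_param (of_complex_op (diag_op (probe s))) = probe s" for s
    using traceless_probe by (auto simp: cartan_H_def diag_param_diag_op)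
  show "\<exists>h\<in>cartan_H. root_value r (diag_param h) \<noteq> 0" if "r \<in> roots" for r
    using root_value_nonzero[OF that] probe by metis
  show "\<exists>h\<in>cartan_H. root_value r (diag_param h) \<noteq> root_value s (diag_param h)" if "r \<in> roots" "s \<in> roots" "r \<noteq> s" for r s
    using root_value_distinct[OF that(1,2)] that(3) probe by metis
  show "h = 0" if "h \<in> cartan_H" "\<And>r. r \<in> roots \<Longrightarrow> root_value r (diag_param h) = 0" for h
  proof -
    obtain x where x: "traceless x" "h = of_complex_op (diag_op x)" using \<open>h \<in> cartan_H\<close> by (auto simp: cartan_H_def)
    then have "x = (\<lambda>_ _. 0)" using that(2) by (intro root_value_separate) (auto simp: diag_param_diag_op)
    then show ?thesis using x of_complex_op_diag_op_zero by simp
  qed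
  show "\<exists>h\<in>cartan_H. \<exists>c. x = h + (\<Sum>r\<in>roots. cscale (c r) (of_complex_op (root_op r)))" if "x \<in> complexification sl3O" for x
    using sl3O_decomposition[OF that] .
  show "opposite r \<in> roots" if "r \<in> roots" for r by (rule opposite_roots[OF that])
  show "root_value (opposite r) (diag_param h) = - root_value r (diag_param h)" for r h by (rule root_value_opposite)
  show "cbracket commutator (of_complex_op (root_op r)) (of_complex_op (root_op (opposite r))) \<in> cartan_H" if "r \<in> roots" for r
    unfolding bracket_root_vectors_opposite[OF that] cartan_H_def using traceless_coroot by blast
  show "root_value r (diag_param (cbracket commutator (of_complex_op (root_op r)) (of_complex_op (root_op (opposite r))))) = 2" if "r \<in> roots" for r
    unfolding bracket_root_vectors_opposite[OF that] diag_param_diag_op[OF traceless_coroot] by (rule root_value_coroot[OF that])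
qed

section \<open>The type of the root system\<close>

text \<open>Bourbaki's numbering: the chain \<open>1, 3, 4, 5, 6\<close> consists of the first \<open>sl(3)\<close>, the central node and
the second \<open>sl(3)\<close>; node \<open>2\<close> comes from the third one.\<close>

definition simple :: "nat \<Rightarrow> root" where
  "simple n = [Dif 1 1 2, Dif 3 2 3, Dif 1 2 3, Pos 3 3 3, Dif 2 2 3, Dif 2 1 2] ! (n - 1)"

lemma atLeast1AtMost6: "{1..6::nat} = {1,2,3,4,5,6}"
  by auto

lemma simple_simps: "simple 1 = Dif 1 1 2" "simple 2 = Dif 3 2 3" "simple 3 = Dif 1 2 3"
  "simple 4 = Pos 3 3 3" "simple 5 = Dif 2 2 3" "simple 6 = Dif 2 1 2" "simple (Suc 0) = Dif 1 1 2"
  by (simp_all add: simple_def)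

lemma simple_roots: "i \<in> {1..6} \<Longrightarrow> simple i \<in> roots"
  unfolding atLeast1AtMost6 by (auto simp: simple_simps roots_def)

text \<open>The parameter on which the simple roots take the prescribed values \<open>a 1, \<dots>, a 6\<close>.\<close>

definition coweight :: "(nat \<Rightarrow> complex) \<Rightarrow> 3 \<Rightarrow> 3 \<Rightarrow> complex" where
  "coweight a = (let s = a 4 + (a 1 + 2 * a 3) / 3 + (a 6 + 2 * a 5) / 3 in
    row3 (row3 ((2 * a 1 + a 3) / 3) ((a 3 - a 1) / 3) (- (a 1 + 2 * a 3) / 3))
         (row3 ((2 * a 6 + a 5) / 3) ((a 5 - a 6) / 3) (- (a 6 + 2 * a 5) / 3))
         (row3 (- a 2 - 2 * s) (a 2 + s) s))"

lemma traceless_coweight: "traceless (coweight a)"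
  by (simp add: traceless_def coweight_def Let_def forall_3 sum_3 field_simps)

lemma root_value_coweight: "i \<in> {1..6} \<Longrightarrow> root_value (simple i) (coweight a) = a i"
  unfolding atLeast1AtMost6 by (auto simp: simple_simps coweight_def Let_def field_simps)

text \<open>The coefficients of \<open>x t i - x t 3\<close> with respect to the simple roots.  The entry for \<open>x 3 1 - x 3 3\<close> is
the simple root 2 minus the highest root: \<open>x 3 1 - x 3 2\<close> is the lowest root, the node removed from the
extended Dynkin diagram.\<close>

definition coord_coeff :: "3 \<Rightarrow> 3 \<Rightarrow> int list" where
  "coord_coeff = row3 (row3 [1,0,1,0,0,0] [0,0,1,0,0,0] [0,0,0,0,0,0])
     (row3 [0,0,0,0,1,1] [0,0,0,0,1,0] [0,0,0,0,0,0])
     (row3 [-1,-1,-2,-3,-2,-1] [0,1,0,0,0,0] [0,0,0,0,0,0])"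

fun simple_coeff :: "root \<Rightarrow> nat \<Rightarrow> int" where
  "simple_coeff (Dif t i j) n = coord_coeff t i ! (n - 1) - coord_coeff t j ! (n - 1)"
| "simple_coeff (Pos i j k) n = (if n = 4 then 1 else 0) + coord_coeff 1 i ! (n - 1) + coord_coeff 2 j ! (n - 1) + coord_coeff 3 k ! (n - 1)"
| "simple_coeff (Neg i j k) n = - ((if n = 4 then 1 else 0) + coord_coeff 1 i ! (n - 1) + coord_coeff 2 j ! (n - 1) + coord_coeff 3 k ! (n - 1))"

lemma sum_1_6: "(\<Sum>i=1..6. f i) = f 1 + f 2 + f 3 + f 4 + f 5 + f (6::nat)" for f :: "nat \<Rightarrow> complex"
  unfolding atLeast1AtMost6 by (simp add: add_ac)

lemma coord_coeff_diff:
  assumes "traceless x"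
  shows "x t i = x t 3 + (\<Sum>n=1..6. of_int (coord_coeff t i ! (n - 1)) * root_value (simple n) x)"
proof -
  have tr: "x t 3 = - x t 1 - x t 2" for t
    using assms by (simp add: traceless_def sum_3 add_eq_0_iff algebra_simps)
  show ?thesis
    unfolding sum_1_6 simple_simps using exhaust_3[of t] exhaust_3[of i]
    by (elim disjE) (simp_all add: coord_coeff_def tr)
qed

lemma root_value_coord_coeff:
  assumes "traceless x"
  shows "root_value r x = (\<Sum>n=1..6. of_int (simple_coeff r n) * root_value (simple n) x)"
proof -
  define f where "f t i = (\<Sum>n=1..6. of_int (coord_coeff t i ! (n - 1)) * root_value (simple n) x)" for t i
  have x: "x t i = x t 3 + f t i" for t i
    unfolding f_def by (rule coord_coeff_diff[OF assms])
  have 4: "(\<Sum>n=1..6. of_int (if n = 4 then 1 else 0) * root_value (simple n) x) = x 1 3 + x 2 3 + x 3 3"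
    unfolding sum_1_6 by (simp add: simple_simps)
  show ?thesis
  proof (cases r)
    case (Dif t i j)
    have "(\<Sum>n=1..6. of_int (simple_coeff r n) * root_value (simple n) x) = f t i - f t j"
      unfolding Dif simple_coeff.simps f_def by (simp add: left_diff_distrib sum_subtractf)
    then show ?thesis using x[of t i] x[of t j] by (simp add: Dif)
  next
    case (Pos i j k)
    have "(\<Sum>n=1..6. of_int (simple_coeff r n) * root_value (simple n) x) = (x 1 3 + x 2 3 + x 3 3) + f 1 i + f 2 j + f 3 k"
      unfolding Pos simple_coeff.simps f_def 4[symmetric] of_int_add distrib_right sum.distrib ..
    then show ?thesis using x[of 1 i] x[of 2 j] x[of 3 k] by (simp add: Pos)
  next
    case (Neg i j k)
    have "(\<Sum>n=1..6. of_int (simple_coeff r n) * root_value (simple n) x) = - ((x 1 3 + x 2 3 + x 3 3) + f 1 i + f 2 j + f 3 k)"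
      unfolding Neg simple_coeff.simps f_def 4[symmetric] of_int_add of_int_minus distrib_right sum.distrib sum_negf mult_minus_left ..
    then show ?thesis using x[of 1 i] x[of 2 j] x[of 3 k] by (simp add: Neg)
  qed
qed

lemma simple_coeff_sign:
  "(\<forall>n\<in>{1..6}. 0 \<le> simple_coeff r n) \<or> (\<forall>n\<in>{1..6}. simple_coeff r n \<le> 0)"
proof (cases r)
  case (Dif t i j)
  show ?thesis unfolding Dif atLeast1AtMost6 using exhaust_3[of t] exhaust_3[of i] exhaust_3[of j]
    by (elim disjE) (simp_all add: coord_coeff_def)
next
  case (Pos i j k)
  show ?thesis unfolding Pos atLeast1AtMost6 using exhaust_3[of i] exhaust_3[of j] exhaust_3[of k]
    by (elim disjE) (simp_all add: coord_coeff_def)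
next
  case (Neg i j k)
  show ?thesis unfolding Neg atLeast1AtMost6 using exhaust_3[of i] exhaust_3[of j] exhaust_3[of k]
    by (elim disjE) (simp_all add: coord_coeff_def)
qed

theorem sl3O_type_E6: "lie_algebra.has_type cscale (cbracket commutator) (complexification sl3O) 6 E6_cartan_matrix"
proof -
  interpret root_decomposition cscale "cbracket commutator" "complexification sl3O" cartan_H roots
     "\<lambda>r w. root_value r (diag_param w)" "\<lambda>r. of_complex_op (root_op r)" opposite
    by (rule root_decomposition_sl3O)
  show ?thesis
  proof (rule has_typeI[where \<beta> = simple])
    show "simple i \<in> roots" if "i \<in> {1..6}" for i using that by (rule simple_roots)
    show "c i = 0" if 0: "\<And>h. h \<in> cartan_H \<Longrightarrow> (\<Sum>i=1..6. c i * root_value (simple i) (diag_param h)) = 0" and i: "i \<in> {1..6}" for c i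
    proof -
      let ?x = "coweight (\<lambda>n. if n = i then 1 else 0)"
      have "of_complex_op (diag_op ?x) \<in> cartan_H" unfolding cartan_H_def using traceless_coweight by blast
      from 0[OF this] have "0 = (\<Sum>n=1..6. c n * root_value (simple n) ?x)"
        by (simp add: diag_param_diag_op[OF traceless_coweight])
      also have "\<dots> = (\<Sum>n=1..6. c n * (if n = i then 1 else 0))"
        by (intro sum.cong refl) (simp add: root_value_coweight)
      also have "\<dots> = c i" using i by (simp add: mult_delta_right)
      finally show ?thesis by simp
    qed
    show "\<exists>m :: nat \<Rightarrow> nat.
        (\<forall>h\<in>cartan_H. root_value r (diag_param h) = (\<Sum>i=1..6. of_nat (m i) * root_value (simple i) (diag_param h))) \<or>
        (\<forall>h\<in>cartan_H. root_value r (diag_param h) = - (\<Sum>i=1..6. of_nat (m i) * root_value (simple i) (diag_param h)))" for r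
    proof -
      have tl: "traceless (diag_param h)" if "h \<in> cartan_H" for h
        using that by (auto simp: cartan_H_def diag_param_diag_op)
      from simple_coeff_sign[of r] show ?thesis
      proof
        assume "\<forall>n\<in>{1..6}. 0 \<le> simple_coeff r n"
        then have "(\<Sum>i=1..6. of_nat (nat (simple_coeff r i)) * root_value (simple i) x) = (\<Sum>i=1..6. of_int (simple_coeff r i) * root_value (simple i) x)" for x
          by (intro sum.cong refl) (simp add: of_nat_nat)
        then show ?thesis using root_value_coord_coeff[OF tl, of _ r] by (intro exI[of _ "\<lambda>n. nat (simple_coeff r n)"]) simp
      next
        assume "\<forall>n\<in>{1..6}. simple_coeff r n \<le> 0"
        then have "- (\<Sum>i=1..6. of_nat (nat (- simple_coeff r i)) * root_value (simple i) x) = (\<Sum>i=1..6. of_int (simple_coeff r i) * root_value (simple i) x)" for x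
          unfolding sum_negf[symmetric] by (intro sum.cong refl) (simp add: of_nat_nat)
        then show ?thesis using root_value_coord_coeff[OF tl, of _ r] by (intro exI[of _ "\<lambda>n. nat (- simple_coeff r n)"]) simp
      qed
    qed
    show "root_value (simple j) (diag_param (cbracket commutator (of_complex_op (root_op (simple i))) (of_complex_op (root_op (opposite (simple i)))))) = of_int (E6_cartan_matrix i j)"
      if "i \<in> {1..6}" "j \<in> {1..6}" for i j
      unfolding bracket_root_vectors_opposite[OF simple_roots[OF that(1)]] diag_param_diag_op[OF traceless_coroot]
      using that unfolding atLeast1AtMost6 insert_iff empty_iff
      by (elim disjE FalseE; simp add: simple_simps E6_cartan_matrix_def doubleton_eq_iff)
  qed
qed

section \<open>The six generators\<close>

text \<open>Independence of a finite family in the form without repetitions: it yields both that the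
members are distinct and that their set is independent.\<close>

lemma distinct_independent:
  fixes f :: "nat \<Rightarrow> 'a::real_vector"
  assumes "\<And>c k. (\<Sum>i<n. c i *\<^sub>R f i) = 0 \<Longrightarrow> k < n \<Longrightarrow> c k = 0"
  shows "distinct (map f [0..<n])" "independent (f ` {..<n})"
proof -
  have inj: "inj_on f {..<n}"
  proof (rule inj_onI, rule ccontr)
    fix i j assume ij: "i \<in> {..<n}" "j \<in> {..<n}" "f i = f j" "i \<noteq> j"
    let ?c = "\<lambda>k. (if k = i then 1 else 0) - (if k = j then 1 else 0) :: real"
    have "(\<Sum>k<n. ?c k *\<^sub>R f k) = (\<Sum>k<n. (if k = i then f k else 0)) - (\<Sum>k<n. (if k = j then f k else 0))"
      unfolding sum_subtractf[symmetric] by (intro sum.cong) (auto simp: scaleR_left_diff_distrib)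
    also have "\<dots> = 0" using ij by simp
    finally have "?c i = 0" using assms[of ?c i] ij by blast
    then show False using ij by simp
  qed
  then show "distinct (map f [0..<n])" by (simp add: distinct_map atLeast0LessThan)
  show "independent (f ` {..<n})"
  proof (rule independent_if_scalars_zero)
    fix c x assume 0: "(\<Sum>x\<in>f ` {..<n}. c x *\<^sub>R x) = 0" and "x \<in> f ` {..<n}"
    then obtain k where k: "k < n" "x = f k" by auto
    have "(\<Sum>i<n. c (f i) *\<^sub>R f i) = 0" using 0 by (simp add: sum.reindex[OF inj])
    from assms[OF this k(1)] show "c x = 0" by (simp add: k)
  qed simp
qed

theorem mainTheorem5:
  shows "let curves = [B1tz, B2tz, R1xl, A_l, G_l, S1_l];
             elems = map dot curves;
             E = complexification sl3O;
             br = cbracket commutator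
         in (\<forall>\<gamma>\<in>set curves. (\<gamma> has_vector_derivative dot \<gamma>) (at 0)) \<and>
            set elems \<subseteq> sl3O \<and>
            distinct elems \<and> independent (set elems) \<and>
            (\<forall>x\<in>set elems. \<forall>y\<in>set elems. commutator x y = 0) \<and>
            lie_algebra cscale br E \<and>
            lie_algebra.cartan_subalgebra cscale br E (cplx.span ((\<lambda>x. (x, 0)) ` set elems)) \<and>
            lie_algebra.has_type cscale br E 6 E6_cartan_matrix"
proof -
  note derivs = B1tz_derivative B2tz_derivative R1xl_derivative A_l_derivative G_l_derivative S1_l_derivative
  have dot: "dot B1tz = diag_elem xB1" "dot B2tz = diag_elem xB2" "dot R1xl = diag_elem xRx" "dot A_l = diag_elem xA" "dot G_l = diag_elem xG" "dot S1_l = diag_elem xS"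
    unfolding dot_def using derivs by (simp_all add: vector_derivative_at)
  let ?xs = "[xB1, xB2, xRx, xA, xG, xS]"
  let ?f = "\<lambda>n. map diag_elem ?xs ! n"
  have elems: "map dot [B1tz, B2tz, R1xl, A_l, G_l, S1_l] = map diag_elem ?xs"
    by (simp add: dot)
  interpret root_decomposition cscale "cbracket commutator" "complexification sl3O" cartan_H roots
     "\<lambda>r w. root_value r (diag_param w)" "\<lambda>r. of_complex_op (root_op r)" opposite
    by (rule root_decomposition_sl3O)
  have tl: "\<forall>x\<in>set ?xs. traceless x" using traceless_x by simp
  have real: "\<forall>x\<in>set ?xs. of_complex_op (diag_op x) = (diag_elem x, 0)" using diag_elem_real_simps by simp
  have der: "\<forall>\<gamma>\<in>set [B1tz, B2tz, R1xl, A_l, G_l, S1_l]. (\<gamma> has_vector_derivative dot \<gamma>) (at 0)"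
    using derivs by (simp add: dot)
  have mem: "set (map diag_elem ?xs) \<subseteq> sl3O"
  proof -
    have "diag_elem x \<in> sl3O" if "x \<in> set ?xs" for x
    proof -
      have "of_complex_op (diag_op x) \<in> complexification sl3O"
        using tl that H_carrier unfolding cartan_H_def by blast
      then show ?thesis unfolding bspec[OF real that] complexification_def by simp
    qed
    then show ?thesis by auto
  qed
  have zero: "c k = 0" if sum: "(\<Sum>i<6. c i *\<^sub>R ?f i) = 0" and k: "k < 6" for c k
  proof -
    have "c 0 = 0 \<and> c 1 = 0 \<and> c 2 = 0 \<and> c 3 = 0 \<and> c 4 = 0 \<and> c 5 = 0"
      using diag_elem_independent[of "\<lambda>n. c (n - 1)"] sum by (simp add: eval_nat_numeral)
    moreover have "k \<in> {0,1,2,3,4,5}" using k by auto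
    ultimately show ?thesis by auto
  qed
  have six: "[0..<6] = [0,1,2,3,4,5]" "{..<6::nat} = {0,1,2,3,4,5}" by (auto simp: eval_nat_numeral)
  have di: "distinct (map ?f [0..<6])" "independent (?f ` {..<6})"
    by (rule distinct_independent; rule zero; assumption)+
  have dist: "distinct (map diag_elem ?xs)"
    using di(1) unfolding six by simp
  have ind: "independent (set (map diag_elem ?xs))"
    using di(2) unfolding six by simp
  have com: "commutator (diag_elem x) (diag_elem y) = 0" if "x \<in> set ?xs" "y \<in> set ?xs" for x y
    using bracket_diag_diag[of x y] unfolding bspec[OF real that(1)] bspec[OF real that(2)]
    by (simp add: cbracket_def commutator_def zero_prod_def)
  have H: "cplx.span ((\<lambda>x. (x, 0)) ` set (map diag_elem ?xs)) = cartan_H"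
    unfolding cartan_H_span by simp
  show ?thesis
    unfolding Let_def elems H
    using der mem dist ind com lie_algebra_sl3O cartan sl3O_type_E6 by auto
qed

end
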